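(* Let $F(x,y)\in\mathbb{Z}[x,y]$ be a diagonalizable form of degree $r\geq 5$ with discriminant $\Delta$, and let $h$ be a positive integer. Put $$\Delta'=\frac{|\Delta|}{2^{r^2-r}r^r h^{2r-2}}.$$ If $$\Delta'\geq r^{7r(r-1)/(r-4)}\,h^{(r-1)(r^2+r+2)/(r(r-4))},$$ then $$N_F(h)\leq \begin{cases} 3r & \text{if } D<0,\\ 6 & \text{if } D>0,\ r \text{ is even and } F \text{ is indefinite},\\ 3 & \text{if } D>0,\ r \text{ is odd and } F \text{ is indefinite},\\ 1 & \text{if } D>0 \text{ and } F \text{ is definite}.\end{cases}$$
   Context: A binary form $F(x,y)\in\mathbb{Z}[x,y]$ of degree $r$ is called diagonalizable if it can be written as $F(x,y)=(\alpha x+\beta y)^r-(\gamma x+\delta y)^r$ with (complex) constants $\alpha,\beta,\gamma,\delta$ satisfying $j=\alpha\delta-\beta\gamma\neq 0$. For such a form one can write $(\alpha x+\beta y)(\gamma x+\delta y)=\chi(Ax^2+Bxy+Cy^2)$ with $A,B,C\in\mathbb{Z}$ and a constant $\chi$; put $D=D(F)=B^2-4AC$ (which is nonzero). $F$ is definite if $F(x,y)$ takes values of only one strict sign for real $(x,y)\neq(0,0)$, and indefinite if it takes both signs. A solution $(x,y)\in\mathbb{Z}^2$ is primitive if $\gcd(x,y)=1$. $N_F(h)$ is the number of primitive solutions $(x,y)\in\mathbb{Z}^2$ of $0<|F(x,y)|\leq h$, where $(x,y)$ and $(-x,-y)$ are counted as one solution. *)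

theory Defs
  imports "HOL-Analysis.Analysis" "HOL-Library.Extended_Nat"
begin

text \<open>
  A binary form of degree \<open>r\<close> over the integers is given by its coefficients
  \<open>c 0, \<dots>, c r\<close>; entries of \<open>c\<close> beyond \<open>r\<close> are ignored. It can be evaluated in every
  commutative ring. Identities of forms are stated as identities of functions
  on \<open>\<complex>\<^sup>2\<close>, which is the same as equality of polynomials.
\<close>

definition form_eval :: "nat \<Rightarrow> (nat \<Rightarrow> int) \<Rightarrow> 'a::comm_ring_1 \<Rightarrow> 'a \<Rightarrow> 'a" where
  "form_eval r c x y = (\<Sum>i\<le>r. of_int (c i) * x ^ (r - i) * y ^ i)"

definition diagonalized_by ::
    "nat \<Rightarrow> (nat \<Rightarrow> int) \<Rightarrow> complex \<Rightarrow> complex \<Rightarrow> complex \<Rightarrow> complex \<Rightarrow> bool" where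
  "diagonalized_by r c \<alpha> \<beta> \<gamma> \<delta> \<longleftrightarrow>
     \<alpha> * \<delta> - \<beta> * \<gamma> \<noteq> 0 \<and>
     (\<forall>x y. form_eval r c x y = (\<alpha> * x + \<beta> * y) ^ r - (\<gamma> * x + \<delta> * y) ^ r)"

definition associated_quadratic ::
    "complex \<Rightarrow> complex \<Rightarrow> complex \<Rightarrow> complex \<Rightarrow> complex \<Rightarrow> int \<Rightarrow> int \<Rightarrow> int \<Rightarrow> bool" where
  "associated_quadratic \<alpha> \<beta> \<gamma> \<delta> \<kappa> A B C \<longleftrightarrow>
     (\<forall>x y. (\<alpha> * x + \<beta> * y) * (\<gamma> * x + \<delta> * y) =
            \<kappa> * (of_int A * x\<^sup>2 + of_int B * x * y + of_int C * y\<^sup>2))"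

text \<open>
  The discriminant of \<open>F = \<Prod>\<^sub>i (a\<^sub>i x - b\<^sub>i y)\<close> is
  \<open>\<Prod>\<^sub>i\<^sub><\<^sub>j (a\<^sub>i b\<^sub>j - a\<^sub>j b\<^sub>i)\<^sup>2\<close>. Every form of positive degree over the complex numbers
  factors in this way; that the value does not depend on the factorization is \<open>form_disc_eqI\<close> below.
\<close>

definition form_disc :: "nat \<Rightarrow> (nat \<Rightarrow> int) \<Rightarrow> complex" where
  "form_disc r c = (THE d. \<exists>a b :: nat \<Rightarrow> complex.
     (\<forall>x y. form_eval r c x y = (\<Prod>i<r. a i * x - b i * y)) \<and>
     d = (\<Prod>j<r. \<Prod>i<j. (a i * b j - a j * b i)\<^sup>2))"

definition definite_form :: "nat \<Rightarrow> (nat \<Rightarrow> int) \<Rightarrow> bool" where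
  "definite_form r c \<longleftrightarrow>
     (\<forall>x y::real. (x, y) \<noteq> (0, 0) \<longrightarrow> form_eval r c x y > 0) \<or>
     (\<forall>x y::real. (x, y) \<noteq> (0, 0) \<longrightarrow> form_eval r c x y < 0)"

definition indefinite_form :: "nat \<Rightarrow> (nat \<Rightarrow> int) \<Rightarrow> bool" where
  "indefinite_form r c \<longleftrightarrow>
     (\<exists>x y::real. form_eval r c x y > 0) \<and> (\<exists>x y::real. form_eval r c x y < 0)"

definition primitive_solutions :: "nat \<Rightarrow> (nat \<Rightarrow> int) \<Rightarrow> nat \<Rightarrow> (int \<times> int) set" where
  "primitive_solutions r c h =
     {(x, y). gcd x y = 1 \<and> 0 < \<bar>form_eval r c x y\<bar> \<and> \<bar>form_eval r c x y\<bar> \<le> int h}"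

text \<open>
  Solutions are counted up to sign. The count is \<open>\<infinity>\<close> for an infinite set (where
  \<^const>\<open>card\<close> is \<open>0\<close>), so an upper bound includes finiteness.
\<close>

definition num_solutions :: "nat \<Rightarrow> (nat \<Rightarrow> int) \<Rightarrow> nat \<Rightarrow> enat" where
  "num_solutions r c h =
     (let S = (\<lambda>(x, y). {(x, y), (- x, - y)}) ` primitive_solutions r c h
      in if finite S then enat (card S) else \<infinity>)"

definition normalized_disc :: "nat \<Rightarrow> (nat \<Rightarrow> int) \<Rightarrow> nat \<Rightarrow> real" where
  "normalized_disc r c h =
     cmod (form_disc r c) / (2 ^ (r\<^sup>2 - r) * real r ^ r * real h ^ (2 * r - 2))"

lemma prod_linear_forms_cancel:
  fixes a b \<mu> x y :: complex and p q :: "'i \<Rightarrow> complex" and p' q' :: "'j \<Rightarrow> complex"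
  assumes "finite I" "finite J" "(a, b) \<noteq> (0, 0)"
    and eq: "\<And>x y. (a * x - b * y) * (\<Prod>i\<in>I. p i * x - q i * y) =
              (a * x - b * y) * (\<mu> * (\<Prod>i\<in>J. p' i * x - q' i * y))"
  shows "(\<Prod>i\<in>I. p i * x - q i * y) = \<mu> * (\<Prod>i\<in>J. p' i * x - q' i * y)"
proof -
  let ?L = "\<lambda>t. a * (x + t * cnj a) - b * (y - t * cnj b)"
  let ?f = "\<lambda>t. \<Prod>i\<in>I. p i * (x + t * cnj a) - q i * (y - t * cnj b)"
  let ?g = "\<lambda>t. \<mu> * (\<Prod>i\<in>J. p' i * (x + t * cnj a) - q' i * (y - t * cnj b))"
  define n where "n = a * cnj a + b * cnj b"
  have "n = of_real ((cmod a)\<^sup>2 + (cmod b)\<^sup>2)"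
    by (simp only: n_def complex_norm_square of_real_add)
  moreover have "(cmod a)\<^sup>2 + (cmod b)\<^sup>2 \<noteq> 0"
    using assms(3) by (auto simp: sum_power2_eq_zero_iff)
  ultimately have n: "n \<noteq> 0"
    by (metis of_real_eq_0_iff)
  have L: "?L t = ?L 0 + t * n" for t
    by (simp add: n_def algebra_simps)
  have ne: "?f t = ?g t" if "t \<noteq> - ?L 0 / n" for t
  proof -
    have "?L t \<noteq> 0"
    proof
      assume "?L t = 0"
      hence "t * n = - ?L 0" using L[of t] by (metis add_eq_0_iff)
      thus False using that n by (simp add: field_simps)
    qed
    thus ?thesis using eq[of "x + t * cnj a" "y - t * cnj b"] by simp
  qed
  have "continuous_on UNIV (\<lambda>t. ?f t - ?g t)"
    by (intro continuous_intros)
  hence "isCont (\<lambda>t. ?f t - ?g t) 0"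
    by (simp add: continuous_on_eq_continuous_at)
  hence lim: "((\<lambda>t. ?f t - ?g t) \<longlongrightarrow> ?f 0 - ?g 0) (at 0)"
    by (simp add: isCont_def)
  have "\<forall>\<^sub>F t in at 0. t \<noteq> - ?L 0 / n"
    by (rule eventually_neq_at_within)
  hence "\<forall>\<^sub>F t in at 0. ?f t - ?g t = 0"
    by eventually_elim (use ne in simp)
  hence "((\<lambda>t. ?f t - ?g t) \<longlongrightarrow> 0) (at 0)"
    by (rule tendsto_eventually)
  from tendsto_unique[OF _ lim this] show ?thesis by simp
qed

lemma prod_linear_forms_eq_0:
  fixes a b :: "'i \<Rightarrow> complex"
  assumes "finite I" and "\<And>x y. (\<Prod>i\<in>I. a i * x - b i * y) = 0"
  shows "\<exists>i\<in>I. a i = 0 \<and> b i = 0"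
  using assms
proof (induction I rule: finite_induct)
  case empty
  thus ?case by simp
next
  case (insert k I)
  show ?case
  proof (cases "(a k, b k) = (0, 0)")
    case False
    have "(\<Prod>i\<in>I. a i * x - b i * y) = 0 * (\<Prod>i\<in>I. a i * x - b i * y)" for x y
      by (rule prod_linear_forms_cancel[OF insert.hyps(1) insert.hyps(1) False])
         (use insert in auto)
    hence "(\<Prod>i\<in>I. a i * x - b i * y) = 0" for x y
      by simp
    from insert.IH[OF this] show ?thesis by auto
  qed auto
qed

lemma disc_insert:
  fixes a b :: "'i \<Rightarrow> complex"
  assumes "finite I" "k \<notin> I"
  shows "(\<Prod>i\<in>insert k I. \<Prod>j\<in>insert k I - {i}. a i * b j - a j * b i) =
    (\<Prod>j\<in>I. - (a j * b k - b j * a k)\<^sup>2) * (\<Prod>i\<in>I. \<Prod>j\<in>I - {i}. a i * b j - a j * b i)"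
proof -
  have "(\<Prod>i\<in>I. \<Prod>j\<in>insert k I - {i}. a i * b j - a j * b i) =
        (\<Prod>i\<in>I. (a i * b k - a k * b i) * (\<Prod>j\<in>I - {i}. a i * b j - a j * b i))"
  proof (rule prod.cong[OF refl])
    fix i assume "i \<in> I"
    hence "insert k I - {i} = insert k (I - {i})" using assms by auto
    thus "(\<Prod>j\<in>insert k I - {i}. a i * b j - a j * b i) =
      (a i * b k - a k * b i) * (\<Prod>j\<in>I - {i}. a i * b j - a j * b i)"
      using assms by simp
  qed
  moreover have "insert k I - {k} = I" using assms by auto
  ultimately have "(\<Prod>i\<in>insert k I. \<Prod>j\<in>insert k I - {i}. a i * b j - a j * b i) =
    (\<Prod>j\<in>I. (a k * b j - a j * b k) * (a j * b k - a k * b j)) *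
      (\<Prod>i\<in>I. \<Prod>j\<in>I - {i}. a i * b j - a j * b i)"
    using assms by (simp add: prod.distrib mult.assoc)
  also have "(\<Prod>j\<in>I. (a k * b j - a j * b k) * (a j * b k - a k * b j)) =
      (\<Prod>j\<in>I. - (a j * b k - b j * a k)\<^sup>2)"
    by (intro prod.cong refl) (simp add: power2_eq_square algebra_simps)
  finally show ?thesis .
qed

lemma disc_unique_aux:
  fixes a b :: "'i \<Rightarrow> complex" and a' b' :: "'j \<Rightarrow> complex"
  assumes "finite I" "finite J" "card I = card J" "\<mu> \<noteq> 0"
    and "\<And>x y. (\<Prod>i\<in>I. a i * x - b i * y) = \<mu> * (\<Prod>i\<in>J. a' i * x - b' i * y)"
    and "\<And>i. i \<in> I \<Longrightarrow> (a i, b i) \<noteq> (0, 0)"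
  shows "\<mu>\<^sup>2 * (\<Prod>i\<in>I. \<Prod>j\<in>I - {i}. a i * b j - a j * b i) =
    \<mu> ^ (2 * card I) * (\<Prod>i\<in>J. \<Prod>j\<in>J - {i}. a' i * b' j - a' j * b' i)"
  using assms
proof (induction I arbitrary: J \<mu> rule: finite_induct)
  case empty
  hence "J = {}" by simp
  with empty.prems(4) show ?case by simp
next
  case (insert k I)
  note F = insert.prems(4)
  have "(\<Prod>i\<in>J. a' i * b k - b' i * a k) = 0"
    using F[of "b k" "a k"] insert.hyps insert.prems(3) by simp
  then obtain l where l: "l \<in> J" "a' l * b k - b' l * a k = 0"
    using insert.prems(1) by auto
  define K where "K = J - {l}"
  have K: "finite K" "l \<notin> K" "J = insert l K" "card K = card I"
    using l insert.prems(1,2) insert.hyps by (auto simp: K_def)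
  have "\<not> (\<exists>i\<in>insert k I. a i = 0 \<and> b i = 0)"
    using insert.prems(5) by auto
  then obtain x0 y0 where "(\<Prod>i\<in>insert k I. a i * x0 - b i * y0) \<noteq> 0"
    using prod_linear_forms_eq_0[of "insert k I" a b] insert.hyps by blast
  hence "(\<Prod>i\<in>J. a' i * x0 - b' i * y0) \<noteq> 0"
    using F[of x0 y0] by auto
  hence l0: "(a' l, b' l) \<noteq> (0, 0)"
    using l(1) insert.prems(1) by auto
  have k0: "(a k, b k) \<noteq> (0, 0)"
    using insert.prems(5) by blast
  obtain s where s: "a' l = s * a k" "b' l = s * b k"
  proof (cases "a k = 0")
    case True
    with k0 l(2) have "a' l = (b' l / b k) * a k" "b' l = (b' l / b k) * b k" by auto
    thus ?thesis using that by blast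
  next
    case False
    with l(2) have "a' l = (a' l / a k) * a k" "b' l = (a' l / a k) * b k"
      by (auto simp: field_simps)
    thus ?thesis using that by blast
  qed
  have s0: "s \<noteq> 0" using l0 s by auto
  have G: "(\<Prod>i\<in>I. a i * x - b i * y) = (\<mu> * s) * (\<Prod>i\<in>K. a' i * x - b' i * y)" for x y
  proof (rule prod_linear_forms_cancel[OF insert.hyps(1) K(1) k0])
    fix x y
    have "(a k * x - b k * y) * (\<Prod>i\<in>I. a i * x - b i * y) =
        \<mu> * ((s * a k * x - s * b k * y) * (\<Prod>i\<in>K. a' i * x - b' i * y))"
      using F[of x y] insert.hyps K s by simp
    thus "(a k * x - b k * y) * (\<Prod>i\<in>I. a i * x - b i * y) =
        (a k * x - b k * y) * ((\<mu> * s) * (\<Prod>i\<in>K. a' i * x - b' i * y))"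
      by (simp add: algebra_simps)
  qed
  define P where "P = (\<Prod>j\<in>K. a' j * b k - b' j * a k)"
  define n where "n = card I"
  define E where "E = (\<Prod>i\<in>I. \<Prod>j\<in>I - {i}. a i * b j - a j * b i)"
  define E' where "E' = (\<Prod>i\<in>K. \<Prod>j\<in>K - {i}. a' i * b' j - a' j * b' i)"
  have 1: "(\<Prod>j\<in>I. - (a j * b k - b j * a k)\<^sup>2) = (-1) ^ n * (\<mu> * s * P)\<^sup>2"
    using G[of "b k" "a k"]
    by (simp add: P_def n_def prod_power_distrib[symmetric] prod_uminus)
  have "(\<Prod>j\<in>K. - (a' j * b' l - b' j * a' l)\<^sup>2) =
        (\<Prod>j\<in>K. - (s * (a' j * b k - b' j * a k))\<^sup>2)"
    by (intro prod.cong refl) (simp add: s algebra_simps)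
  also have "\<dots> = (-1) ^ n * (s ^ n * P)\<^sup>2"
    using K(4) by (simp add: P_def n_def prod_power_distrib[symmetric] prod_uminus prod.distrib power_mult_distrib
        power_mult[symmetric] mult.commute)
  finally have 2: "(\<Prod>j\<in>K. - (a' j * b' l - b' j * a' l)\<^sup>2) = (-1) ^ n * (s ^ n * P)\<^sup>2" .
  have IH: "(\<mu> * s)\<^sup>2 * E = (\<mu> * s) ^ (2 * n) * E'"
    unfolding E_def E'_def n_def
    by (rule insert.IH) (use K insert.prems(3,5) s0 G in auto)
  have "\<mu>\<^sup>2 * ((-1) ^ n * (\<mu> * s * P)\<^sup>2 * E) =
        \<mu> ^ (2 * Suc n) * ((-1) ^ n * (s ^ n * P)\<^sup>2 * E')"
  proof -
    from IH have "\<mu>\<^sup>2 * (-1) ^ n * P\<^sup>2 * ((\<mu> * s)\<^sup>2 * E) = \<mu>\<^sup>2 * (-1) ^ n * P\<^sup>2 * ((\<mu> * s) ^ (2 * n) * E')"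
      by simp
    thus ?thesis
      by (simp add: power_mult_distrib power_mult power_add mult_ac power2_eq_square)
  qed
  thus ?case
    unfolding K(3) disc_insert[OF insert.hyps(1,2)] disc_insert[OF K(1,2)] 1 2
      card_insert_disjoint[OF insert.hyps(1,2)] E_def E'_def n_def .
qed

lemma prod_pairs_eq:
  fixes a b :: "nat \<Rightarrow> complex"
  shows "(\<Prod>i<r. \<Prod>j\<in>{..<r} - {i}. a i * b j - a j * b i) =
    (-1) ^ (\<Sum>j<r. j) * (\<Prod>j<r. \<Prod>i<j. (a i * b j - a j * b i)\<^sup>2)"
proof (induction r)
  case 0
  show ?case by simp
next
  case (Suc r)
  have "(\<Prod>i<r. - (a i * b r - b i * a r)\<^sup>2) = (-1) ^ r * (\<Prod>i<r. (a i * b r - a r * b i)\<^sup>2)"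
    by (simp add: prod_uminus mult.commute)
  thus ?case
    using Suc unfolding lessThan_Suc by (subst disc_insert) (simp_all add: power_add mult_ac)
qed

lemma disc_unique:
  fixes a b a' b' :: "nat \<Rightarrow> complex"
  assumes "\<And>x y. (\<Prod>i<r. a i * x - b i * y) = (\<Prod>i<r. a' i * x - b' i * y)"
  shows "(\<Prod>j<r. \<Prod>i<j. (a i * b j - a j * b i)\<^sup>2) =
    (\<Prod>j<r. \<Prod>i<j. (a' i * b' j - a' j * b' i)\<^sup>2)"
proof -
  let ?E = "\<lambda>a b :: nat \<Rightarrow> complex. \<Prod>i<r. \<Prod>j\<in>{..<r} - {i}. a i * b j - a j * b i"
  have zero: "?E a b = 0"
    if that: "r \<noteq> 1" "k < r" "a k = 0" "b k = 0" for a b :: "nat \<Rightarrow> complex" and k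
  proof -
    define j where "j = (if k = 0 then 1 else 0 :: nat)"
    have "j < r" "j \<noteq> k" using that(1,2) by (auto simp: j_def)
    hence "(\<Prod>j\<in>{..<r} - {k}. a k * b j - a j * b k) = 0"
      using that by (intro prod_zero) auto
    thus ?thesis using that(2) by (intro prod_zero) auto
  qed
  have "?E a b = ?E a' b'"
  proof (cases "\<exists>k<r. a k = 0 \<and> b k = 0")
    case True
    then obtain k where k: "k < r" "a k = 0" "b k = 0" by blast
    have "(\<Prod>i<r. a i * x - b i * y) = 0" for x y
      using k by (intro prod_zero) (auto intro!: bexI[of _ k])
    then obtain l where l: "l < r" "a' l = 0" "b' l = 0"
      using prod_linear_forms_eq_0[of "{..<r}" a' b'] assms by auto
    show ?thesis
    proof (cases "r = 1")
      case False
      show ?thesis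
        unfolding zero[of k a b, OF False k] zero[of l a' b', OF False l] ..
    qed (simp add: lessThan_Suc)
  next
    case False
    thus ?thesis
      using disc_unique_aux[of "{..<r}" "{..<r}" 1 a b a' b'] assms by auto
  qed
  thus ?thesis by (simp add: prod_pairs_eq)
qed

lemma form_disc_eqI:
  assumes "\<And>x y :: complex. form_eval r c x y = (\<Prod>i<r. a i * x - b i * y)"
  shows "form_disc r c = (\<Prod>j<r. \<Prod>i<j. (a i * b j - a j * b i)\<^sup>2)"
  unfolding form_disc_def
proof (rule the_equality)
  show "\<exists>a' b'. (\<forall>x y. form_eval r c x y = (\<Prod>i<r. a' i * x - b' i * y)) \<and>
    (\<Prod>j<r. \<Prod>i<j. (a i * b j - a j * b i)\<^sup>2) = (\<Prod>j<r. \<Prod>i<j. (a' i * b' j - a' j * b' i)\<^sup>2)"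
    using assms by blast
next
  fix d
  assume "\<exists>a' b' :: nat \<Rightarrow> complex. (\<forall>x y. form_eval r c x y = (\<Prod>i<r. a' i * x - b' i * y)) \<and>
    d = (\<Prod>j<r. \<Prod>i<j. (a' i * b' j - a' j * b' i)\<^sup>2)"
  then obtain a' b' where *: "\<And>x y :: complex. form_eval r c x y = (\<Prod>i<r. a' i * x - b' i * y)"
    "d = (\<Prod>j<r. \<Prod>i<j. (a' i * b' j - a' j * b' i)\<^sup>2)" by blast
  have "(\<Prod>i<r. a' i * x - b' i * y) = (\<Prod>i<r. a i * x - b i * y)" for x y
    using assms[of x y] *(1)[of x y] by simp
  from disc_unique[OF this] *(2)
  show "d = (\<Prod>j<r. \<Prod>i<j. (a i * b j - a j * b i)\<^sup>2)" by simp
qed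

text \<open>
  For \<open>r \<ge> 3\<close> every diagonalization has an associated integral quadratic form, which is
  unique up to a rational factor; so the sign of its discriminant is well defined.
\<close>

lemma associated_quadratic_exists:
  assumes "r \<ge> 3" "diagonalized_by r c \<alpha> \<beta> \<gamma> \<delta>"
  shows "\<exists>\<kappa> A B C. associated_quadratic \<alpha> \<beta> \<gamma> \<delta> \<kappa> A B C"
proof -
  define j where "j = \<alpha> * \<delta> - \<beta> * \<gamma>"
  have j: "j \<noteq> 0" using assms(2) by (simp add: j_def diagonalized_by_def)
  define s where "s i = \<alpha> ^ (r - i) * \<beta> ^ i - \<gamma> ^ (r - i) * \<delta> ^ i" for i
  define S where "S i = c i * int (fact i * fact (r - i))" for i
  have coeff: "of_int (c i) = of_nat (r choose i) * s i" if "i \<le> r" for i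
  proof -
    have "(\<Sum>i\<le>r. of_int (c i) * y ^ i) = (\<Sum>i\<le>r. of_nat (r choose i) * s i * y ^ i)" for y :: complex
    proof -
      have "(\<Sum>i\<le>r. of_int (c i) * y ^ i) = form_eval r c 1 y"
        by (simp add: form_eval_def)
      also have "\<dots> = (\<beta> * y + \<alpha>) ^ r - (\<delta> * y + \<gamma>) ^ r"
        using assms(2) by (simp add: diagonalized_by_def add.commute)
      also have "\<dots> = (\<Sum>i\<le>r. of_nat (r choose i) * s i * y ^ i)"
        unfolding binomial_ring s_def sum_subtractf[symmetric]
        by (simp add: power_mult_distrib algebra_simps)
      finally show ?thesis .
    qed
    thus ?thesis using that polyfun_eq_coeffs[of "\<lambda>i. of_int (c i)" r "\<lambda>i. of_nat (r choose i) * s i"]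
      by blast
  qed
  have S: "of_int (S i) = fact r * s i" if "i \<le> r" for i
  proof -
    have "(fact r :: complex) = of_nat (fact i * fact (r - i) * (r choose i))"
      using binomial_fact_lemma[OF that] by simp
    thus ?thesis using coeff[OF that] by (simp add: S_def mult_ac)
  qed
  have *: ?thesis if i: "i + 3 \<le> r" and ne: "(\<alpha> * \<gamma>) ^ (r - i - 3) * (\<beta> * \<delta>) ^ i \<noteq> 0" for i
  proof -
    define A where "A = S (i + 1) * S (i + 1) - S i * S (i + 2)"
    define B where "B = S (i + 1) * S (i + 2) - S i * S (i + 3)"
    define C where "C = S (i + 2) * S (i + 2) - S (i + 1) * S (i + 3)"
    define w where "w = fact r * fact r * j\<^sup>2 * ((\<alpha> * \<gamma>) ^ (r - i - 3) * (\<beta> * \<delta>) ^ i)"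
    have w: "w \<noteq> 0" using ne j unfolding w_def by simp
    define m where "m = r - i - 3"
    have r: "r = m + i + 3" using i by (simp add: m_def)
    define U where "U = \<alpha> ^ m * \<beta> ^ i"
    define V where "V = \<gamma> ^ m * \<delta> ^ i"
    have "m + i + 3 - i = m + 3" "m + i + 3 - (i + 1) = m + 2" "m + i + 3 - (i + 2) = m + 1"
      "m + i + 3 - (i + 3) = m" by simp_all
    hence s: "s i = \<alpha> ^ 3 * U - \<gamma> ^ 3 * V"
      "s (i + 1) = \<alpha>\<^sup>2 * \<beta> * U - \<gamma>\<^sup>2 * \<delta> * V"
      "s (i + 2) = \<alpha> * \<beta>\<^sup>2 * U - \<gamma> * \<delta>\<^sup>2 * V"
      "s (i + 3) = \<beta> ^ 3 * U - \<delta> ^ 3 * V"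
      unfolding s_def r U_def V_def by (simp_all add: power_add power2_eq_square mult_ac)
    have w_eq: "w = fact r * fact r * ((\<alpha> * \<delta> - \<beta> * \<gamma>)\<^sup>2 * U * V)"
      unfolding w_def U_def V_def j_def m_def[symmetric] by (simp add: power_mult_distrib mult_ac)
    have S': "of_int (S i) = fact r * s i" "of_int (S (i + 1)) = fact r * s (i + 1)"
      "of_int (S (i + 2)) = fact r * s (i + 2)" "of_int (S (i + 3)) = fact r * s (i + 3)"
      by (rule S; use i in simp)+
    have "of_int A = fact r * fact r * (s (i + 1) * s (i + 1) - s i * s (i + 2))"
      "of_int B = fact r * fact r * (s (i + 1) * s (i + 2) - s i * s (i + 3))"
      "of_int C = fact r * fact r * (s (i + 2) * s (i + 2) - s (i + 1) * s (i + 3))"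
      unfolding A_def B_def C_def of_int_diff of_int_mult S' by (simp_all only: algebra_simps)
    moreover have "s (i + 1) * s (i + 1) - s i * s (i + 2) = (\<alpha> * \<delta> - \<beta> * \<gamma>)\<^sup>2 * U * V * (\<alpha> * \<gamma>)"
      "s (i + 1) * s (i + 2) - s i * s (i + 3) = (\<alpha> * \<delta> - \<beta> * \<gamma>)\<^sup>2 * U * V * ((\<alpha> * \<delta> + \<beta> * \<gamma>))"
      "s (i + 2) * s (i + 2) - s (i + 1) * s (i + 3) = (\<alpha> * \<delta> - \<beta> * \<gamma>)\<^sup>2 * U * V * (\<beta> * \<delta>)"
      unfolding s by algebra+
    ultimately have "of_int A = w * (\<alpha> * \<gamma>)" "of_int B = w * (\<alpha> * \<delta> + \<beta> * \<gamma>)" "of_int C = w * (\<beta> * \<delta>)"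
      unfolding w_eq by (simp_all only: mult.assoc)
    hence "associated_quadratic \<alpha> \<beta> \<gamma> \<delta> (1 / w) A B C"
      using w by (simp add: associated_quadratic_def power2_eq_square field_simps)
    thus ?thesis by blast
  qed
  show ?thesis
  proof -
    consider "\<alpha> * \<gamma> \<noteq> 0" | "\<beta> * \<delta> \<noteq> 0" | "\<alpha> * \<gamma> = 0" "\<beta> * \<delta> = 0" by blast
    thus ?thesis
    proof cases
      case 1
      thus ?thesis using *[of 0] assms(1) by simp
    next
      case 2
      thus ?thesis using *[of "r - 3"] assms(1) by simp
    next
      case 3
      hence "associated_quadratic \<alpha> \<beta> \<gamma> \<delta> (\<alpha> * \<delta> + \<beta> * \<gamma>) 0 1 0"
        by (auto simp: associated_quadratic_def algebra_simps)
      thus ?thesis by blast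
    qed
  qed
qed

end

theory Submission
  imports Defs "HOL-Computational_Algebra.Fundamental_Theorem_Algebra" "HOL-Number_Theory.Cong"
begin

text \<open>
  Put \<open>\<xi> = \<alpha>x + \<beta>y\<close> and \<open>\<eta> = \<gamma>x + \<delta>y\<close>, so that \<open>F = \<xi>\<^sup>r - \<eta>\<^sup>r\<close>. At a solution where \<open>\<xi>\<close> is large, \<open>\<eta>/\<xi>\<close>
  is close to an \<open>r\<close>-th root of unity \<open>\<omega>\<close>; large solutions with the same \<open>\<omega>\<close> form a class. The
  argument shows that a class has at most two members and that, up to sign, at most one solution
  fails to be large. Hence there are at most \<open>2k + 1\<close> solutions if there are \<open>k\<close> classes. In general
  \<open>k \<le> r\<close>. If \<open>D > 0\<close>, then the linear forms are real up to a constant factor, all \<open>\<omega>\<close> lie on one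
  line through \<open>0\<close>, and \<open>k \<le> 2\<close>, even \<open>k \<le> 1\<close> for odd \<open>r\<close>. If moreover the form is definite, then
  \<open>|F| = |\<xi>|\<^sup>r + |\<eta>|\<^sup>r\<close> and no solution is large.

  Everything rests on lower bounds for \<open>|\<xi>(P)\<eta>(Q) - \<xi>(Q)\<eta>(P)|\<close>. This expression is \<open>j\<close> times the
  determinant of the integer points \<open>P\<close> and \<open>Q\<close>, so it is at least \<open>|j|\<close> unless they are
  proportional. If both points are small, it is too small, which leaves a single small solution
  (\<open>small_solutions_proportional\<close>). If both are large and in the same class, the two products nearly
  cancel, which forces the larger point to be much larger than the smaller one (\<open>gap_principle\<close>).

  To exclude a third member \<open>S\<close> of a class that contains \<open>P\<close> and \<open>Q\<close>, with \<open>|\<xi>|\<close> increasing from \<open>P\<close>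
  to \<open>S\<close>, the hypergeometric method of Thue and Siegel replaces the determinant by
  \<open>\<Lambda>\<^sub>n = \<xi>(Q) \<eta>(S) p\<^sub>n(w) - \<xi>(S) \<eta>(Q) q\<^sub>n(w)\<close>, where \<open>w = (\<eta>(Q)/\<xi>(Q))\<^sup>r\<close> and \<open>p\<^sub>n/q\<^sub>n\<close> is the diagonal
  Pade approximant of \<open>w\<^bsup>1/r\<^esup>\<close> at \<open>w = 1\<close>. Its two terms are, after multiplication by the same factor,
  conjugate integers of \<open>\<rat>(\<surd>D)\<close> times \<open>\<kappa>\<close>, so \<open>\<Lambda>\<^sub>n\<close> times this factor is an integral multiple of \<open>j\<close>
  (\<open>pade_form_integrality\<close>). The remainder estimate \<open>pade_approx\<close> bounds it by less than \<open>|j|\<close>,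
  provided that \<open>n\<close> is adapted to the size of \<open>S\<close>; as \<open>Q\<close> is already huge by the gap principle,
  two consecutive \<open>n\<close> are suitable (\<open>choose_pade_index\<close>). For these \<open>\<Lambda>\<^sub>n = 0\<close>, which contradicts
  \<open>p\<^sub>n q\<^sub>n\<^sub>+\<^sub>1 \<noteq> p\<^sub>n\<^sub>+\<^sub>1 q\<^sub>n\<close> (\<open>pade_determinant_nonzero\<close>).

  The discriminant enters through \<open>|\<Delta>| = |j|\<^bsup>r(r-1)\<^esup> r\<^sup>r\<close>, which turns the hypothesis into a lower
  bound for \<open>L = |j|/2\<close> in terms of \<open>r\<close> and \<open>h\<close> (\<open>half_jdet_lower_bounds\<close>).
\<close>

section \<open>Diagonal Pade approximants of a power function\<close>

text \<open>
  By Pascal's rule the sum for \<open>n + 1\<close> is the sum for \<open>n\<close> at \<open>x\<close> minus the sum for \<open>n\<close> at \<open>x - 1\<close>,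
  and the closed form satisfies the same recursion.
\<close>

lemma alternating_partial_fraction:
  fixes x :: "'a::field_char_0"
  assumes "\<And>b. b \<le> n \<Longrightarrow> x \<noteq> of_nat b"
  shows "(\<Sum>b\<le>n. (-1) ^ b * of_nat (n choose b) / (x - of_nat b)) = - fact n / pochhammer (- x) (Suc n)"
  using assms
proof (induction n arbitrary: x)
  case 0
  thus ?case by simp
next
  case (Suc n)
  have nz: "x - of_nat b \<noteq> 0" if "b \<le> Suc n" for b
    using Suc.prems[OF that] by simp
  have ne: "x - 1 \<noteq> of_nat b" if "b \<le> n" for b
    using Suc.prems[of "Suc b"] that by (auto simp: algebra_simps)
  have "(\<Sum>b\<le>Suc n. (-1) ^ b * of_nat (Suc n choose b) / (x - of_nat b)) =
      1 / x + (\<Sum>b\<le>n. (-1) ^ Suc b * of_nat (n choose Suc b) / (x - of_nat (Suc b)))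
            + (\<Sum>b\<le>n. (-1) ^ Suc b * of_nat (n choose b) / (x - of_nat (Suc b)))"
    by (subst sum.atMost_Suc_shift)
       (simp add: sum.distrib[symmetric] ring_distribs
           add_divide_distrib diff_divide_distrib algebra_simps)
  also have "1 / x + (\<Sum>b\<le>n. (-1) ^ Suc b * of_nat (n choose Suc b) / (x - of_nat (Suc b)))
      = (\<Sum>b\<le>Suc n. (-1) ^ b * of_nat (n choose b) / (x - of_nat b))"
    by (subst sum.atMost_Suc_shift) simp
  also have "\<dots> = (\<Sum>b\<le>n. (-1) ^ b * of_nat (n choose b) / (x - of_nat b))"
    by simp
  also have "\<dots> = - fact n / pochhammer (- x) (Suc n)"
    using Suc.IH[of x] Suc.prems by simp
  also have "(\<Sum>b\<le>n. (-1) ^ Suc b * of_nat (n choose b) / (x - of_nat (Suc b))) =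
      - (\<Sum>b\<le>n. (-1) ^ b * of_nat (n choose b) / ((x - 1) - of_nat b))"
    by (simp add: sum_negf[symmetric] algebra_simps)
  also have "\<dots> = fact n / pochhammer (1 - x) (Suc n)"
    using Suc.IH[of "x - 1"] ne by simp
  finally have 1: "(\<Sum>b\<le>Suc n. (-1) ^ b * of_nat (Suc n choose b) / (x - of_nat b)) =
     fact n / pochhammer (1 - x) (Suc n) - fact n / pochhammer (- x) (Suc n)" by simp
  have p: "pochhammer (- x) (Suc (Suc n)) = - x * pochhammer (1 - x) (Suc n)"
    "pochhammer (- x) (Suc (Suc n)) = pochhammer (- x) (Suc n) * (of_nat (Suc n) - x)"
    using pochhammer_rec[of "-x" "Suc n"] pochhammer_Suc[of "-x" "Suc n"] by simp_all
  have nz': "pochhammer (- x) (Suc (Suc n)) \<noteq> 0"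
    using Suc.prems by (auto simp: pochhammer_eq_0_iff)
  have "fact n / pochhammer (1 - x) (Suc n) = - x * fact n / pochhammer (- x) (Suc (Suc n))"
    using p(1) nz' by (simp add: divide_simps)
  moreover have "fact n / pochhammer (- x) (Suc n) = (of_nat (Suc n) - x) * fact n
      / pochhammer (- x) (Suc (Suc n))"
    using p(2) nz' by (simp add: divide_simps)
  ultimately have "fact n / pochhammer (1 - x) (Suc n) - fact n / pochhammer (- x) (Suc n) =
      (- x * fact n - (of_nat (Suc n) - x) * fact n) / pochhammer (- x) (Suc (Suc n))"
    by (simp only: diff_divide_distrib)
  also have "- x * fact n - (of_nat (Suc n) - x) * fact n = - fact (Suc n)"
    by (simp add: algebra_simps)
  finally show ?case unfolding 1 by simp
qed

text \<open>
  In this normalization the approximant is symmetric: \<open>pade n \<nu>\<close> is the numerator and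
  \<open>pade n (- \<nu>)\<close> the denominator of the approximant of \<open>w\<^sup>\<nu>\<close>, and \<open>w \<mapsto> 1/w\<close> exchanges the two up to
  the factor \<open>w\<^sup>n\<close> (\<open>pade_coeff_flip\<close>). In the application this symmetry becomes conjugation.
\<close>

definition pade_coeff :: "nat \<Rightarrow> real \<Rightarrow> nat \<Rightarrow> real" where
  "pade_coeff n \<nu> a = ((real n + \<nu>) gchoose a) * ((real n - \<nu>) gchoose (n - a))"

definition pade :: "nat \<Rightarrow> real \<Rightarrow> complex \<Rightarrow> complex" where
  "pade n \<nu> w = (\<Sum>a\<le>n. of_real (pade_coeff n \<nu> a) * w ^ a)"

text \<open>
  The remainder of the approximation is this constant times the integral from \<open>w\<close> to \<open>1\<close> of
  \<open>(t - 1)\<^sup>n (t - w)\<^sup>n t\<^bsup>\<nu> - n - 1\<^esup>\<close>.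
\<close>

definition pade_const :: "nat \<Rightarrow> real \<Rightarrow> real" where
  "pade_const n \<nu> = pochhammer (\<nu> - real n) (2 * n + 1) / (fact n)\<^sup>2"

lemma pade_coeff_flip: "a \<le> n \<Longrightarrow> pade_coeff n (- \<nu>) a = pade_coeff n \<nu> (n - a)"
  by (simp add: pade_coeff_def)

text \<open>
  The right-hand side is what termwise integration of the expanded remainder integral produces. The
  product over \<open>[\<nu> - n, \<nu> + n]\<close> in \<open>pade_const\<close> splits into three blocks: the middle one
  cancels against the partial fraction, and the outer ones are the two binomial coefficients.
\<close>

lemma pade_coeff_eq:
  assumes "a \<le> n" "\<nu> \<notin> \<int>"
  shows "pade_coeff n \<nu> a = pade_const n \<nu> * ((-1) ^ a * real (n choose a) *
     (\<Sum>b\<le>n. (-1) ^ b * real (n choose b) / (real n - real a + \<nu> - real b)))"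
proof -
  have nz: "\<nu> + of_int k \<noteq> 0" for k :: int
    using assms(2) by (metis Ints_minus Ints_of_int add_eq_0_iff minus_minus)
  define x where "x = real n - real a + \<nu>"
  have S: "(\<Sum>b\<le>n. (-1) ^ b * real (n choose b) / (x - real b)) = - fact n / pochhammer (- x) (Suc n)"
  proof (rule alternating_partial_fraction)
    fix b assume "b \<le> n"
    show "x \<noteq> real b" using nz[of "int n - int a - int b"] by (auto simp: x_def)
  qed
  have P1: "pochhammer (- x) (Suc n) = (-1) ^ Suc n * pochhammer (\<nu> - real a) (Suc n)"
    by (subst pochhammer_minus) (simp add: x_def algebra_simps)
  have "2 * n + 1 = (n - a) + (Suc n + a)" using assms(1) by simp
  hence "pochhammer (\<nu> - real n) (2 * n + 1) =
     pochhammer (\<nu> - real n) (n - a) * (pochhammer (\<nu> - real a) (Suc n) * pochhammer (\<nu> + real n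
         - real a + 1) a)"
    using assms(1)
    by (simp only: pochhammer_product') (simp add: of_nat_diff algebra_simps)
  also have "pochhammer (\<nu> - real n) (n - a) = (-1) ^ (n - a) * pochhammer (real a + 1 - \<nu>) (n - a)"
    using pochhammer_minus[of "real n - \<nu>" "n - a"] assms(1) by (simp add: of_nat_diff algebra_simps)
  finally have P2: "pochhammer (\<nu> - real n) (2 * n + 1) = (-1) ^ (n - a) * pochhammer (real a + 1
      - \<nu>) (n - a) *
      (pochhammer (\<nu> - real a) (Suc n) * pochhammer (\<nu> + real n - real a + 1) a)" .
  have nzp: "pochhammer (\<nu> - real a) (Suc n) \<noteq> 0"
    unfolding pochhammer_eq_0_iff
  proof safe
    fix k assume "\<nu> - real a = - real k"
    thus False using nz[of "int k - int a"] by simp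
  qed
  have g: "(real n + \<nu>) gchoose a = pochhammer (\<nu> + real n - real a + 1) a / fact a"
    "(real n - \<nu>) gchoose (n - a) = pochhammer (real a + 1 - \<nu>) (n - a) / fact (n - a)"
    using assms(1) by (simp_all add: gbinomial_pochhammer' of_nat_diff algebra_simps)
  have f: "real (n choose a) = fact n / (fact a * fact (n - a))"
    using assms(1) by (rule binomial_fact)
  have sg: "(-1::real) ^ (n - a) = (-1) ^ n * (-1) ^ a"
  proof -
    have "(-1::real) ^ n = (-1) ^ (n - a) * (-1) ^ a"
      using assms(1) by (simp flip: power_add)
    thus ?thesis by (simp add: mult.assoc flip: power_mult_distrib)
  qed
  show ?thesis
    unfolding x_def[symmetric] S P1 pade_const_def P2 pade_coeff_def g f sg
    using nzp by (simp add: field_simps power2_eq_square) 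
qed

text \<open>
  The constant is \<open>\<nu> \<Prod>\<^sub>i (\<nu>\<^sup>2 - i\<^sup>2)/i\<^sup>2\<close> with \<open>i\<close> from \<open>1\<close> to \<open>n\<close>,
      and no factor exceeds \<open>1\<close> in absolute value.
\<close>

lemma abs_pade_const_le:
  assumes "\<bar>\<nu>\<bar> \<le> 1"
  shows "\<bar>pade_const n \<nu>\<bar> \<le> 1"
proof (induction n)
  case 0
  thus ?case using assms by (simp add: pade_const_def)
next
  case (Suc n)
  have "pochhammer (\<nu> - real (Suc n)) (2 * Suc n + 1) = (\<nu> - real (Suc n)) * pochhammer (\<nu>
      - real n) (2 * n + 1) * (\<nu> + real (Suc n))"
  proof -
    have "pochhammer (\<nu> - real (Suc n)) (2 * Suc n + 1) = pochhammer (\<nu> - real (Suc n)) (Suc (Suc (2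
        * n + 1)))"
      by simp
    also have "\<dots> = (\<nu> - real (Suc n)) * (pochhammer (\<nu> - real (Suc n) + 1) (2 * n + 1) *
        (\<nu> - real (Suc n) + 1 + real (2 * n + 1)))"
      by (simp only: pochhammer_rec[of _ "Suc (2 * n + 1)"] pochhammer_Suc[of _ "2 * n + 1"])
    also have "\<nu> - real (Suc n) + 1 = \<nu> - real n" by simp
    also have "\<nu> - real n + real (2 * n + 1) = \<nu> + real (Suc n)" by simp
    finally show ?thesis by (simp only: mult.assoc)
  qed
  hence "pade_const (Suc n) \<nu> = pade_const n \<nu> * ((\<nu> - real (Suc n)) * (\<nu> + real (Suc n))
      / (real (Suc n))\<^sup>2)"
    unfolding pade_const_def by (simp add: field_simps power2_eq_square)
  also have "\<bar>\<dots>\<bar> = \<bar>pade_const n \<nu>\<bar> * (((real (Suc n))\<^sup>2 - \<nu>\<^sup>2) / (real (Suc n))\<^sup>2)"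
  proof -
    have "\<nu>\<^sup>2 \<le> 1" using assms by (simp add: abs_square_le_1)
    moreover have "1 \<le> (real (Suc n))\<^sup>2" by simp
    moreover have "(\<nu> - real (Suc n)) * (\<nu> + real (Suc n)) = \<nu>\<^sup>2 - (real (Suc n))\<^sup>2"
      by (simp only: power2_eq_square algebra_simps)
    ultimately have "\<bar>(\<nu> - real (Suc n)) * (\<nu> + real (Suc n))\<bar> = (real (Suc n))\<^sup>2 - \<nu>\<^sup>2"
      by linarith
    thus ?thesis by (simp add: abs_mult)
  qed
  also have "\<dots> \<le> 1 * 1"
  proof (rule mult_mono)
    have "\<nu>\<^sup>2 \<le> 1" using assms by (simp add: abs_square_le_1)
    also have "1 \<le> (real (Suc n))\<^sup>2" by simp
    finally show "0 \<le> ((real (Suc n))\<^sup>2 - \<nu>\<^sup>2) / (real (Suc n))\<^sup>2" by simp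
  qed (use Suc in \<open>auto simp: divide_simps\<close>)
  finally show ?case by simp
qed

lemma pade_coeff_nonneg:
  assumes "\<bar>\<nu>\<bar> < 1" "a \<le> n"
  shows "pade_coeff n \<nu> a \<ge> 0"
proof -
  have "pochhammer (\<nu> + real n - real a + 1) a \<ge> 0" "pochhammer (real a + 1 - \<nu>) (n - a) \<ge> 0"
    using assms by (intro pochhammer_nonneg; simp)+
  thus ?thesis using assms
    by (simp add: pade_coeff_def gbinomial_pochhammer' of_nat_diff algebra_simps)
qed

lemma sum_pade_coeff: "(\<Sum>a\<le>n. pade_coeff n \<nu> a) = real ((2 * n) choose n)"
  using gbinomial_Vandermonde[of "real n + \<nu>" "real n - \<nu>" n]
  by (simp add: pade_coeff_def binomial_gbinomial atLeast0AtMost)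

text \<open>
  The coefficients are nonnegative with sum \<open>(2n choose n) \<le> 4\<^sup>n\<close>.
\<close>

lemma norm_pade_le:
  assumes "\<bar>\<nu>\<bar> < 1" "cmod w \<le> 3/2"
  shows "cmod (pade n \<nu> w) \<le> 6 ^ n"
proof -
  have "cmod (pade n \<nu> w) \<le> (\<Sum>a\<le>n. pade_coeff n \<nu> a * (3/2) ^ n)"
    unfolding pade_def
  proof (rule sum_norm_le)
    fix a assume "a \<in> {..n}"
    hence a: "a \<le> n" by simp
    have "cmod w ^ a \<le> (3/2) ^ a" using assms by (intro power_mono) auto
    also have "\<dots> \<le> (3/2) ^ n" using a by (intro power_increasing) auto
    finally show "cmod (of_real (pade_coeff n \<nu> a) * w ^ a) \<le> pade_coeff n \<nu> a * (3/2) ^ n"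
      using pade_coeff_nonneg[OF assms(1) a] by (simp add: norm_mult norm_power mult_left_mono)
  qed
  also have "\<dots> = real ((2 * n) choose n) * (3/2) ^ n"
    by (simp add: sum_distrib_right[symmetric] sum_pade_coeff)
  also have "\<dots> \<le> 4 ^ n * (3/2) ^ n"
  proof -
    have "(2 * n) choose n \<le> (\<Sum>k\<le>2*n. (2 * n) choose k)"
      by (rule member_le_sum) auto
    also have "\<dots> = 4 ^ n" by (simp add: choose_row_sum power_mult)
    finally have "real ((2 * n) choose n) \<le> real (4 ^ n)" by (simp only: of_nat_le_iff)
    thus ?thesis by (intro mult_right_mono) auto
  qed
  also have "\<dots> = 6 ^ n" by (simp add: power_mult_distrib[symmetric])
  finally show ?thesis .
qed

lemma Re_pos_near_1:
  assumes "cmod (w - 1) \<le> 1/2"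
  shows "Re w \<ge> 1/2" "w \<notin> \<real>\<^sub>\<le>\<^sub>0" "w \<noteq> 0" "cmod w \<ge> 1/2" "cmod w \<le> 3/2"
proof -
  show 1: "Re w \<ge> 1/2"
    using assms abs_Re_le_cmod[of "w - 1"] by (auto simp: abs_if split: if_splits)
  thus "w \<notin> \<real>\<^sub>\<le>\<^sub>0" "w \<noteq> 0" by (auto simp: complex_nonpos_Reals_iff)
  show "cmod w \<ge> 1/2" using 1 complex_Re_le_cmod[of w] by linarith
  show "cmod w \<le> 3/2" using assms norm_triangle_ineq[of "w - 1" 1] by simp
qed

text \<open>
  The integrand of the remainder is of order \<open>|w - 1|\<^bsup>2n\<^esup>\<close> on the segment from \<open>1\<close> to \<open>w\<close>. Expanding
  it yields an explicit antiderivative \<open>G\<close>, whose values at the two ends are multiples of the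
  numerator and of \<open>w\<^sup>\<nu>\<close> times the denominator; the mean value inequality for \<open>G\<close> then gives the
  estimate.
\<close>

lemma pade_approx:
  assumes "\<bar>\<nu>\<bar> < 1" "\<nu> \<noteq> 0" "cmod (w - 1) \<le> 1/2"
  shows "cmod (pade n \<nu> w - w powr of_real \<nu> * pade n (- \<nu>) w) \<le> 4 * 2 ^ n * cmod (w - 1) ^ (2 * n + 1)"
proof -
  have nI: "\<nu> \<notin> \<int>"
  proof
    assume "\<nu> \<in> \<int>"
    thus False using Ints_nonzero_abs_ge1[of \<nu>] assms by auto
  qed
  have nz: "real n - real a + \<nu> - real b \<noteq> 0" for a b
  proof
    assume "real n - real a + \<nu> - real b = 0"
    hence "\<nu> = of_int (int a + int b - int n)" by simp
    thus False using nI Ints_of_int by metis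
  qed
  define e where "e a b = real n - real a + \<nu> - real b" for a b
  have e_nz: "e a b \<noteq> 0" for a b using nz by (simp add: e_def)
  define g where "g t = (t - 1) ^ n * (t - w) ^ n * t powr (of_real (\<nu> - real n - 1))" for t :: complex
  define G where "G t = (\<Sum>a\<le>n. \<Sum>b\<le>n. of_real ((-1) ^ a * real (n choose a) * ((-1) ^ b
      * real (n choose b))) * w ^ a *
     (t powr (of_real (e a b)) / of_real (e a b)))" for t :: complex
  have deriv: "(G has_field_derivative g t) (at t)" if t: "t \<notin> \<real>\<^sub>\<le>\<^sub>0" for t
  proof -
    have t0: "t \<noteq> 0" using t by auto
    have "(G has_field_derivative (\<Sum>a\<le>n. \<Sum>b\<le>n. of_real ((-1) ^ a * real (n choose a) * ((-1) ^ b
        * real (n choose b))) * w ^ a *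
     (t powr (of_real (e a b) - 1)))) (at t)"
      unfolding G_def
      using t e_nz by (auto intro!: derivative_eq_intros sum.cong)
    also have "(\<Sum>a\<le>n. \<Sum>b\<le>n. of_real ((-1) ^ a * real (n choose a) * ((-1) ^ b * real (n choose b)))
        * w ^ a *
     (t powr (of_real (e a b) - 1))) = (\<Sum>a\<le>n. \<Sum>b\<le>n. (of_nat (n choose a) * (-w) ^ a * t ^ (n - a))
         * (of_nat (n choose b) * (-1) ^ b * t ^ (n - b)) * t powr (of_real (\<nu> - real n - 1)))"
    proof (intro sum.cong refl, goal_cases)
      case (1 a b)
      hence "complex_of_real (e a b) - 1 = of_nat ((n - a) + (n - b)) + of_real (\<nu> - real n - 1)"
        by (simp add: e_def of_nat_diff algebra_simps)
      hence "t powr (of_real (e a b) - 1) = t ^ (n - a) * t ^ (n - b) * t powr (of_real (\<nu> - real n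
          - 1))"
        using t0 by (simp only: powr_add powr_nat power_add) simp
      thus ?case by (simp add: power_minus[of w] mult_ac)
    qed
    also have "\<dots> = (- w + t) ^ n * (- 1 + t) ^ n * t powr (of_real (\<nu> - real n - 1))"
      unfolding binomial_ring by (simp only: sum_product) (simp only: sum_distrib_right)
    also have "\<dots> = g t" by (simp add: g_def mult_ac)
    finally show ?thesis .
  qed
  have p1: "of_real (pade_const n \<nu>) * G 1 = pade n \<nu> w"
  proof -
    have "of_real (pade_const n \<nu>) * G 1 = (\<Sum>a\<le>n. of_real (pade_const n \<nu> * ((-1) ^ a
        * real (n choose a) *
     (\<Sum>b\<le>n. (-1) ^ b * real (n choose b) / (real n - real a + \<nu> - real b)))) * w ^ a)"
      unfolding G_def e_def by (simp add: sum_distrib_left sum_distrib_right mult_ac)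
    also have "\<dots> = pade n \<nu> w"
      unfolding pade_def using pade_coeff_eq[OF _ nI] by (intro sum.cong refl) simp
    finally show ?thesis .
  qed
  have w0: "w \<noteq> 0" using Re_pos_near_1[OF assms(3)] by simp
  have p2: "of_real (pade_const n \<nu>) * G w = w powr of_real \<nu> * pade n (- \<nu>) w"
  proof -
    have "G w = (\<Sum>b\<le>n. \<Sum>a\<le>n. of_real ((-1) ^ a * real (n choose a) * ((-1) ^ b * real (n choose b))) *
        (w powr of_real \<nu> * w ^ (n - b) / of_real (e a b)))"
      unfolding G_def
    proof (subst sum.swap, intro sum.cong refl, goal_cases)
      case (1 b a)
      hence "of_nat a + complex_of_real (e a b) = of_real \<nu> + of_nat (n - b)"
        by (simp add: e_def of_nat_diff algebra_simps)
      hence "w powr (of_nat a + complex_of_real (e a b)) = w powr (of_real \<nu> + of_nat (n - b))"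
        by simp
      hence "w ^ a * w powr of_real (e a b) = w powr of_real \<nu> * w ^ (n - b)"
        using w0 by (simp only: powr_add powr_nat) simp
      thus ?case by (simp add: mult.assoc)
    qed
    hence "of_real (pade_const n \<nu>) * G w = w powr of_real \<nu> * (\<Sum>b\<le>n. of_real (pade_const n \<nu>
        * ((-1) ^ b * real (n choose b) *
     (\<Sum>a\<le>n. (-1) ^ a * real (n choose a) / e a b))) * w ^ (n - b))"
      by (simp add: sum_distrib_left sum_distrib_right mult_ac)
    also have "(\<Sum>b\<le>n. of_real (pade_const n \<nu> * ((-1) ^ b * real (n choose b) *
     (\<Sum>a\<le>n. (-1) ^ a * real (n choose a) / e a b))) * w ^ (n - b)) =
       (\<Sum>b\<le>n. of_real (pade_coeff n \<nu> b) * w ^ (n - b))"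
    proof (intro sum.cong refl)
      fix b assume "b \<in> {..n}"
      moreover have "e a b = real n - real b + \<nu> - real a" for a
        by (simp add: e_def)
      ultimately have "pade_coeff n \<nu> b = pade_const n \<nu> * ((-1) ^ b * real (n choose b) *
          (\<Sum>a\<le>n. (-1) ^ a * real (n choose a) / e a b))"
        using pade_coeff_eq[OF _ nI, of b n] by simp
      thus "of_real (pade_const n \<nu> * ((-1) ^ b * real (n choose b) *
          (\<Sum>a\<le>n. (-1) ^ a * real (n choose a) / e a b))) * w ^ (n - b) =
          of_real (pade_coeff n \<nu> b) * w ^ (n - b)" by simp
    qed
    also have "\<dots> = pade n (- \<nu>) w"
      unfolding pade_def
      by (rule sum.reindex_bij_witness[of _ "\<lambda>a. n - a" "\<lambda>a. n - a"]) (auto simp: pade_coeff_flip)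
    finally show ?thesis .
  qed
  have "cmod (G w - G 1) \<le> (4 * 2 ^ n * cmod (w - 1) ^ (2 * n)) * cmod (w - 1)"
  proof (rule field_differentiable_bound[where S = "closed_segment 1 w" and f' = g])
    fix t assume t: "t \<in> closed_segment 1 w"
    have d: "cmod (t - 1) \<le> cmod (w - 1)" "cmod (t - w) \<le> cmod (w - 1)"
      using segment_bound[OF t] by (simp_all add: norm_minus_commute)
    with assms(3) have tn: "cmod (t - 1) \<le> 1/2" by linarith
    note R = Re_pos_near_1[OF tn]
    show "(G has_field_derivative g t) (at t within closed_segment 1 w)"
      using deriv[OF R(2)] by (rule has_field_derivative_at_within)
    have "cmod (t powr of_real (\<nu> - real n - 1)) = cmod t powr (\<nu> - real n - 1)"
      by (subst norm_powr_real_powr') auto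
    also have "\<dots> = (1 / cmod t) powr (real n + 1 - \<nu>)"
      using R(3) by (simp add: powr_divide powr_minus_divide[symmetric] diff_diff_eq)
    also have "\<dots> \<le> 2 powr (real n + 1 - \<nu>)"
      using R(3,4) assms(1) by (intro powr_mono2) (auto simp: field_simps)
    also have "\<dots> \<le> 2 powr (real (n + 2))"
      using assms(1) by (intro powr_mono) auto
    also have "\<dots> = 4 * 2 ^ n" by (subst powr_realpow) auto
    finally have 1: "cmod (t powr of_real (\<nu> - real n - 1)) \<le> 4 * 2 ^ n" .
    have "cmod (g t) \<le> cmod (w - 1) ^ n * cmod (w - 1) ^ n * (4 * 2 ^ n)"
      unfolding g_def norm_mult norm_power
      using d 1 by (intro mult_mono power_mono) auto
    thus "cmod (g t) \<le> 4 * 2 ^ n * cmod (w - 1) ^ (2 * n)"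
      unfolding mult_2 power_add by (simp only: mult_ac)
  qed auto
  hence 3: "cmod (G 1 - G w) \<le> 4 * 2 ^ n * cmod (w - 1) ^ (2 * n + 1)"
    by (simp add: norm_minus_commute mult_ac)
  have "cmod (pade n \<nu> w - w powr of_real \<nu> * pade n (- \<nu>) w) = \<bar>pade_const n \<nu>\<bar> * cmod (G 1 - G w)"
    unfolding p1[symmetric] p2[symmetric] right_diff_distrib[symmetric] by (simp add: norm_mult)
  also have "\<dots> \<le> 1 * cmod (G 1 - G w)"
    using abs_pade_const_le[of \<nu> n] assms(1) by (intro mult_right_mono) auto
  finally show ?thesis using 3 by simp
qed

lemma norm_powr_minus_1_le:
  assumes "0 < \<nu>" "\<nu> \<le> 1" "cmod (w - 1) \<le> 1/2"
  shows "cmod (w powr of_real \<nu> - 1) \<le> 2 * \<nu> * cmod (w - 1)"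
proof -
  have "cmod (w powr of_real \<nu> - 1 powr of_real \<nu>) \<le> (2 * \<nu>) * cmod (w - 1)"
  proof (rule field_differentiable_bound[where S = "closed_segment 1 w" and
        f' = "\<lambda>t. of_real \<nu> * t powr (of_real \<nu> - 1)"])
    fix t assume t: "t \<in> closed_segment 1 w"
    have "cmod (t - 1) \<le> 1/2"
      using segment_bound(1)[OF t] assms(3) by linarith
    note R = Re_pos_near_1[OF this]
    show "((\<lambda>t. t powr of_real \<nu>) has_field_derivative of_real \<nu> * t powr (of_real \<nu>
        - 1)) (at t within closed_segment 1 w)"
      by (rule has_field_derivative_at_within) (use R(2) in \<open>auto intro!: derivative_eq_intros\<close>)
    have "cmod (t powr (of_real (\<nu> - 1))) = cmod t powr (\<nu> - 1)"
      by (subst norm_powr_real_powr') auto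
    also have "\<dots> = (1 / cmod t) powr (1 - \<nu>)"
      using R(3) by (simp add: powr_divide powr_minus_divide[symmetric])
    also have "\<dots> \<le> 2 powr (1 - \<nu>)"
      using R(3,4) assms by (intro powr_mono2) (auto simp: field_simps)
    also have "\<dots> \<le> 2 powr 1" using assms by (intro powr_mono) auto
    finally show "cmod (of_real \<nu> * t powr (of_real \<nu> - 1)) \<le> 2 * \<nu>"
      using assms(1) by (simp add: norm_mult)
  qed auto
  thus ?thesis by simp
qed

text \<open>
  The estimate forces a zero of order \<open>m\<close> at \<open>1\<close>, which leaves only a constant factor.
\<close>

lemma poly_eq_monomial_if_small:
  fixes f :: "complex poly"
  assumes "degree f \<le> m"
    and small: "\<And>z. cmod (z - 1) \<le> 1/2 \<Longrightarrow> cmod (poly f z) \<le> c * cmod (z - 1) ^ m"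
  shows "f = smult (coeff f m) ([:-1, 1:] ^ m)"
proof (cases "f = 0")
  case False
  obtain g where g: "f = [:-1, 1:] ^ order 1 f * g" "\<not> [:-1, 1:] dvd g"
    using order_decomp[OF False, of 1] by auto
  have "poly g 1 \<noteq> 0" using g(2) by (simp add: poly_eq_0_iff_dvd)
  have "m \<le> order 1 f"
  proof (rule ccontr)
    assume "\<not> m \<le> order 1 f"
    then obtain k where k: "m = order 1 f + Suc k" by (metis add_Suc_right less_imp_Suc_add not_le)
    have "((\<lambda>z. poly g z) \<longlongrightarrow> poly g 1) (at 1)"
      by (intro tendsto_intros)
    moreover have "((\<lambda>z. poly g z) \<longlongrightarrow> 0) (at 1)"
    proof (rule Lim_null_comparison)
      have "((\<lambda>z::complex. c * cmod (z - 1) ^ Suc k) \<longlongrightarrow> c * cmod (1 - 1) ^ Suc k) (at 1)"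
        by (intro tendsto_intros)
      thus "((\<lambda>z::complex. c * cmod (z - 1) ^ Suc k) \<longlongrightarrow> 0) (at 1)" by simp
      have "\<forall>\<^sub>F z::complex in at 1. z \<noteq> 1 \<and> dist z 1 \<le> 1/2"
        unfolding eventually_at by (intro exI[of _ "1/2"]) auto
      thus "\<forall>\<^sub>F z in at 1. cmod (poly g z) \<le> c * cmod (z - 1) ^ Suc k"
      proof eventually_elim
        case (elim z)
        hence "cmod (z - 1) ^ order 1 f * cmod (poly g z) \<le> cmod (z - 1) ^ order 1 f * (c * cmod (z
            - 1) ^ Suc k)"
        proof -
          have "poly f z = (z - 1) ^ order 1 f * poly g z"
            using arg_cong[OF g(1), of "\<lambda>p. poly p z"] by (simp only: poly_mult poly_power) simp
          thus ?thesis using small[of z] elim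
            by (simp add: norm_mult norm_power k power_add dist_norm mult_ac)
        qed
        thus ?case using elim by simp
      qed
    qed
    ultimately have "poly g 1 = 0" by (rule tendsto_unique[rotated]) simp
    with \<open>poly g 1 \<noteq> 0\<close> show False by simp
  qed
  hence "[:-1, 1:] ^ m dvd f"
    using order_1[of 1 f] by (meson dvd_trans le_imp_power_dvd)
  then obtain q where q: "f = [:-1, 1:] ^ m * q" by (elim dvdE)
  have "q \<noteq> 0" using q False by auto
  have deg: "degree (([:-1, 1:] :: complex poly) ^ m) = m"
    by (simp add: degree_power_eq)
  have "degree f = m + degree q"
    unfolding q by (subst degree_mult_eq) (use \<open>q \<noteq> 0\<close> deg in auto)
  hence "degree q = 0" using assms(1) by simp
  then obtain d where d: "q = [:d:]" by (rule degree_eq_zeroE)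
  have "lead_coeff (([:-1, 1:] :: complex poly) ^ m) = 1"
    by (subst lead_coeff_power) simp
  hence "coeff (([:-1, 1:] :: complex poly) ^ m) m = 1" unfolding deg .
  hence cf: "coeff f m = d" unfolding q d by simp
  show ?thesis unfolding cf by (simp add: q d)
qed auto

lemma pade_coeff_top: "pade_coeff n \<nu> n = (real n + \<nu>) gchoose n"
  by (simp add: pade_coeff_def)

text \<open>
  The determinant is a polynomial of degree at most \<open>2n + 1\<close>. As a combination of two remainders it
  vanishes to order \<open>2n + 1\<close> at \<open>1\<close>, so it is \<open>c (w - 1)\<^bsup>2n+1\<^esup>\<close>, and its leading coefficient \<open>c\<close> can be
  read off from the approximants.
\<close>

lemma pade_determinant_nonzero:
  assumes \<nu>: "\<bar>\<nu>\<bar> < 1" "\<nu> \<noteq> 0" and "w \<noteq> 1"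
  shows "pade n \<nu> w * pade (Suc n) (- \<nu>) w \<noteq> pade (Suc n) \<nu> w * pade n (- \<nu>) w"
proof -
  define P where "P k \<mu> = (\<Sum>a\<le>k. monom (complex_of_real (pade_coeff k \<mu> a)) a)" for k \<mu>
  have polyP: "poly (P k \<mu>) z = pade k \<mu> z" for k \<mu> z
    by (simp add: P_def pade_def poly_sum poly_monom)
  have coeffP: "coeff (P k \<mu>) i = (if i \<le> k then of_real (pade_coeff k \<mu> i) else 0)" for k \<mu> i
    by (simp add: P_def coeff_sum)
  have degP: "degree (P k \<mu>) \<le> k" for k \<mu>
    by (rule degree_le) (simp add: coeffP)
  define f where "f = P n \<nu> * P (Suc n) (- \<nu>) - P (Suc n) \<nu> * P n (- \<nu>)"
  have degf: "degree f \<le> 2 * n + 1"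
    unfolding f_def using degP[of n \<nu>] degP[of "Suc n" "-\<nu>"] degP[of "Suc n" \<nu>] degP[of n "-\<nu>"]
    by (intro degree_diff_le) (rule order.trans[OF degree_mult_le], simp)+
  have top: "coeff (P k \<mu> * P l \<mu>') (k + l) = of_real (pade_coeff k \<mu> k * pade_coeff l \<mu>' l)"
      for k l \<mu> \<mu>'
  proof -
    have "coeff (P k \<mu> * P l \<mu>') (k + l) = (\<Sum>i\<le>k+l. coeff (P k \<mu>) i * coeff (P l \<mu>') (k + l - i))"
      by (rule coeff_mult)
    also have "\<dots> = (\<Sum>i\<in>{k}. coeff (P k \<mu>) i * coeff (P l \<mu>') (k + l - i))"
      by (intro sum.mono_neutral_right) (auto simp: coeffP)
    finally show ?thesis by (simp add: coeffP)
  qed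
  have gs: "real (Suc n) + \<mu> gchoose Suc n = (real n + \<mu> gchoose n) * (real (Suc n) + \<mu>)
      / real (Suc n)" for \<mu>
    using gbinomial_absorption[of n "real n + \<mu>"] gbinomial_factors[of "real n + \<mu>" n]
    by (simp add: field_simps)
  have coefff: "coeff f (2 * n + 1) = of_real ((real n + \<nu> gchoose n) * (real n - \<nu> gchoose n)
      * (- 2 * \<nu> / real (Suc n)))"
  proof -
    have "coeff f (2 * n + 1) = of_real (pade_coeff n \<nu> n * pade_coeff (Suc n) (-\<nu>) (Suc n) -
        pade_coeff (Suc n) \<nu> (Suc n) * pade_coeff n (-\<nu>) n)"
      using top[of n \<nu> "Suc n" "-\<nu>"] top[of "Suc n" \<nu> n "-\<nu>"]
      by (simp add: f_def mult_2)
    also have "pade_coeff n \<nu> n * pade_coeff (Suc n) (-\<nu>) (Suc n) -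
        pade_coeff (Suc n) \<nu> (Suc n) * pade_coeff n (-\<nu>) n =
        (real n + \<nu> gchoose n) * (real n - \<nu> gchoose n) * (- 2 * \<nu> / real (Suc n))"
    proof -
      have "a * (b * (m + - \<nu>) / m) - a * (m + \<nu>) / m * b = a * b * (- 2 * \<nu> / m)" if "m \<noteq> 0"
          for a b m :: real
        using that by (simp add: field_simps)
      thus ?thesis unfolding pade_coeff_top gs by simp
    qed
    finally show ?thesis .
  qed
  have nz: "(real n + \<mu> gchoose n) \<noteq> 0" if "\<bar>\<mu>\<bar> < 1" for \<mu>
  proof -
    have "pochhammer (\<mu> + 1) n > 0" using that by (intro pochhammer_pos) auto
    thus ?thesis by (simp add: gbinomial_pochhammer')
  qed
  have coefff0: "coeff f (2 * n + 1) \<noteq> 0"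
    unfolding coefff of_real_eq_0_iff using nz[of \<nu>] nz[of "-\<nu>"] \<nu> by simp
  define c :: real where "c = 4 * 2 ^ n * 6 ^ Suc n + 4 * 2 ^ Suc n * 6 ^ n"
  have "f = smult (coeff f (2 * n + 1)) ([:-1, 1:] ^ (2 * n + 1))"
  proof (rule poly_eq_monomial_if_small[OF degf])
    fix z assume z: "cmod (z - 1) \<le> 1/2"
    define E where "E k = pade k \<nu> z - z powr of_real \<nu> * pade k (- \<nu>) z" for k
    have E: "cmod (E k) \<le> 4 * 2 ^ k * cmod (z - 1) ^ (2 * k + 1)" for k
      unfolding E_def by (rule pade_approx[OF \<nu> z])
    have p: "cmod (pade k (-\<nu>) z) \<le> 6 ^ k" for k
      using norm_pade_le[of "-\<nu>" z] \<nu> Re_pos_near_1(5)[OF z] by simp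
    have "poly f z = E n * pade (Suc n) (- \<nu>) z - E (Suc n) * pade n (- \<nu>) z"
      by (simp add: f_def polyP E_def algebra_simps)
    also have "cmod \<dots> \<le> cmod (E n) * cmod (pade (Suc n) (- \<nu>) z) + cmod (E (Suc n))
        * cmod (pade n (- \<nu>) z)"
      by (metis norm_mult norm_triangle_ineq4)
    also have "\<dots> \<le> (4 * 2 ^ n * cmod (z - 1) ^ (2 * n + 1)) * 6 ^ Suc n +
       (4 * 2 ^ Suc n * cmod (z - 1) ^ (2 * n + 1)) * 6 ^ n"
    proof (intro add_mono mult_mono E p)
      have "cmod (z - 1) ^ (2 * Suc n + 1) \<le> cmod (z - 1) ^ (2 * n + 1)"
        using z by (intro power_decreasing) auto
      thus "cmod (E (Suc n)) \<le> 4 * 2 ^ Suc n * cmod (z - 1) ^ (2 * n + 1)"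
        using E[of "Suc n"] by (meson mult_left_mono order.trans zero_le_mult_iff zero_le_numeral zero_le_power)
    qed auto
    also have "\<dots> = c * cmod (z - 1) ^ (2 * n + 1)" by (simp add: c_def algebra_simps)
    finally show "cmod (poly f z) \<le> c * cmod (z - 1) ^ (2 * n + 1)" .
  qed
  hence "poly f w = poly (smult (coeff f (2 * n + 1)) ([:-1, 1:] ^ (2 * n + 1))) w"
    by (rule arg_cong)
  hence "poly f w = coeff f (2 * n + 1) * (w - 1) ^ (2 * n + 1)"
    by (simp only: poly_smult poly_power) simp
  hence "poly f w \<noteq> 0" using coefff0 assms(3) by simp
  thus ?thesis by (simp add: f_def polyP)
qed

section \<open>Denominators of the approximants\<close>

text \<open>
  Among the factors \<open>1, \<dots>, k\<close> only \<open>p, 2p, \<dots>, mp\<close> with \<open>m = k div p\<close> contribute, so the multiplicity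
  is \<open>m\<close> plus the multiplicity in \<open>m!\<close>, and induction bounds it by \<open>2m \<le> k\<close>.
\<close>

lemma multiplicity_fact_le:
  assumes "prime (p::nat)"
  shows "multiplicity p (fact k) \<le> k"
proof (induction k rule: less_induct)
  case (less k)
  have p: "p \<ge> 2" using assms by (rule prime_ge_2_nat)
  show ?case
  proof (cases "k = 0")
    case False
    define m where "m = k div p"
    have mk: "m < k" using False p by (simp add: m_def)
    have "multiplicity p (fact k :: nat) = (\<Sum>i\<in>{1..k}. multiplicity p i)"
      unfolding fact_prod using assms
      by (simp only: of_nat_id, subst prime_elem_multiplicity_prod_distrib) auto
    also have "\<dots> = (\<Sum>i\<in>(\<lambda>j. p * j) ` {1..m}. multiplicity p i)"
    proof (rule sum.mono_neutral_right)
      show "(\<lambda>j. p * j) ` {1..m} \<subseteq> {1..k}"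
        using p by (auto simp: m_def) (metis div_times_less_eq_dividend dual_order.trans mult.commute mult_le_mono1)
      show "\<forall>i\<in>{1..k} - (\<lambda>j. p * j) ` {1..m}. multiplicity p i = 0"
      proof
        fix i assume i: "i \<in> {1..k} - (\<lambda>j. p * j) ` {1..m}"
        have "\<not> p dvd i"
        proof
          assume "p dvd i"
          then obtain j where j: "i = p * j" by (elim dvdE)
          have "j \<in> {1..m}" using i j p by (auto simp: m_def less_eq_div_iff_mult_less_eq mult.commute)
          thus False using i j by blast
        qed
        thus "multiplicity p i = 0" by (rule not_dvd_imp_multiplicity_0)
      qed
    qed auto
    also have "\<dots> = (\<Sum>j\<in>{1..m}. multiplicity p (p * j))"
      by (subst sum.reindex) (use p in \<open>auto simp: inj_on_def\<close>)
    also have "\<dots> = (\<Sum>j\<in>{1..m}. 1 + multiplicity p j)"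
      using assms by (intro sum.cong refl, subst multiplicity_times_same) (use p in auto)
    also have "\<dots> = m + (\<Sum>j\<in>{1..m}. multiplicity p j)"
      by (simp only: sum.distrib) simp
    also have "(\<Sum>j\<in>{1..m}. multiplicity p j) = multiplicity p (fact m :: nat)"
      unfolding fact_prod using assms
      by (simp only: of_nat_id, subst prime_elem_multiplicity_prod_distrib) auto
    also have "m + multiplicity p (fact m :: nat) \<le> m + m" using less.IH[OF mk] by simp
    also have "\<dots> \<le> k"
    proof -
      have "m * 2 \<le> m * p" using p by (rule mult_le_mono2)
      also have "\<dots> \<le> k" unfolding m_def by (rule div_times_less_eq_dividend)
      finally show ?thesis by simp
    qed
    finally show ?thesis .
  qed simp
qed

text \<open>
  At a prime \<open>p\<close> not dividing \<open>r\<close>, multiplication by an inverse of \<open>r\<close> modulo a power of \<open>p\<close> turns the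
  progression into \<open>k\<close> consecutive integers, whose product is divisible by \<open>k!\<close>. At a prime dividing
  \<open>r\<close> the factor \<open>r\<^sup>k\<close> is enough.
\<close>

lemma fact_dvd_arith_progression:
  fixes a :: int and r k :: nat
  assumes "r > 0"
  shows "fact k dvd int r ^ k * (\<Prod>i<k. a - int i * int r)"
proof (cases "(\<Prod>i<k. a - int i * int r) = 0")
  case False
  show ?thesis
  proof (rule multiplicity_le_imp_dvd)
    fix p :: int assume p: "prime p"
    define q where "q = nat p"
    have q2: "p = int q" using prime_ge_0_int[OF p] by (simp add: q_def)
    hence q1: "prime q" using p by simp
    note q = q1 q2
    define e where "e = multiplicity p (fact k :: int)"
    have ed: "p ^ e dvd fact k" unfolding e_def by (rule multiplicity_dvd)
    have "p ^ e dvd int r ^ k * (\<Prod>i<k. a - int i * int r)"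
    proof (cases "p dvd int r")
      case True
      have "\<not> q ^ Suc k dvd fact k"
        using multiplicity_fact_le[OF q(1), of k] q(1)
        by (subst power_dvd_iff_le_multiplicity) (auto simp: prime_gt_1_nat)
      hence "\<not> p ^ Suc k dvd fact k"
        by (metis of_nat_dvd_iff of_nat_fact of_nat_power q(2))
      hence "e \<le> k"
        using ed by (meson dvd_trans le_imp_power_dvd not_less_eq_eq)
      hence "p ^ e dvd p ^ k" by (rule le_imp_power_dvd)
      also have "p ^ k dvd int r ^ k" using True by (rule dvd_power_same)
      finally show ?thesis by simp
    next
      case False
      hence "coprime (int r) (p ^ e)"
        using p by (metis coprime_commute coprime_power_left_iff prime_imp_coprime)
      then obtain s where s: "[int r * s = 1] (mod p ^ e)"
        using cong_solve_coprime_int by blast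
      have "[s ^ k * (\<Prod>i<k. a - int i * int r) = (\<Prod>i<k. s * a - int i)] (mod p ^ e)"
      proof -
        have "s ^ k * (\<Prod>i<k. a - int i * int r) = (\<Prod>i<k. s * (a - int i * int r))"
          by (simp add: prod.distrib)
        also have "[\<dots> = (\<Prod>i<k. s * a - int i)] (mod p ^ e)"
        proof (rule cong_prod)
          fix i
          have "[s * a - int i * (int r * s) = s * a - int i * 1] (mod p ^ e)"
            by (intro cong_diff cong_mult cong_refl s)
          thus "[s * (a - int i * int r) = s * a - int i] (mod p ^ e)"
            by (simp add: algebra_simps)
        qed
        finally show ?thesis .
      qed
      moreover have "p ^ e dvd (\<Prod>i<k. s * a - int i)"
      proof -
        have "(\<Prod>i<k. s * a - int i) = (-1) ^ k * pochhammer (- (s * a)) k"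
          using falling_fact_pochhammer[of "s * a" k] by (simp add: atLeast0LessThan)
        moreover have "p ^ e dvd pochhammer (- (s * a)) k"
          using ed fact_dvd_pochhammer by (rule dvd_trans)
        ultimately show ?thesis by simp
      qed
      ultimately have "p ^ e dvd s ^ k * (\<Prod>i<k. a - int i * int r)"
        by (simp add: cong_dvd_iff)
      moreover have "coprime (p ^ e) (s ^ k)"
      proof -
        have "coprime s (p ^ e)" using s
          by (metis cong_imp_coprime cong_sym coprime_1_left coprime_mult_left_iff)
        thus ?thesis by (simp add: coprime_commute)
      qed
      ultimately have "p ^ e dvd (\<Prod>i<k. a - int i * int r)"
        by (simp add: coprime_dvd_mult_right_iff)
      thus ?thesis by simp
    qed
    thus "multiplicity p (fact k :: int) \<le> multiplicity p (int r ^ k * (\<Prod>i<k. a - int i * int r))"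
      using False assms p unfolding e_def
      by (subst (asm) power_dvd_iff_le_multiplicity) (auto dest: prime_elem_not_unit)
  qed auto
next
  case True
  thus ?thesis by (simp only: mult_zero_right dvd_0_right)
qed

lemma gbinomial_denominator:
  fixes a :: int and r k :: nat
  assumes "r > 0"
  shows "real r ^ (2 * k) * ((of_int a / real r) gchoose k) \<in> \<int>"
proof -
  have "real r ^ (2 * k) * ((of_int a / real r) gchoose k) =
      real r ^ k * (\<Prod>i<k. real r * (of_int a / real r - real i)) / fact k"
    by (simp add: gbinomial_prod_rev atLeast0LessThan prod.distrib mult_2 power_add)
  also have "(\<Prod>i<k. real r * (of_int a / real r - real i)) = (\<Prod>i<k. of_int a - real i * real r)"
    using assms by (intro prod.cong refl) (simp add: field_simps)
  also have "real r ^ k * (\<Prod>i<k. of_int a - real i * real r) =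
      of_int (int r ^ k * (\<Prod>i<k. a - int i * int r))"
    by simp
  also have "\<dots> / fact k \<in> \<int>"
  proof -
    obtain z where "int r ^ k * (\<Prod>i<k. a - int i * int r) = fact k * z"
    using fact_dvd_arith_progression[OF assms] by (blast elim: dvdE)
    hence "of_int (int r ^ k * (\<Prod>i<k. a - int i * int r)) / fact k = real_of_int z"
      by (simp only: of_int_mult of_int_fact) simp
    thus ?thesis by simp
  qed
  finally show ?thesis .
qed

lemma pade_coeff_denominator:
  assumes "r > 0" "a \<le> n"
  shows "real r ^ (2 * n) * pade_coeff n (1 / real r) a \<in> \<int>"
proof -
  have e: "real n + 1 / real r = of_int (int n * int r + 1) / real r"
    "real n - 1 / real r = of_int (int n * int r - 1) / real r"
    using assms(1) by (simp_all add: field_simps)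
  have "2 * n = 2 * a + 2 * (n - a)" using assms(2) by simp
  hence "real r ^ (2 * n) * pade_coeff n (1 / real r) a =
    (real r ^ (2 * a) * ((of_int (int n * int r + 1) / real r) gchoose a)) *
    (real r ^ (2 * (n - a)) * ((of_int (int n * int r - 1) / real r) gchoose (n - a)))"
    unfolding pade_coeff_def e by (simp only: power_add mult_ac)
  also have "\<dots> \<in> \<int>"
    by (intro Ints_mult gbinomial_denominator assms)
  finally show ?thesis .
qed

section \<open>The discriminant of a diagonal form\<close>

definition unity_root :: "nat \<Rightarrow> nat \<Rightarrow> complex" where
  "unity_root r k = cis (2 * pi * real k / real r)"

lemma unity_poly_factorization:
  assumes "r > 0"
  shows "(\<Prod>k<r. [:- unity_root r k, 1:]) = monom 1 r - 1"
proof -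
  define p :: "complex poly" where "p = monom 1 r - 1"
  have bij: "bij_betw (unity_root r) {..<r} {z. z ^ r = 1}"
    using Complex.bij_betw_roots_unity[OF assms] by (simp add: unity_root_def[abs_def])
  have poly_p: "poly p z = z ^ r - 1" for z by (simp add: p_def poly_monom)
  have "rsquarefree p"
    unfolding rsquarefree_roots
  proof safe
    fix z assume "poly p z = 0" "poly (pderiv p) z = 0"
    hence "z ^ r = 1" "z ^ (r - 1) = 0"
      using assms by (auto simp: poly_p p_def pderiv_diff pderiv_monom poly_monom)
    thus False using assms by (auto simp: power_0_left)
  qed
  have "degree p = r"
    unfolding p_def diff_conv_add_uminus using assms
    by (subst degree_add_eq_left) (simp_all add: degree_monom_eq)
  hence "lead_coeff p = 1" using assms by (simp add: p_def)
  with complex_poly_decompose_rsquarefree[OF \<open>rsquarefree p\<close>]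
  have "p = (\<Prod>z | z ^ r = 1. [:- z, 1:])" by (simp add: poly_p)
  also have "\<dots> = (\<Prod>k<r. [:- unity_root r k, 1:])"
    by (rule prod.reindex_bij_betw[OF bij, symmetric])
  finally show ?thesis by (simp add: p_def)
qed

lemma diff_powers_factorization:
  assumes "r > 0"
  shows "a ^ r - b ^ r = (\<Prod>k<r. a - unity_root r k * b)"
proof (cases "b = 0")
  case True
  thus ?thesis using assms by simp
next
  case False
  have "(a / b) ^ r - 1 = poly (\<Prod>k<r. [:- unity_root r k, 1:]) (a / b)"
    unfolding unity_poly_factorization[OF assms] by (simp add: poly_monom)
  also have "\<dots> = (\<Prod>k<r. a / b - unity_root r k)" by (simp add: poly_prod)
  finally have "b ^ r * ((a / b) ^ r - 1) = (\<Prod>k<r. b * (a / b - unity_root r k))"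
    by (simp add: prod.distrib)
  thus ?thesis using False by (simp add: power_divide right_diff_distrib mult.commute)
qed

text \<open>
  The product is the derivative of \<open>X\<^sup>r - 1\<close> at one of its roots.
\<close>

lemma norm_prod_unity_root_diff:
  assumes "k < r"
  shows "cmod (\<Prod>i\<in>{..<r} - {k}. unity_root r k - unity_root r i) = real r"
proof -
  define p :: "complex poly" where "p = monom 1 r - 1"
  define q where "q = (\<Prod>i\<in>{..<r} - {k}. [:- unity_root r i, 1:])"
  have "p = [:- unity_root r k, 1:] * q"
    unfolding p_def q_def using assms
    by (subst unity_poly_factorization[symmetric]) (auto simp: prod.remove)
  hence "poly (pderiv p) (unity_root r k) =
      poly ([:- unity_root r k, 1:] * pderiv q + q * pderiv [:- unity_root r k, 1:]) (unity_root r k)"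
    by (simp only: pderiv_mult)
  hence "poly (pderiv p) (unity_root r k) = poly q (unity_root r k)"
    by (simp only: poly_add poly_mult) (simp add: pderiv_pCons)
  moreover have "poly (pderiv p) (unity_root r k) = of_nat r * unity_root r k ^ (r - 1)"
    by (simp add: p_def pderiv_diff pderiv_monom poly_monom)
  ultimately have "(\<Prod>i\<in>{..<r} - {k}. unity_root r k - unity_root r i) = of_nat r
      * unity_root r k ^ (r - 1)"
    by (simp add: q_def poly_prod)
  thus ?thesis by (simp add: norm_mult norm_power unity_root_def)
qed

text \<open>
  In the factorization of \<open>\<xi>\<^sup>r - \<eta>\<^sup>r\<close> into the linear forms \<open>\<xi> - \<omega>\<eta>\<close>, the determinant of two of them is
  \<open>j\<close> times the difference of the roots of unity.
\<close>

lemma norm_form_disc: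
  assumes "diagonalized_by r c \<alpha> \<beta> \<gamma> \<delta>" "r > 0"
  shows "cmod (form_disc r c) = cmod (\<alpha> * \<delta> - \<beta> * \<gamma>) ^ (r * (r - 1)) * real r ^ r"
proof -
  define j where "j = \<alpha> * \<delta> - \<beta> * \<gamma>"
  define a b where "a k = \<alpha> - unity_root r k * \<gamma>" and "b k = - (\<beta> - unity_root r k * \<delta>)" for k
  have ab: "a i * b k - a k * b i = j * (unity_root r k - unity_root r i)" for i k
    by (simp add: a_def b_def j_def algebra_simps)
  have "form_eval r c x y = (\<Prod>i<r. a i * x - b i * y)" for x y :: complex
  proof -
    have "form_eval r c x y = (\<alpha> * x + \<beta> * y) ^ r - (\<gamma> * x + \<delta> * y) ^ r"
      using assms(1) by (simp add: diagonalized_by_def)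
    also have "\<dots> = (\<Prod>i<r. a i * x - b i * y)"
      unfolding diff_powers_factorization[OF assms(2)]
      by (intro prod.cong refl) (simp add: a_def b_def algebra_simps)
    finally show ?thesis .
  qed
  hence "form_disc r c = (\<Prod>k<r. \<Prod>i<k. (a i * b k - a k * b i)\<^sup>2)"
    by (rule form_disc_eqI)
  hence "cmod (form_disc r c) = cmod (\<Prod>i<r. \<Prod>k\<in>{..<r} - {i}. a i * b k - a k * b i)"
    by (subst prod_pairs_eq) (simp add: norm_mult norm_power)
  also have "\<dots> = (\<Prod>i<r. \<Prod>k\<in>{..<r} - {i}. cmod j * cmod (unity_root r i - unity_root r k))"
    by (simp add: prod_norm[symmetric] ab norm_mult norm_minus_commute)
  also have "\<dots> = (\<Prod>i<r. cmod j ^ (r - 1) * real r)"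
  proof (intro prod.cong refl)
    fix i assume i: "i \<in> {..<r}"
    have "(\<Prod>k\<in>{..<r} - {i}. cmod j * cmod (unity_root r i - unity_root r k)) =
       cmod j ^ (r - 1) * cmod (\<Prod>k\<in>{..<r} - {i}. unity_root r i - unity_root r k)"
      using i by (simp add: prod.distrib prod_norm)
    also have "\<dots> = cmod j ^ (r - 1) * real r"
      using norm_prod_unity_root_diff[of i r] i by simp
    finally show "(\<Prod>k\<in>{..<r} - {i}. cmod j * cmod (unity_root r i - unity_root r k)) = cmod j ^ (r
        - 1) * real r" .
  qed
  also have "\<dots> = cmod j ^ (r * (r - 1)) * real r ^ r"
    by (simp add: power_mult_distrib power_mult[symmetric] mult.commute)
  finally show ?thesis by (simp add: j_def)
qed

text \<open>
  The hypothesis amounts to \<open>L \<ge> r\<^bsup>7/(r-4)\<^esup> h\<^sup>b\<close> with \<open>b = (3r - 7)/(r(r - 4)) + 2/(r\<^sup>2(r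
      - 4))\<close>. Of this,
  two consequences with integral exponents are used: the first brings \<open>\<eta>/\<xi>\<close> close to a root of unity,
  the second makes the second member of a class so large that the constants of the hypergeometric
  method do not matter.
\<close>

lemma half_jdet_lower_bounds:
  assumes r: "r \<ge> 5" and h: "h > 0" and diag: "diagonalized_by r c \<alpha> \<beta> \<gamma> \<delta>"
    and big: "normalized_disc r c h \<ge>
           real r powr (7 * real r * (real r - 1) / (real r - 4)) *
           real h powr ((real r - 1) * ((real r)\<^sup>2 + real r + 2) / (real r * (real r - 4)))"
  defines "L \<equiv> cmod (\<alpha> * \<delta> - \<beta> * \<gamma>) / 2"
  shows "L ^ r \<ge> real r ^ 7 * real h ^ 2" "L ^ (r\<^sup>2 + r - 8) \<ge> real r ^ 40 * real h ^ (2 * r + 10)"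
proof -
  define R H where "R = real r" and "H = real h"
  have R: "R \<ge> 5" and H: "H \<ge> 1" using r h by (simp_all add: R_def H_def)
  have L0: "L > 0" using diag by (simp add: L_def diagonalized_by_def)
  have r2: "r\<^sup>2 - r = r * (r - 1)" by (simp add: power2_eq_square algebra_simps)
  have "cmod (form_disc r c) = (2 * L) ^ (r * (r - 1)) * real r ^ r"
    unfolding norm_form_disc[OF diag order.strict_trans2[OF _ r, of 0, simplified]] by (simp add: L_def)
  hence nd: "normalized_disc r c h = L ^ (r * (r - 1)) / H ^ (2 * r - 2)"
    using r h unfolding normalized_disc_def r2 by (simp add: H_def power_mult_distrib)
  define E1 E2 where "E1 = 7 * R * (R - 1) / (R - 4)" and "E2 = (R - 1) * (R\<^sup>2 + R + 2) / (R * (R - 4))"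
  have "R powr E1 * H powr E2 \<le> L powr (R * (R - 1)) / H powr (2 * R - 2)"
  proof -
    have e: "real (r * (r - 1)) = R * (R - 1)" "real (2 * r - 2) = 2 * R - 2"
      using r by (simp_all add: R_def of_nat_diff)
    have "L powr (R * (R - 1)) = L ^ (r * (r - 1))"
      using powr_realpow[OF L0, of "r * (r - 1)"] unfolding e by simp
    moreover have "H powr (2 * R - 2) = H ^ (2 * r - 2)"
      using powr_realpow[of H "2 * r - 2"] H unfolding e by simp
    ultimately show ?thesis
      using big unfolding nd E1_def E2_def R_def H_def by simp
  qed
  hence "R powr E1 * H powr E2 * H powr (2 * R - 2) \<le> L powr (R * (R - 1))"
    using H by (simp add: field_simps)
  hence 1: "R powr E1 * H powr (E2 + (2 * R - 2)) \<le> L powr (R * (R - 1))"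
    by (simp add: powr_add mult.assoc)
  define b1 b2 where "b1 = 7 / (R - 4)" and "b2 = (3 * R - 7) / (R * (R - 4))"
  have nz: "R * (R - 1) \<noteq> 0" "R * (R - 1) > 0" using R by auto
  have "R powr b1 * H powr b2 \<le> L"
  proof -
    have "(R powr E1 * H powr (E2 + (2 * R - 2))) powr (1 / (R * (R - 1))) \<le> (L powr (R * (R
        - 1))) powr (1 / (R * (R - 1)))"
      using 1 nz by (intro powr_mono2) auto
    also have "\<dots> = L" using nz L0 by (simp add: powr_powr)
    also have "(R powr E1 * H powr (E2 + (2 * R - 2))) powr (1 / (R * (R - 1))) =
        R powr (E1 / (R * (R - 1))) * H powr ((E2 + (2 * R - 2)) / (R * (R - 1)))"
      using R H by (simp add: powr_mult powr_powr)
    also have "E1 / (R * (R - 1)) = b1"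
    proof -
      have "E1 = R * (R - 1) * b1" by (simp add: E1_def b1_def)
      thus ?thesis using nz by simp
    qed
    also have "(E2 + (2 * R - 2)) / (R * (R - 1)) = b2 + 2 / (R\<^sup>2 * (R - 4))"
    proof -
      have "E2 = (R - 1) * ((R\<^sup>2 + R + 2) / (R * (R - 4)))" by (simp add: E2_def)
      hence "E2 + (2 * R - 2) = (R - 1) * ((R\<^sup>2 + R + 2) / (R * (R - 4)) + 2)" by (simp
          add: algebra_simps)
      hence "(E2 + (2 * R - 2)) / (R * (R - 1)) = ((R\<^sup>2 + R + 2) / (R * (R - 4)) + 2) / R"
        using R by simp
      also have "\<dots> = b2 + 2 / (R\<^sup>2 * (R - 4))"
        using R by (simp add: b2_def divide_simps) (simp add: power2_eq_square algebra_simps)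
      finally show ?thesis .
    qed
    finally have "R powr b1 * H powr (b2 + 2 / (R\<^sup>2 * (R - 4))) \<le> L" .
    moreover have "H powr b2 \<le> H powr (b2 + 2 / (R\<^sup>2 * (R - 4)))"
      using H R by (intro powr_mono) auto
    ultimately show ?thesis
      by (meson mult_left_mono order.trans powr_ge_zero)
  qed
  hence pw: "R powr (b1 * real m) * H powr (b2 * real m) \<le> L ^ m" for m
  proof -
    have "(R powr b1 * H powr b2) powr real m \<le> L powr real m"
      using \<open>R powr b1 * H powr b2 \<le> L\<close> by (intro powr_mono2) auto
    thus ?thesis using L0 R H by (simp add: powr_realpow powr_mult powr_powr)
  qed
  have lower: "R ^ k * H ^ l \<le> L ^ m" if "real k \<le> b1 * real m" "real l \<le> b2 * real m" for k l m
  proof -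
    have "R ^ k * H ^ l = R powr real k * H powr real l" using R H by (simp add: powr_realpow)
    also have "\<dots> \<le> R powr (b1 * real m) * H powr (b2 * real m)"
      using R H that by (intro mult_mono powr_mono) auto
    also note pw[of m]
    finally show ?thesis .
  qed
  have "R ^ 7 * H ^ 2 \<le> L ^ r"
  proof (rule lower)
    show "real 7 \<le> b1 * real r" using R by (simp add: b1_def R_def[symmetric] field_simps)
    have "b2 * R = (3 * R - 7) / (R - 4)" using R by (simp add: b2_def)
    also have "\<dots> \<ge> 2" using R by (simp add: field_simps)
    finally show "real 2 \<le> b2 * real r" by (simp add: R_def)
  qed
  thus "L ^ r \<ge> real r ^ 7 * real h ^ 2" by (simp add: R_def H_def)
  have e: "real (r\<^sup>2 + r - 8) = R\<^sup>2 + R - 8"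
  proof -
    have "8 \<le> r\<^sup>2 + r" using r by (intro trans_le_add1) (use power_mono[of 5 r 2] in auto)
    thus ?thesis by (simp add: R_def of_nat_diff)
  qed
  have "R ^ 40 * H ^ (2 * r + 10) \<le> L ^ (r\<^sup>2 + r - 8)"
  proof (rule lower)
    have "0 \<le> 7 * (R - 5)\<^sup>2 + (37 * R - 71)" using R
      by (intro add_nonneg_nonneg) auto
    hence "40 * (R - 4) \<le> 7 * (R\<^sup>2 + R - 8)" by (simp add: power2_eq_square algebra_simps)
    thus "real 40 \<le> b1 * real (r\<^sup>2 + r - 8)" unfolding e using R by (simp add: b1_def field_simps)
    have "0 \<le> R * (R - 3)\<^sup>2 + 56" using R by simp
    hence "(2 * R + 10) * (R * (R - 4)) \<le> (3 * R - 7) * (R\<^sup>2 + R - 8)"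
      by (simp add: power2_eq_square algebra_simps)
    hence "2 * R + 10 \<le> b2 * (R\<^sup>2 + R - 8)" using R by (simp add: b2_def pos_le_divide_eq)
    thus "real (2 * r + 10) \<le> b2 * real (r\<^sup>2 + r - 8)" unfolding e by (simp add: R_def)
  qed
  thus "L ^ (r\<^sup>2 + r - 8) \<ge> real r ^ 40 * real h ^ (2 * r + 10)" by (simp add: R_def H_def)
qed

section \<open>Arithmetic of diagonal forms\<close>

definition form_dx :: "nat \<Rightarrow> (nat \<Rightarrow> int) \<Rightarrow> 'a::comm_ring_1 \<Rightarrow> 'a \<Rightarrow> 'a" where
  "form_dx r c x y = (\<Sum>i\<le>r. of_int (c i) * (of_nat (r - i) * x ^ (r - i - 1)) * y ^ i)"

definition form_dy :: "nat \<Rightarrow> (nat \<Rightarrow> int) \<Rightarrow> 'a::comm_ring_1 \<Rightarrow> 'a \<Rightarrow> 'a" where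
  "form_dy r c x y = (\<Sum>i\<le>r. of_int (c i) * x ^ (r - i) * (of_nat i * y ^ (i - 1)))"

lemma of_int_form:
  "of_int (form_eval r c x y) = form_eval r c (of_int x) (of_int y)"
  "of_int (form_dx r c x y) = form_dx r c (of_int x) (of_int y)"
  "of_int (form_dy r c x y) = form_dy r c (of_int x) (of_int y)"
  by (simp_all add: form_eval_def form_dx_def form_dy_def)

lemma form_minus: "form_eval r c (- x) (- y) = (-1) ^ r * form_eval r c x y"
  unfolding form_eval_def sum_distrib_left
proof (intro sum.cong refl)
  fix i assume "i \<in> {..r}"
  hence "(-1) ^ r = (-1) ^ (r - i) * (-1 :: 'a) ^ i" by (simp flip: power_add)
  thus "of_int (c i) * (- x) ^ (r - i) * (- y) ^ i = (-1) ^ r * (of_int (c i) * x ^ (r - i) * y ^ i)"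
    by (simp add: power_minus[of x] power_minus[of y] mult_ac)
qed

locale diagonal_form =
  fixes r :: nat and c :: "nat \<Rightarrow> int"
    and \<alpha> \<beta> \<gamma> \<delta> \<kappa> :: complex and A B C D :: int
  assumes r_pos: "r > 0"
    and diag: "diagonalized_by r c \<alpha> \<beta> \<gamma> \<delta>"
    and quad: "associated_quadratic \<alpha> \<beta> \<gamma> \<delta> \<kappa> A B C"
    and D_def: "D = B\<^sup>2 - 4 * A * C"
begin

definition "jdet = \<alpha> * \<delta> - \<beta> * \<gamma>"

definition xi :: "int \<times> int \<Rightarrow> complex" where
  "xi p = \<alpha> * of_int (fst p) + \<beta> * of_int (snd p)"

definition eta :: "int \<times> int \<Rightarrow> complex" where
  "eta p = \<gamma> * of_int (fst p) + \<delta> * of_int (snd p)"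

definition F :: "int \<times> int \<Rightarrow> int" where "F p = form_eval r c (fst p) (snd p)"

text \<open>
  The constants \<open>\<theta>\<close> and \<open>\<theta>'\<close> are the conjugate numbers \<open>(B \<plusminus> \<surd>D)/2\<close>; defining them from the
  linear forms fixes which root of \<open>D\<close> is meant by \<open>sqrtD\<close>.
\<close>

definition \<theta> :: complex where "\<theta> = \<alpha> * \<delta> / \<kappa>"
definition \<theta>' :: complex where "\<theta>' = \<beta> * \<gamma> / \<kappa>"
definition sqrtD :: complex where "sqrtD = \<theta> - \<theta>'"

lemma jdet_nonzero: "jdet \<noteq> 0"
  using diag by (simp add: diagonalized_by_def jdet_def)

lemma quad_coeffs: "\<alpha> * \<gamma> = \<kappa> * of_int A" "\<alpha> * \<delta> + \<beta> * \<gamma> = \<kappa> * of_int B" "\<beta> * \<delta> = \<kappa> * of_int C"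
proof -
  have q: "(\<alpha> * x + \<beta> * y) * (\<gamma> * x + \<delta> * y) =
            \<kappa> * (of_int A * x\<^sup>2 + of_int B * x * y + of_int C * y\<^sup>2)" for x y
    using quad by (auto simp: associated_quadratic_def)
  show 1: "\<alpha> * \<gamma> = \<kappa> * of_int A" using q[of 1 0] by simp
  show 2: "\<beta> * \<delta> = \<kappa> * of_int C" using q[of 0 1] by simp
  show "\<alpha> * \<delta> + \<beta> * \<gamma> = \<kappa> * of_int B" using q[of 1 1] 1 2 by (simp add: algebra_simps)
qed

lemma kappa_nonzero: "\<kappa> \<noteq> 0"
proof
  assume "\<kappa> = 0"
  hence "\<alpha> * \<gamma> = 0" "\<alpha> * \<delta> + \<beta> * \<gamma> = 0" "\<beta> * \<delta> = 0" using quad_coeffs by auto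
  thus False using jdet_nonzero unfolding jdet_def by (metis add.inverse_inverse
      add_eq_0_iff diff_zero mult_eq_0_iff mult_zero_right add.right_neutral)
qed

lemma theta: "\<theta> + \<theta>' = of_int B" "\<theta> * \<theta>' = of_int (A * C)"
proof -
  show "\<theta> + \<theta>' = of_int B"
    using quad_coeffs(2) kappa_nonzero by (simp add: \<theta>_def \<theta>'_def field_simps)
  have "\<theta> * \<theta>' = (\<alpha> * \<gamma>) * (\<beta> * \<delta>) / \<kappa>\<^sup>2"
    by (simp add: \<theta>_def \<theta>'_def field_simps power2_eq_square)
  thus "\<theta> * \<theta>' = of_int (A * C)"
    unfolding quad_coeffs using kappa_nonzero by (simp add: power2_eq_square)
qed

lemma sqrtD_sq: "sqrtD\<^sup>2 = of_int D"
proof -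
  have "sqrtD\<^sup>2 = (\<theta> + \<theta>')\<^sup>2 - 4 * (\<theta> * \<theta>')"
    by (simp add: sqrtD_def power2_eq_square algebra_simps)
  thus ?thesis unfolding theta by (simp add: D_def)
qed

lemma jdet_eq: "jdet = \<kappa> * sqrtD"
  using kappa_nonzero by (simp add: jdet_def sqrtD_def \<theta>_def \<theta>'_def field_simps)

lemma sqrtD_nonzero: "sqrtD \<noteq> 0"
  using jdet_nonzero by (auto simp: jdet_eq)

lemma D_nonzero: "D \<noteq> 0"
  using sqrtD_nonzero sqrtD_sq by auto

lemma F_eq: "of_int (F p) = xi p ^ r - eta p ^ r"
  using diag by (simp add: F_def of_int_form diagonalized_by_def xi_def eta_def)

text \<open>
  Conjugate elements of the order \<open>\<int>[\<theta>]\<close>. Carrying both conjugates along, instead of applying an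
  automorphism, makes sense also if \<open>D\<close> is a square, where \<open>\<theta>\<close> is rational.
\<close>

definition conj_pair :: "complex \<Rightarrow> complex \<Rightarrow> bool" where
  "conj_pair z z' \<longleftrightarrow> (\<exists>a b :: int. z = of_int a + of_int b * \<theta> \<and> z' = of_int a + of_int b * \<theta>')"

lemma conj_pair_of_int: "conj_pair (of_int n) (of_int n)"
  unfolding conj_pair_def by (rule exI[of _ n], rule exI[of _ 0]) simp

lemma conj_pair_add:
  assumes "conj_pair z z'" "conj_pair t t'"
  shows "conj_pair (z + t) (z' + t')"
proof -
  obtain a b a' b' :: int where *: "z = of_int a + of_int b * \<theta>" "z' = of_int a + of_int b * \<theta>'"
    "t = of_int a' + of_int b' * \<theta>" "t' = of_int a' + of_int b' * \<theta>'"
    using assms by (auto simp: conj_pair_def)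
  show ?thesis unfolding conj_pair_def *
    by (rule exI[of _ "a + a'"], rule exI[of _ "b + b'"]) (simp add: algebra_simps)
qed

lemma conj_pair_mult:
  assumes "conj_pair z z'" "conj_pair t t'"
  shows "conj_pair (z * t) (z' * t')"
proof -
  obtain a b a' b' :: int where *: "z = of_int a + of_int b * \<theta>" "z' = of_int a + of_int b * \<theta>'"
    "t = of_int a' + of_int b' * \<theta>" "t' = of_int a' + of_int b' * \<theta>'"
    using assms by (auto simp: conj_pair_def)
  have "\<theta> * \<theta> = of_int B * \<theta> - of_int (A * C)" "\<theta>' * \<theta>' = of_int B * \<theta>' - of_int (A * C)"
    unfolding theta[symmetric] by (simp_all add: algebra_simps)
  hence sq: "of_int b * of_int b' * (\<theta> * \<theta>) = of_int b * of_int b' * (of_int B * \<theta> - of_int (A * C))"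
    "of_int b * of_int b' * (\<theta>' * \<theta>') = of_int b * of_int b' * (of_int B * \<theta>' - of_int (A * C))" by
        simp_all
  show ?thesis unfolding conj_pair_def *
    by (rule exI[of _ "a * a' - b * b' * (A * C)"], rule exI[of _ "a * b' + a' * b + b * b' * B"])
       (use sq in \<open>simp add: algebra_simps\<close>)
qed

lemma conj_pair_power: "conj_pair z z' \<Longrightarrow> conj_pair (z ^ n) (z' ^ n)"
  using conj_pair_of_int[of 1] by (induction n) (auto intro: conj_pair_mult)

lemma conj_pair_sum:
  "(\<And>i. i \<in> I \<Longrightarrow> conj_pair (f i) (g i)) \<Longrightarrow> conj_pair (sum f I) (sum g I)"
  using conj_pair_of_int[of 0]
  by (induction I rule: infinite_finite_induct) (auto intro: conj_pair_add)

lemma conj_pair_swap: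
  assumes "conj_pair z z'" shows "conj_pair z' z"
proof -
  obtain a b :: int where *: "z = of_int a + of_int b * \<theta>" "z' = of_int a + of_int b * \<theta>'"
    using assms by (auto simp: conj_pair_def)
  have "\<theta>' = of_int B - \<theta>" using theta(1) by (simp add: algebra_simps)
  note e = this
  show ?thesis unfolding conj_pair_def *
    by (rule exI[of _ "a + b * B"], rule exI[of _ "- b"]) (simp add: e algebra_simps)
qed

lemma conj_pair_diff:
  assumes "conj_pair z z'" shows "\<exists>k::int. z - z' = of_int k * sqrtD"
proof -
  obtain a b :: int where *: "z = of_int a + of_int b * \<theta>" "z' = of_int a + of_int b * \<theta>'"
    using assms by (auto simp: conj_pair_def)
  show ?thesis unfolding * sqrtD_def by (rule exI[of _ b]) (simp add: algebra_simps)
qed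

lemma conj_pair_prod_int: 
  assumes "conj_pair z z'" shows "z * z' \<in> \<int>"
proof -
  obtain a b :: int where *: "z = of_int a + of_int b * \<theta>" "z' = of_int a + of_int b * \<theta>'"
    using assms by (auto simp: conj_pair_def)
  have "z * z' = of_int (a * a) + of_int (a * b) * (\<theta> + \<theta>') + of_int (b * b) * (\<theta> * \<theta>')"
    unfolding * by (simp add: algebra_simps)
  also have "\<dots> = of_int (a * a + a * b * B + b * b * (A * C))" unfolding theta by simp
  finally show ?thesis by (metis Ints_of_int)
qed

lemma conj_pair_mixed: "conj_pair (xi p * eta q / \<kappa>) (xi q * eta p / \<kappa>)"
proof -
  obtain x y x' y' where pq: "p = (x, y)" "q = (x', y')" by (cases p, cases q)
  have k: "\<alpha> * \<gamma> / \<kappa> = of_int A" "\<beta> * \<delta> / \<kappa> = of_int C" "\<alpha> * \<delta> / \<kappa> = \<theta>" "\<beta> * \<gamma> / \<kappa> = \<theta>'"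
    using quad_coeffs(1,3) kappa_nonzero by (simp_all add: \<theta>_def \<theta>'_def)
  have e: "xi p * eta q / \<kappa> = (\<alpha> * \<gamma> / \<kappa>) * of_int (x * x') + (\<beta> * \<delta> / \<kappa>) * of_int (y * y')
      + (\<alpha> * \<delta> / \<kappa>) * of_int (x * y') + (\<beta> * \<gamma> / \<kappa>) * of_int (y * x')"
    "xi q * eta p / \<kappa> = (\<alpha> * \<gamma> / \<kappa>) * of_int (x * x') + (\<beta> * \<delta> / \<kappa>) * of_int (y * y')
      + (\<alpha> * \<delta> / \<kappa>) * of_int (x' * y) + (\<beta> * \<gamma> / \<kappa>) * of_int (y' * x)"
    by (simp_all add: xi_def eta_def pq add_divide_distrib algebra_simps)
  have "\<theta>' = of_int B - \<theta>" using theta(1) by (simp add: algebra_simps)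
  note \<theta>' = this
  show ?thesis unfolding conj_pair_def e k
    by (rule exI[of _ "A * (x * x') + C * (y * y') + B * (y * x')"], rule exI[of _ "x * y' - y * x'"])
       (simp add: \<theta>' algebra_simps)
qed

lemma form_dx_eq: "form_dx r c x y = of_nat r * (\<alpha> * (\<alpha> * x + \<beta> * y) ^ (r - 1) - \<gamma> * (\<gamma> * x + \<delta>
    * y) ^ (r - 1))"
proof (rule DERIV_unique)
  show "((\<lambda>t. form_eval r c t y) has_field_derivative form_dx r c x y) (at x)"
    unfolding form_eval_def form_dx_def
    by (auto intro!: derivative_eq_intros sum.cong)
  have "(\<lambda>t. form_eval r c t y) = (\<lambda>t. (\<alpha> * t + \<beta> * y) ^ r - (\<gamma> * t + \<delta> * y) ^ r)"
    using diag by (simp add: diagonalized_by_def)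
  thus "((\<lambda>t. form_eval r c t y) has_field_derivative
     of_nat r * (\<alpha> * (\<alpha> * x + \<beta> * y) ^ (r - 1) - \<gamma> * (\<gamma> * x + \<delta> * y) ^ (r - 1))) (at x)"
    by (auto intro!: derivative_eq_intros simp: algebra_simps)
qed

lemma form_dy_eq: "form_dy r c x y = of_nat r * (\<beta> * (\<alpha> * x + \<beta> * y) ^ (r - 1) - \<delta> * (\<gamma> * x + \<delta>
    * y) ^ (r - 1))"
proof (rule DERIV_unique)
  show "((\<lambda>t. form_eval r c x t) has_field_derivative form_dy r c x y) (at y)"
    unfolding form_eval_def form_dy_def
    by (auto intro!: derivative_eq_intros sum.cong)
  have "(\<lambda>t. form_eval r c x t) = (\<lambda>t. (\<alpha> * x + \<beta> * t) ^ r - (\<gamma> * x + \<delta> * t) ^ r)"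
    using diag by (simp add: diagonalized_by_def)
  thus "((\<lambda>t. form_eval r c x t) has_field_derivative
     of_nat r * (\<beta> * (\<alpha> * x + \<beta> * y) ^ (r - 1) - \<delta> * (\<gamma> * x + \<delta> * y) ^ (r - 1))) (at y)"
    by (auto intro!: derivative_eq_intros simp: algebra_simps)
qed

text \<open>
  The sum \<open>\<xi>\<^sup>r + \<eta>\<^sup>r\<close> is the Jacobian of \<open>F\<close> and the quadratic form divided by \<open>r \<surd>D\<close>,
      and the difference
  is \<open>F\<close>. So \<open>r \<surd>D\<close> makes both powers integral up to a factor \<open>2\<close>, and Euler's identity for \<open>F\<close>
  supplies the parity condition under which the factor disappears.
\<close>

lemma conj_pair_powers: "conj_pair (of_nat r * sqrtD * xi p ^ r) (of_nat r * sqrtD * eta p ^ r)"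
proof -
  obtain x y where p: "p = (x, y)" by (cases p)
  define X Y where "X = complex_of_int x" and "Y = complex_of_int y"
  define a b where "a = xi p" and "b = eta p"
  have ab: "a = \<alpha> * X + \<beta> * Y" "b = \<gamma> * X + \<delta> * Y"
    by (simp_all add: a_def b_def xi_def eta_def p X_def Y_def)
  define fx fy where "fx = form_dx r c x y" and "fy = form_dy r c x y"
  have fx: "of_int fx = of_nat r * (\<alpha> * a ^ (r - 1) - \<gamma> * b ^ (r - 1))"
    and fy: "of_int fy = of_nat r * (\<beta> * a ^ (r - 1) - \<delta> * b ^ (r - 1))"
    by (simp_all only: fx_def fy_def of_int_form form_dx_eq form_dy_eq ab X_def Y_def)
  have pw: "a ^ r = a * a ^ (r - 1)" "b ^ r = b * b ^ (r - 1)"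
    using r_pos by (simp_all add: power_eq_if)
  define N where "N = C * y * fx - A * x * fy - B * y * fy"
  have jac: "\<kappa> * of_int (B * int r * F p + 2 * N) = of_nat r * jdet * (a ^ r + b ^ r)"
  proof -
    have "\<kappa> * of_int (B * int r * F p + 2 * N) =
       of_nat r * (\<kappa> * of_int B) * (a ^ r - b ^ r) + 2 * ((\<kappa> * of_int C) * Y * of_int fx -
        (\<kappa> * of_int A) * X * of_int fy - (\<kappa> * of_int B) * Y * of_int fy)"
      by (simp add: N_def F_eq a_def b_def X_def Y_def algebra_simps)
    also have "\<dots> = of_nat r * (\<alpha> * \<delta> + \<beta> * \<gamma>) * (a * a ^ (r - 1) - b * b ^ (r - 1)) + 
       2 * (\<beta> * \<delta> * Y * (of_nat r * (\<alpha> * a ^ (r - 1) - \<gamma> * b ^ (r - 1))) -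
        (\<alpha> * \<gamma>) * X * (of_nat r * (\<beta> * a ^ (r - 1) - \<delta> * b ^ (r - 1))) 
        - (\<alpha> * \<delta> + \<beta> * \<gamma>) * Y * (of_nat r * (\<beta> * a ^ (r - 1) - \<delta> * b ^ (r - 1))))"
      by (simp only: quad_coeffs fx fy pw)
    also have "\<dots> = of_nat r * jdet * (a * a ^ (r - 1) + b * b ^ (r - 1))"
    proof -
      have "(\<alpha> * \<delta> + \<beta> * \<gamma>) * (a * s - b * t) + 
       2 * (\<beta> * \<delta> * Y * ((\<alpha> * s - \<gamma> * t)) - (\<alpha> * \<gamma>) * X * ((\<beta> * s - \<delta> * t)) 
        - (\<alpha> * \<delta> + \<beta> * \<gamma>) * Y * ((\<beta> * s - \<delta> * t))) = jdet * (a * s + b * t)" for s t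
        unfolding ab jdet_def by algebra
      from this[of "a ^ (r - 1)" "b ^ (r - 1)"] have
        "of_nat r * ((\<alpha> * \<delta> + \<beta> * \<gamma>) * (a * a ^ (r - 1) - b * b ^ (r - 1)) + 
       2 * (\<beta> * \<delta> * Y * ((\<alpha> * a ^ (r - 1) - \<gamma> * b ^ (r - 1))) - (\<alpha> * \<gamma>) * X * ((\<beta> * a ^ (r - 1) - \<delta>
           * b ^ (r - 1))) 
        - (\<alpha> * \<delta> + \<beta> * \<gamma>) * Y * ((\<beta> * a ^ (r - 1) - \<delta> * b ^ (r - 1))))) = of_nat r * (jdet * (a
            * a ^ (r - 1) + b * b ^ (r - 1)))"
        by simp
      thus ?thesis by (simp only: ring_distribs mult_ac right_diff_distrib)
    qed
    finally show ?thesis by (simp only: pw)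
  qed
  hence "\<kappa> * of_int (B * int r * F p + 2 * N) = \<kappa> * (of_nat r * sqrtD * (a ^ r + b ^ r))"
    unfolding jdet_eq by (simp add: mult_ac)
  hence sum: "of_nat r * sqrtD * (a ^ r + b ^ r) = of_int (B * int r * F p + 2 * N)"
    using kappa_nonzero by simp
  have diff: "of_nat r * sqrtD * (a ^ r - b ^ r) = of_int (int r * F p) * sqrtD"
    by (simp add: F_eq a_def b_def)
  have split: "x = n + f * t" "y = n + f * t'"
    if "x + y = b * f + 2 * n" "x - y = f * (t - t')" "t + t' = b" for x y n f t t' b :: complex
  proof -
    have "2 * x = 2 * (n + f * t)" "2 * y = 2 * (n + f * t')" using that by algebra+
    thus "x = n + f * t" "y = n + f * t'" by (metis mult_left_cancel zero_neq_numeral)+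
  qed
  have "of_nat r * sqrtD * a ^ r = of_int N + of_int (int r * F p) * \<theta>"
    "of_nat r * sqrtD * b ^ r = of_int N + of_int (int r * F p) * \<theta>'"
    by (rule split[of _ _ "of_int B"]; use sum diff theta(1) in \<open>simp
        add: sqrtD_def ring_distribs mult.assoc\<close>)+
  thus ?thesis unfolding conj_pair_def a_def b_def by blast
qed

text \<open>
  The two terms are conjugate: exchanging \<open>\<xi>\<^sup>r\<close> and \<open>\<eta>\<^sup>r\<close> exchanges the homogenized numerator and
  denominator of the Pade approximant. The difference of two conjugates is an integral multiple
  of \<open>\<surd>D\<close>, hence of \<open>j\<close> after multiplication by \<open>\<kappa>\<close>. Of the factor \<open>r\<^bsup>3n\<^esup>\<close>, two thirds
  clear the denominators of the approximant and one third belongs to the powers of \<open>\<xi>\<close> and \<open>\<eta>\<close>.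
\<close>

lemma pade_form_integrality:
  assumes "xi p \<noteq> 0"
  shows "\<exists>k::int. (of_nat (r ^ 3) * sqrtD * xi p ^ r) ^ n *
     (xi p * eta q * pade n (1 / real r) ((eta p / xi p) ^ r) -
      xi q * eta p * pade n (- (1 / real r)) ((eta p / xi p) ^ r)) = of_int k * jdet"
proof -
  define u v where "u = of_nat r * sqrtD * xi p ^ r" and "v = of_nat r * sqrtD * eta p ^ r"
  have u0: "u \<noteq> 0" using assms r_pos sqrtD_nonzero by (simp add: u_def)
  have w: "(eta p / xi p) ^ r = v / u"
    using r_pos sqrtD_nonzero by (simp add: u_def v_def power_divide)
  define f where "f a = \<lfloor>real r ^ (2 * n) * pade_coeff n (1 / real r) a\<rfloor>" for a
  have f: "real r ^ (2 * n) * pade_coeff n (1 / real r) a = of_int (f a)" if "a \<le> n" for a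
    using pade_coeff_denominator[OF r_pos that] unfolding f_def by (metis Ints_cases floor_of_int)
  have f': "of_nat r ^ (2 * n) * complex_of_real (pade_coeff n (1 / real r) a) = of_int (f a)" if "a
      \<le> n" for a
    using arg_cong[OF f[OF that], of complex_of_real] by simp
  have 1: "of_nat r ^ (2 * n) * u ^ n * pade n (1 / real r) (v / u) = (\<Sum>a\<le>n. of_int (f a) * v ^ a
      * u ^ (n - a))"
    unfolding pade_def sum_distrib_left
  proof (intro sum.cong refl)
    fix a assume "a \<in> {..n}"
    hence a: "a \<le> n" by simp
    hence "u ^ n = u ^ a * u ^ (n - a)" by (simp flip: power_add)
    thus "of_nat r ^ (2 * n) * u ^ n * (of_real (pade_coeff n (1 / real r) a) * (v / u) ^ a)
        = of_int (f a) * v ^ a * u ^ (n - a)"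
      using u0 by (simp add: f'[OF a, symmetric] power_divide field_simps)
  qed
  have 2: "of_nat r ^ (2 * n) * u ^ n * pade n (- (1 / real r)) (v / u) = (\<Sum>a\<le>n. of_int (f a)
      * u ^ a * v ^ (n - a))"
  proof -
    have "of_nat r ^ (2 * n) * u ^ n * pade n (- (1 / real r)) (v / u) = (\<Sum>a\<le>n. of_int (f (n - a))
        * v ^ a * u ^ (n - a))"
      unfolding pade_def sum_distrib_left
    proof (intro sum.cong refl)
      fix a assume "a \<in> {..n}"
      hence a: "a \<le> n" by simp
      hence "u ^ n = u ^ a * u ^ (n - a)" by (simp flip: power_add)
      thus "of_nat r ^ (2 * n) * u ^ n * (of_real (pade_coeff n (- (1 / real r)) a) * (v / u) ^ a)
          = of_int (f (n - a)) * v ^ a * u ^ (n - a)"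
        using u0 f'[of "n - a", symmetric] a by (simp add: pade_coeff_flip power_divide field_simps)
    qed
    also have "\<dots> = (\<Sum>a\<le>n. of_int (f a) * u ^ a * v ^ (n - a))"
      by (rule sum.reindex_bij_witness[of _ "\<lambda>a. n - a" "\<lambda>a. n - a"]) (auto simp: mult_ac)
    finally show ?thesis .
  qed
  have "conj_pair u v" unfolding u_def v_def by (rule conj_pair_powers)
  hence cp: "conj_pair u v" "conj_pair v u" by (simp_all add: conj_pair_swap)
  have "conj_pair (xi p * eta q / \<kappa> * (\<Sum>a\<le>n. of_int (f a) * v ^ a * u ^ (n - a)))
                  (xi q * eta p / \<kappa> * (\<Sum>a\<le>n. of_int (f a) * u ^ a * v ^ (n - a)))"
    by (intro conj_pair_mult conj_pair_mixed conj_pair_sum conj_pair_power conj_pair_of_int cp)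
  from conj_pair_diff[OF this] obtain k :: int where
    "xi p * eta q / \<kappa> * (\<Sum>a\<le>n. of_int (f a) * v ^ a * u ^ (n - a)) -
     xi q * eta p / \<kappa> * (\<Sum>a\<le>n. of_int (f a) * u ^ a * v ^ (n - a)) = of_int k * sqrtD" by blast
  hence "xi p * eta q * (\<Sum>a\<le>n. of_int (f a) * v ^ a * u ^ (n - a)) -
     xi q * eta p * (\<Sum>a\<le>n. of_int (f a) * u ^ a * v ^ (n - a)) = of_int k * jdet"
    unfolding jdet_eq using kappa_nonzero by (simp add: field_simps)
  also have "xi p * eta q * (\<Sum>a\<le>n. of_int (f a) * v ^ a * u ^ (n - a)) -
     xi q * eta p * (\<Sum>a\<le>n. of_int (f a) * u ^ a * v ^ (n - a)) =
     (of_nat r ^ (2 * n) * u ^ n) * (xi p * eta q * pade n (1 / real r) (v / u) -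
      xi q * eta p * pade n (- (1 / real r)) (v / u))"
    unfolding 1[symmetric] 2[symmetric] by (simp only: right_diff_distrib mult_ac)
  also have "of_nat r ^ (2 * n) * u ^ n = (of_nat (r ^ 3) * sqrtD * xi p ^ r) ^ n"
  proof -
    have "of_nat r ^ (2 * n) * u ^ n = (of_nat r ^ 2 * u) ^ n"
        by (simp only: power_mult power_mult_distrib)
    also have "of_nat r ^ 2 * u = of_nat (r ^ 3) * sqrtD * xi p ^ r"
      by (simp add: u_def power2_eq_square power3_eq_cube mult_ac)
    finally show ?thesis .
  qed
  finally show ?thesis unfolding w by blast
qed

lemma xi_eta_det: "xi p * eta q - xi q * eta p = jdet * of_int (fst p * snd q - snd p * fst q)"
  by (simp add: xi_def eta_def jdet_def algebra_simps)

text \<open>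
  The product of the conjugates \<open>r \<surd>D \<xi>\<^sup>r\<close> and \<open>r \<surd>D \<eta>\<^sup>r\<close> is an integer; it equals \<open>r\<^sup>2 D \<kappa>\<^sup>r\<close> times
  the \<open>r\<close>-th power of a value of the quadratic form. The values \<open>A\<close>, \<open>C\<close> and \<open>A + B + C\<close> have no common
  factor, so \<open>r\<^sup>2 D \<kappa>\<^sup>r\<close> itself is a nonzero integer.
\<close>

lemma disc_bound:
  assumes "gcd A (gcd B C) = 1"
  shows "1 \<le> real r ^ 2 * \<bar>of_int D\<bar> * cmod \<kappa> ^ r"
proof -
  define e where "e = of_nat r ^ 2 * of_int D * \<kappa> ^ r"
  have Q: "e * of_int ((A * x\<^sup>2 + B * x * y + C * y\<^sup>2) ^ r) \<in> \<int>" for x y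
  proof -
    have "(of_nat r * sqrtD * xi (x,y) ^ r) * (of_nat r * sqrtD * eta (x,y) ^ r) \<in> \<int>"
      by (rule conj_pair_prod_int[OF conj_pair_powers])
    also have "(of_nat r * sqrtD * xi (x,y) ^ r) * (of_nat r * sqrtD * eta (x,y) ^ r) =
       of_nat r ^ 2 * sqrtD\<^sup>2 * (xi (x,y) * eta (x,y)) ^ r"
      by (simp add: power2_eq_square power_mult_distrib mult_ac)
    also have "xi (x,y) * eta (x,y) = \<kappa> * of_int (A * x\<^sup>2 + B * x * y + C * y\<^sup>2)"
      using quad by (simp add: associated_quadratic_def xi_def eta_def)
    also have "of_nat r ^ 2 * sqrtD\<^sup>2 * (\<kappa> * of_int (A * x\<^sup>2 + B * x * y + C * y\<^sup>2)) ^ r =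
      e * of_int ((A * x\<^sup>2 + B * x * y + C * y\<^sup>2) ^ r)"
      unfolding sqrtD_sq e_def by (simp only: power_mult_distrib of_int_power mult_ac)
    finally show ?thesis .
  qed
  have G: "e * of_int (gcd m n) \<in> \<int>" if mn: "e * of_int m \<in> \<int>" "e * of_int n \<in> \<int>" for m n
  proof -
    obtain s t where "s * m + t * n = gcd m n" using bezout_int by blast
    hence "e * of_int (gcd m n) = of_int s * (e * of_int m) + of_int t * (e * of_int n)"
      by (metis (no_types, lifting) distrib_left mult.left_commute of_int_add of_int_mult)
    thus ?thesis using mn by simp
  qed
  have g1: "gcd (gcd A C) (A + B + C) = 1"
  proof -
    have "gcd (gcd A C) (A + B + C) dvd B"
    proof -
      define g where "g = gcd (gcd A C) (A + B + C)"
      have "g dvd A" "g dvd C" "g dvd A + B + C" by (auto simp: g_def intro: dvd_trans)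
      hence "g dvd A + B + C - A - C" by (intro dvd_diff)
      thus ?thesis by (simp add: g_def)
    qed
    hence "gcd (gcd A C) (A + B + C) dvd gcd A (gcd B C)"
      by (auto intro: dvd_trans)
    thus ?thesis unfolding assms by simp
  qed
  have "e * of_int (gcd (gcd (A ^ r) (C ^ r)) ((A + B + C) ^ r)) \<in> \<int>"
    using Q[of 1 0] Q[of 0 1] Q[of 1 1] by (intro G) simp_all
  also have "gcd (gcd (A ^ r) (C ^ r)) ((A + B + C) ^ r) = 1"
    using g1 by simp
  finally obtain m where m: "e = of_int m" by (auto elim: Ints_cases)
  have "e \<noteq> 0" using r_pos D_nonzero kappa_nonzero by (simp add: e_def)
  hence "m \<noteq> 0" using m by auto
  hence "1 \<le> cmod e" unfolding m by simp
  thus ?thesis by (simp add: e_def norm_mult norm_power)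
qed

end

section \<open>Choosing the degree of approximation\<close>

text \<open>
  The two inequalities control the two parts of \<open>\<Lambda>\<^sub>n\<close>, with \<open>X = |\<xi>(Q)|\<close> and \<open>Y
      = |\<xi>(S)|\<close>. The first holds
  for small \<open>n\<close>, the second for large \<open>n\<close>. If \<open>N\<close> is the least index for which the second holds,
  then its failure at \<open>N - 1\<close> bounds \<open>Y\<close> from below, and this gives the first one even at \<open>N + 1\<close>. Here
  \<open>N \<ge> 1\<close> by the gap principle. The worst case is \<open>N = 1\<close>, where the exponents of \<open>X\<^sup>r\<close> on the two sides
  differ by \<open>r - 4\<close>; this is where \<open>r \<ge> 5\<close> is needed.
\<close>

lemma choose_pade_index:
  fixes X Y T L h :: real and r :: nat
  assumes r: "r \<ge> 5" and pos: "X > 0" "Y > 0" "T \<ge> 1" "L \<ge> 1" "h \<ge> 1"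
    and gap: "Y * X \<ge> real r * L / (2 * h) * X ^ r"
    and large: "X ^ r > 1024 * T\<^sup>2 * h ^ 5"
  shows "\<exists>N. \<forall>n\<in>{N, Suc N}.
     2 * h / real r * (T * X ^ r) ^ n * X < L * Y ^ (r - 1) \<and>
     4 * h * (h\<^sup>2 * T) ^ n * (Y * X) < L * (X ^ r) ^ Suc n"
proof -
  define W where "W = X ^ r"
  define q where "q = h\<^sup>2 * T"
  have h1: "h ^ k \<ge> 1" and T1: "T ^ k \<ge> 1" and L1: "L ^ k \<ge> 1" for k
    using pos by simp_all
  have W0: "W > 0" using pos by (simp add: W_def)
  have q1: "q \<ge> 1" unfolding q_def using mult_mono[OF h1[of 2] pos(3)] by simp
  have Wq: "W \<ge> 2 * q"
  proof -
    have "2 * q \<le> 1024 * (T * T) * (h\<^sup>2 * h ^ 3)"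
    proof -
      have "T \<le> T * T" "h\<^sup>2 \<le> h\<^sup>2 * h ^ 3"
        using mult_left_mono[OF pos(3), of T] mult_left_mono[OF h1[of 3], of "h\<^sup>2"] pos
        by (simp_all only: mult_1_right zero_le_power2)
      hence "T * h\<^sup>2 \<le> T * T * (h\<^sup>2 * h ^ 3)" using pos by (intro mult_mono) auto
      moreover have "0 \<le> T * h\<^sup>2" using pos by simp
      ultimately have "2 * (T * h\<^sup>2) \<le> 1024 * (T * T * (h\<^sup>2 * h ^ 3))" by linarith
      thus ?thesis unfolding q_def by (simp only: mult.assoc mult.commute[of "h\<^sup>2" T])
    qed
    also have "\<dots> = 1024 * T\<^sup>2 * h ^ 5" by (simp add: power2_eq_square eval_nat_numeral)
    finally show ?thesis using large by (simp add: W_def)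
  qed
  have W1: "W \<ge> 1" using Wq q1 by linarith
  let ?I = "\<lambda>n. 2 * h / real r * (T * W) ^ n * X < L * Y ^ (r - 1)"
  let ?II = "\<lambda>n. 4 * h * q ^ n * (Y * X) < L * W ^ Suc n"
  have II_Suc: "?II (Suc n)" if "?II n" for n
  proof -
    have "4 * h * q ^ Suc n * (Y * X) = q * (4 * h * q ^ n * (Y * X))" by simp
    also have "\<dots> < q * (L * W ^ Suc n)" using that q1 by (intro mult_strict_left_mono) auto
    also have "\<dots> \<le> W * (L * W ^ Suc n)" using Wq q1 W0 pos by (intro mult_right_mono) auto
    finally show ?thesis by (simp add: mult_ac)
  qed
  have I_pred: "?I n" if "?I (Suc n)" for n
  proof -
    have "1 * 1 \<le> T * W" using pos W1 by (intro mult_mono) auto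
    hence "(T * W) ^ n \<le> (T * W) ^ Suc n" by (intro power_increasing) auto
    hence "2 * h / real r * (T * W) ^ n * X \<le> 2 * h / real r * (T * W) ^ Suc n * X"
      using pos by (intro mult_right_mono mult_left_mono) auto
    with that show ?thesis by linarith
  qed
  have "\<exists>n. ?II n"
  proof -
    obtain n where n: "4 * h * (Y * X) / (L * W) < 2 ^ n" using real_arch_pow[of 2] by auto
    have "4 * h * q ^ n * (Y * X) = q ^ n * (L * W) * (4 * h * (Y * X) / (L * W))"
      using pos W0 by (simp add: field_simps)
    also have "\<dots> < q ^ n * (L * W) * 2 ^ n"
      using n pos W0 q1 by (intro mult_strict_left_mono) auto
    also have "\<dots> = L * W * (2 * q) ^ n" by (simp add: power_mult_distrib mult_ac)
    also have "\<dots> \<le> L * W * W ^ n" using Wq q1 pos W0 by (intro mult_left_mono power_mono) auto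
    finally show ?thesis by (intro exI[of _ n]) (simp add: mult_ac)
  qed
  define N where "N = (LEAST n. ?II n)"
  have N: "?II N" unfolding N_def using \<open>\<exists>n. ?II n\<close> by (rule LeastI_ex)
  have "N \<noteq> 0"
  proof
    assume "N = 0"
    hence "4 * h * (Y * X) < L * W" using N by simp
    moreover have "4 * h * (Y * X) \<ge> 4 * h * (real r * L / (2 * h) * W)"
      using gap pos unfolding W_def by (intro mult_left_mono) auto
    moreover have "4 * h * (real r * L / (2 * h) * W) = 2 * real r * (L * W)" using pos by simp
    moreover have "2 * real r * (L * W) \<ge> 1 * (L * W)" using r pos W0 by (intro mult_right_mono) auto
    ultimately show False by linarith
  qed
  then obtain M where M: "N = Suc M" by (cases N) auto
  have "\<not> ?II M" using not_less_Least[of M ?II] M by (simp add: N_def)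
  hence YX: "4 * h * q ^ M * (Y * X) \<ge> L * W ^ Suc M" by simp
  define k where "k = r - 5"
  have k: "r = k + 5" using r by (simp add: k_def)
  have k': "r - 2 = k + 3" "r - 4 = k + 1" by (simp_all add: k)
  \<comment> \<open>For \<open>r = 5\<close> this is immediate from the assumed lower bound for \<open>W\<close>;
    the power \<open>r - 4\<close> of that bound covers the larger \<open>r\<close>.\<close>
  have S1: "4 ^ (r - 1) * T\<^sup>2 * h ^ r < W ^ (r - 4)"
  proof -
    have "4 ^ (r - 1) * T\<^sup>2 * h ^ r \<le> (1024 * T\<^sup>2 * h ^ 5) ^ (k + 1)"
    proof -
      have "(1024::real) = 4 ^ 5" by simp
      hence "(1024 * T\<^sup>2 * h ^ 5) ^ (k + 1) = 4 ^ (5 * (k + 1)) * T ^ (2 * (k + 1)) * h ^ (5 * (k + 1))"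
        by (simp only: power_mult_distrib power_mult)
      also have "\<dots> \<ge> 4 ^ (r - 1) * T\<^sup>2 * h ^ r"
        using pos unfolding k by (intro mult_mono power_increasing) auto
      finally show ?thesis .
    qed
    also have "\<dots> < W ^ (k + 1)"
      using large pos by (intro power_strict_mono) (auto simp: W_def)
    finally show ?thesis using k by simp
  qed
  have S2: "T ^ r * h ^ (2 * (r - 1)) \<le> W ^ (r - 2)"
  proof -
    have "T ^ r * h ^ (2 * (r - 1)) \<le> T ^ (2 * (k + 3)) * h ^ (5 * (k + 3))"
      using pos unfolding k by (intro mult_mono[where 'a = real] power_increasing) auto
    also have "\<dots> \<le> 1024 ^ (k + 3) * (T ^ (2 * (k + 3)) * h ^ (5 * (k + 3)))"
    proof -
      have "0 \<le> T ^ (2 * (k + 3)) * h ^ (5 * (k + 3))"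
        using h1[of "5 * (k + 3)"] T1[of "2 * (k + 3)"] by (intro mult_nonneg_nonneg; linarith)
      moreover have "(1::real) \<le> 1024 ^ (k + 3)" by (rule one_le_power) simp
      ultimately have "1 * (T ^ (2 * (k + 3)) * h ^ (5 * (k + 3))) \<le> 1024 ^ (k + 3) * (T ^ (2 * (k
          + 3)) * h ^ (5 * (k + 3)))"
        by (rule mult_right_mono[rotated])
      thus ?thesis by (simp only: mult_1_left)
    qed
    also have "\<dots> = (1024 * T\<^sup>2 * h ^ 5) ^ (k + 3)"
      by (simp only: power_mult_distrib power_mult mult.assoc)
    also have "\<dots> \<le> W ^ (k + 3)"
      using large pos by (intro power_mono) (auto simp: W_def)
    finally show ?thesis unfolding k' .
  qed
  have "?I (Suc N)"
  proof -
    \<comment> \<open>Multiplication by \<open>U\<close> turns \<open>Y\<^bsup>r-1\<^esup>\<close> into a power of \<open>4 h q\<^sup>M (Y X)\<close>,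
      which the failure of the second inequality at \<open>M\<close> bounds from below.\<close>
    define U where "U = (4 * h) ^ (r - 1) * q ^ (M * (r - 1)) * X ^ (r - 1)"
    have U0: "U > 0" using pos q1 by (simp add: U_def)
    have "2 * h / real r * (T * W) ^ Suc N * X * U =
       2 / real r * (4 ^ (r - 1) * T\<^sup>2 * h ^ r) * (T ^ r * h ^ (2 * (r - 1))) ^ M * W ^ (M + 3)"
    proof -
      have x: "X * X ^ (r - 1) = W" using r by (simp add: W_def power_eq_if)
      have hh: "h * h ^ (r - 1) = h ^ r" using r by (simp add: power_eq_if)
      have q: "q ^ (M * (r - 1)) = (h ^ (2 * (r - 1))) ^ M * (T ^ (r - 1)) ^ M"
      proof -
        have "q ^ (M * (r - 1)) = (q ^ (r - 1)) ^ M" by (metis mult.commute power_mult)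
        also have "q ^ (r - 1) = h ^ (2 * (r - 1)) * T ^ (r - 1)"
          by (simp only: q_def power_mult_distrib power_mult)
        finally show ?thesis by (simp only: power_mult_distrib)
      qed
      have T: "T ^ Suc N * (T ^ (r - 1)) ^ M = T\<^sup>2 * (T ^ r) ^ M"
      proof -
        have "(T ^ r) ^ M = (T ^ (r - 1)) ^ M * T ^ M"
        proof -
          have "T ^ r = T ^ (r - 1) * T" using r by (simp add: power_eq_if)
          thus ?thesis by (simp only: power_mult_distrib)
        qed
        thus ?thesis by (simp add: M power2_eq_square)
      qed
      have "2 * h / real r * (T * W) ^ Suc N * X * U =
        2 / real r * 4 ^ (r - 1) * (h * h ^ (r - 1)) * (T ^ Suc N * (T ^ (r - 1)) ^ M) * (h ^ (2
            * (r - 1))) ^ M * (X * X ^ (r - 1)) * W ^ Suc N"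
        unfolding U_def q by (simp add: power_mult_distrib mult_ac)
      also have "\<dots> = 2 / real r * (4 ^ (r - 1) * T\<^sup>2 * h ^ r) * (T ^ r * h ^ (2 * (r - 1))) ^ M
          * W ^ (M + 3)"
        unfolding x hh T unfolding M by (simp add: power_mult_distrib eval_nat_numeral mult_ac)
      finally show ?thesis .
    qed
    also have "\<dots> \<le> 1 * (4 ^ (r - 1) * T\<^sup>2 * h ^ r) * (T ^ r * h ^ (2 * (r - 1))) ^ M * W ^ (M + 3)"
      using r pos W0 by (intro mult_right_mono) auto
    also have "\<dots> \<le> 1 * (4 ^ (r - 1) * T\<^sup>2 * h ^ r) * (W ^ (r - 2)) ^ M * W ^ (M + 3)"
      using S2 pos W0 by (intro mult_right_mono mult_left_mono power_mono) auto
    also have "\<dots> < 1 * W ^ (r - 4) * (W ^ (r - 2)) ^ M * W ^ (M + 3)"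
      using S1 W0 by (intro mult_strict_right_mono mult_strict_left_mono) auto
    also have "\<dots> = W ^ (Suc M * (r - 1))"
    proof -
      have "(r - 4) + (r - 2) * M + (M + 3) = Suc M * (r - 1)" unfolding k by (simp add: algebra_simps)
      thus ?thesis by (simp flip: power_add power_mult)
    qed
    also have "\<dots> \<le> L ^ r * W ^ (Suc M * (r - 1))"
      using L1[of r] W0 by (simp add: mult_le_cancel_right1)
    also have "\<dots> = L * (L * W ^ Suc M) ^ (r - 1)"
    proof -
      have "L ^ r = L * L ^ (r - 1)" using r by (simp add: power_eq_if)
      thus ?thesis by (simp only: power_mult_distrib power_mult mult.assoc)
    qed
    also have "\<dots> \<le> L * (4 * h * q ^ M * (Y * X)) ^ (r - 1)"
      using YX pos W0 by (intro mult_left_mono power_mono) auto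
    also have "\<dots> = L * Y ^ (r - 1) * U"
      unfolding U_def power_mult by (simp only: power_mult_distrib mult_ac)
    finally show ?thesis by (rule mult_right_less_imp_less) (use U0 in simp)
  qed
  hence "\<forall>n\<in>{N, Suc N}. ?I n \<and> ?II n"
    using I_pred[of N] N II_Suc[of N] by blast
  thus ?thesis unfolding W_def q_def by blast
qed

section \<open>Large solutions\<close>

text \<open>
  What is left of the hypothesis on the discriminant. Dividing the quadratic form by its content does
  not change the sign of \<open>D\<close>, so it may be taken primitive.
\<close>

locale large_diagonal_form = diagonal_form +
  fixes h :: nat and L :: real
  assumes r5: "r \<ge> 5" and h_pos: "h > 0"
    and primitive_quad: "gcd A (gcd B C) = 1"
    and L_def: "L = cmod jdet / 2"
    and L_power_r: "real r ^ 7 * real h ^ 2 \<le> L ^ r"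
    and L_power_large: "real r ^ 40 * real h ^ (2 * r + 10) \<le> L ^ (r\<^sup>2 + r - 8)"
begin

definition maxnorm :: "int \<times> int \<Rightarrow> real" where "maxnorm p = max (cmod (xi p)) (cmod (eta p))"

definition solution :: "int \<times> int \<Rightarrow> bool" where
  "solution p \<longleftrightarrow> 0 < \<bar>F p\<bar> \<and> \<bar>F p\<bar> \<le> int h"

definition large_solution :: "int \<times> int \<Rightarrow> bool" where
  "large_solution p \<longleftrightarrow> solution p \<and> L \<le> (maxnorm p)\<^sup>2"

definition quot :: "int \<times> int \<Rightarrow> complex" where "quot p = (eta p / xi p) ^ r"

definition nu :: real where "nu = 1 / real r"

text \<open>
  The root of unity near \<open>\<eta>/\<xi>\<close>: the principal branch of \<open>quot p\<^bsup>1/r\<^esup>\<close> is the \<open>r\<close>-th root near \<open>1\<close>.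
\<close>

definition omega :: "int \<times> int \<Rightarrow> complex" where
  "omega p = eta p / (xi p * quot p powr of_real nu)"

definition det :: "int \<times> int \<Rightarrow> int \<times> int \<Rightarrow> int" where
  "det p q = fst p * snd q - snd p * fst q"

lemma h_ge_1: "real h \<ge> 1" using h_pos by simp

lemma L_pos: "L > 0" using jdet_nonzero by (simp add: L_def)

lemma r_power_7_ge: "real r ^ 7 \<ge> 16"
proof -
  have "(16::real) \<le> 5 ^ 7" by simp
  also have "\<dots> \<le> real r ^ 7" using r5 by (intro power_mono) auto
  finally show ?thesis .
qed

lemma L_ge_1: "L \<ge> 1"
proof (rule ccontr)
  assume "\<not> L \<ge> 1"
  hence "L ^ r \<le> 1" using L_pos by (intro power_le_one) auto
  moreover have "16 * 1 \<le> real r ^ 7 * real h ^ 2"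
    using r_power_7_ge h_ge_1 by (intro mult_mono one_le_power) auto
  ultimately show False using L_power_r by linarith
qed

lemma det_lower_bound: "det p q \<noteq> 0 \<Longrightarrow> 2 * L \<le> cmod (xi p * eta q - xi q * eta p)"
proof -
  assume "det p q \<noteq> 0"
  hence "1 \<le> real_of_int \<bar>det p q\<bar>" by linarith
  hence "2 * L * 1 \<le> 2 * L * real_of_int \<bar>det p q\<bar>"
    using L_pos by (intro mult_left_mono) auto
  also have "\<dots> = cmod (xi p * eta q - xi q * eta p)"
    unfolding xi_eta_det det_def[symmetric] norm_mult L_def by simp
  finally show ?thesis by simp
qed

lemma small_solutions_proportional:
  assumes "(maxnorm p)\<^sup>2 < L" "(maxnorm q)\<^sup>2 < L"
  shows "det p q = 0"
proof (rule ccontr)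
  assume "det p q \<noteq> 0"
  have M0: "maxnorm p \<ge> 0" "maxnorm q \<ge> 0" by (simp_all add: maxnorm_def le_max_iff_disj)
  have "2 * L \<le> cmod (xi p * eta q - xi q * eta p)" by (rule det_lower_bound) fact
  also have "\<dots> \<le> cmod (xi p) * cmod (eta q) + cmod (xi q) * cmod (eta p)"
    by (metis norm_mult norm_triangle_ineq4)
  also have "\<dots> \<le> maxnorm p * maxnorm q + maxnorm q * maxnorm p"
    using M0 by (intro add_mono mult_mono) (auto simp: maxnorm_def)
  also have "\<dots> \<le> (maxnorm p)\<^sup>2 + (maxnorm q)\<^sup>2"
    using zero_le_power2[of "maxnorm p - maxnorm q"] unfolding power2_diff by (simp add: algebra_simps)
  also have "\<dots> < 2 * L" using assms by simp
  finally show False by simp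
qed

lemma F_bound:
  assumes "solution p"
  shows "cmod (xi p ^ r - eta p ^ r) \<le> real h"
    and "(maxnorm p) ^ r \<le> cmod (xi p) ^ r + real h"
proof -
  show 1: "cmod (xi p ^ r - eta p ^ r) \<le> real h"
    unfolding F_eq[symmetric] using assms by (simp add: solution_def) linarith
  have "cmod (eta p) ^ r \<le> cmod (xi p) ^ r + cmod (xi p ^ r - eta p ^ r)"
    using norm_triangle_ineq2[of "eta p ^ r" "xi p ^ r"] by (simp add: norm_power norm_minus_commute)
  with 1 show "(maxnorm p) ^ r \<le> cmod (xi p) ^ r + real h" by (simp add: maxnorm_def max_def)
qed

lemma maxnorm_power_ge:
  assumes "L \<le> (maxnorm p)\<^sup>2"
  shows "4 * real h \<le> maxnorm p ^ r" and "L ^ r \<le> (maxnorm p ^ r)\<^sup>2"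
proof -
  have M0: "maxnorm p \<ge> 0" by (simp add: maxnorm_def le_max_iff_disj)
  have "L ^ r \<le> ((maxnorm p)\<^sup>2) ^ r" using assms L_pos by (intro power_mono) auto
  also have "((maxnorm p)\<^sup>2) ^ r = (maxnorm p ^ r)\<^sup>2" by (metis mult.commute power_mult)
  finally show 1: "L ^ r \<le> (maxnorm p ^ r)\<^sup>2" .
  have "(4 * real h)\<^sup>2 = 16 * real h ^ 2" by (simp add: power_mult_distrib)
  also have "\<dots> \<le> real r ^ 7 * real h ^ 2" using r_power_7_ge by (intro mult_right_mono) auto
  also note L_power_r
  also note 1
  finally show "4 * real h \<le> maxnorm p ^ r" by (rule power2_le_imp_le) (use M0 in auto)
qed

context
  fixes p assumes p: "large_solution p"
begin

text \<open>
  The powers \<open>|\<xi>|\<^sup>r\<close> and \<open>|\<eta>|\<^sup>r\<close> differ by at most \<open>h\<close>, which is at most a quarter of the larger one.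
\<close>

lemma large_xi: "3 * maxnorm p ^ r \<le> 4 * cmod (xi p) ^ r" "3 * real h \<le> cmod (xi p) ^ r" "xi p \<noteq> 0"
proof -
  show "3 * maxnorm p ^ r \<le> 4 * cmod (xi p) ^ r" and 1: "3 * real h \<le> cmod (xi p) ^ r"
    using F_bound(2)[of p] maxnorm_power_ge(1)[of p] p by (auto simp: large_solution_def)
  show "xi p \<noteq> 0" using 1 h_ge_1 r5 by (auto simp: power_0_left)
qed

lemma quot_close:
  "cmod (quot p - 1) \<le> real h / cmod (xi p) ^ r" "cmod (quot p - 1) \<le> 1 / 2" "quot p \<noteq> 1" "quot p \<noteq> 0"
proof -
  have e: "quot p - 1 = - (xi p ^ r - eta p ^ r) / xi p ^ r"
    using large_xi(3) by (simp add: quot_def power_divide diff_divide_distrib)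
  show 1: "cmod (quot p - 1) \<le> real h / cmod (xi p) ^ r"
    unfolding e norm_divide norm_power norm_minus_cancel
    using F_bound(1)[of p] p by (intro divide_right_mono) (auto simp: large_solution_def)
  also have "\<dots> \<le> 1 / 2"
    using large_xi(2,3) h_ge_1 by (simp add: divide_simps)
  finally show 2: "cmod (quot p - 1) \<le> 1 / 2" .
  show "quot p \<noteq> 0" using Re_pos_near_1(3)[OF 2] .
  have "xi p ^ r - eta p ^ r \<noteq> 0"
    using p unfolding F_eq[symmetric] by (auto simp: large_solution_def solution_def)
  thus "quot p \<noteq> 1" using e large_xi(3) by auto
qed

lemma quot_powr_power: "(quot p powr of_real nu) ^ r = quot p"
proof -
  have "(quot p powr of_real nu) ^ r = exp (of_real nu * Ln (quot p)) ^ r"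
    using quot_close(4) by (simp add: powr_def)
  also have "\<dots> = exp (of_nat r * (of_real nu * Ln (quot p)))"
    by (rule exp_of_nat_mult[symmetric])
  also have "of_nat r * (of_real nu * Ln (quot p)) = Ln (quot p)" using r5 by (simp add: nu_def)
  finally show ?thesis using quot_close(4) by simp
qed

lemma omega_power: "omega p ^ r = 1"
proof -
  have 1: "quot p * xi p ^ r = eta p ^ r"
    using large_xi(3) by (simp add: quot_def power_divide)
  have 2: "eta p ^ r \<noteq> 0" using quot_close(4) large_xi(3) unfolding 1[symmetric] by simp
  have "omega p ^ r = eta p ^ r / (xi p ^ r * quot p)"
    by (simp only: omega_def power_divide power_mult_distrib quot_powr_power)
  also have "xi p ^ r * quot p = eta p ^ r" using 1 by (simp only: mult.commute)
  finally show ?thesis using 2 by simp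
qed

lemma norm_omega: "cmod (omega p) = 1"
proof -
  have "cmod (omega p) ^ r = cmod (omega p ^ r)" by (rule norm_power[symmetric])
  hence "cmod (omega p) ^ r = 1 ^ r" unfolding omega_power by simp
  thus ?thesis using r5 power_eq_iff_eq_base[of r "cmod (omega p)" 1] by simp
qed

lemma eta_eq: "eta p = omega p * xi p * quot p powr of_real nu"
  using large_xi(3) quot_close(4) by (simp add: omega_def)

lemma quot_powr_close: "cmod (quot p powr of_real nu - 1) \<le> 2 / real r * (real h / cmod (xi p) ^ r)"
proof -
  have "cmod (quot p powr of_real nu - 1) \<le> 2 * nu * cmod (quot p - 1)"
    using r5 quot_close(2) by (intro norm_powr_minus_1_le) (auto simp: nu_def)
  also have "\<dots> \<le> 2 * nu * (real h / cmod (xi p) ^ r)"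
    using quot_close(1) by (intro mult_left_mono) (auto simp: nu_def)
  finally show ?thesis by (simp add: nu_def)
qed

end

text \<open>
  With \<open>\<omega>\<close> common to both points, \<open>\<xi>(p)\<eta>(q) - \<xi>(q)\<eta>(p)\<close> is \<open>\<omega> \<xi>(p) \<xi>(q)\<close> times the difference of two
  numbers that are close to \<open>1\<close>; on the other hand it is at least \<open>|j|\<close>.
\<close>

lemma gap_principle:
  assumes p: "large_solution p" and q: "large_solution q" and "omega p = omega q" "det p q \<noteq> 0"
    and le: "cmod (xi p) \<le> cmod (xi q)"
  shows "real r * L / (2 * real h) * cmod (xi p) ^ r \<le> cmod (xi q) * cmod (xi p)"
proof -
  define X Y where "X = cmod (xi p)" and "Y = cmod (xi q)"
  have pos: "X > 0" "Y > 0" "X ^ r \<le> Y ^ r"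
    using large_xi(3)[OF p] large_xi(3)[OF q] le by (simp_all add: X_def Y_def power_mono)
  have "2 * L \<le> cmod (xi p * eta q - xi q * eta p)" by (rule det_lower_bound) fact
  also have "xi p * eta q - xi q * eta p = omega p * xi p * xi q *
     ((quot q powr of_real nu - 1) - (quot p powr of_real nu - 1))"
    unfolding eta_eq[OF p] eta_eq[OF q] assms(3) by (simp add: algebra_simps)
  also have "cmod \<dots> = X * Y * cmod ((quot q powr of_real nu - 1) - (quot p powr of_real nu - 1))"
    by (simp only: norm_mult norm_omega[OF p] X_def Y_def mult_1_left)
  also have "\<dots> \<le> X * Y * (2 / real r * (real h / Y ^ r) + 2 / real r * (real h / X ^ r))"
    using pos order.trans[OF norm_triangle_ineq4
        add_mono[OF quot_powr_close[OF q] quot_powr_close[OF p]]]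
    by (intro mult_left_mono) (simp_all add: X_def Y_def)
  also have "\<dots> \<le> X * Y * (2 / real r * (real h / X ^ r) + 2 / real r * (real h / X ^ r))"
    using pos by (intro mult_left_mono add_mono divide_left_mono mult_pos_pos) auto
  also have "\<dots> = (X * Y) * (4 * real h) / (real r * X ^ r)" by (simp add: field_simps)
  finally have "2 * L * (real r * X ^ r) \<le> (X * Y) * (4 * real h)"
    using pos r5 by (subst (asm) pos_le_divide_eq) auto
  hence "real r * L * X ^ r \<le> Y * X * (2 * real h)" by (simp add: mult_ac)
  hence "real r * L * X ^ r / (2 * real h) \<le> Y * X" using h_pos by (subst pos_divide_le_eq) auto
  thus ?thesis by (simp add: X_def Y_def)
qed

lemma norm_sqrtD: "(cmod sqrtD)\<^sup>2 = real_of_int \<bar>D\<bar>"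
  using arg_cong[OF sqrtD_sq, of cmod] by (simp add: norm_power)

text \<open>
  Since \<open>|j| = |\<kappa>| |D|\<^bsup>1/2\<^esup>\<close>, the lower bound for \<open>|\<kappa>|\<close> in \<open>disc_bound\<close> bounds \<open>|D|\<^bsup>r-2\<^esup>\<close> by
  \<open>r\<^sup>4 |j|\<^bsup>2r\<^esup>\<close>; the exponents are then rounded up to be independent of \<open>r\<close>.
\<close>

lemma abs_D_le: "real_of_int \<bar>D\<bar> \<le> (2 * L) ^ 4 * real r ^ 2"
proof (rule ccontr)
  define d J where "d = real_of_int \<bar>D\<bar>" and "J = 2 * L"
  assume "\<not> ?thesis"
  hence big: "J ^ 4 * real r ^ 2 < d" by (simp add: d_def J_def)
  have J1: "J \<ge> 1" using L_ge_1 by (simp add: J_def)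
  have d1: "d \<ge> 1" using D_nonzero by (simp add: d_def)
  have J2: "J\<^sup>2 = (cmod \<kappa>)\<^sup>2 * d"
    unfolding d_def norm_sqrtD[symmetric] J_def L_def jdet_eq by (simp
        add: norm_mult power_mult_distrib)
  have "1 \<le> (real r ^ 2 * d * cmod \<kappa> ^ r)\<^sup>2"
    using disc_bound[OF primitive_quad] by (simp add: d_def)
  also have "\<dots> = real r ^ 4 * d\<^sup>2 * ((cmod \<kappa>)\<^sup>2) ^ r"
  proof -
    have "(cmod \<kappa> ^ r)\<^sup>2 = ((cmod \<kappa>)\<^sup>2) ^ r" by (metis mult.commute power_mult)
    moreover have "(real r ^ 2)\<^sup>2 = real r ^ 4" by (simp flip: power_mult)
    ultimately show ?thesis by (simp only: power_mult_distrib)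
  qed
  finally have "d ^ r \<le> real r ^ 4 * d\<^sup>2 * ((cmod \<kappa>)\<^sup>2) ^ r * d ^ r"
    using d1 by (simp add: mult_le_cancel_right1)
  also have "\<dots> = real r ^ 4 * d\<^sup>2 * (J\<^sup>2) ^ r" unfolding J2 by (simp add: power_mult_distrib)
  finally have "d ^ r \<le> d\<^sup>2 * (real r ^ 4 * J ^ (2 * r))"
    unfolding power_mult by (simp only: mult_ac)
  moreover have "d ^ r = d\<^sup>2 * d ^ (r - 2)"
    proof -
    have "2 + (r - 2) = r" using r5 by simp
    thus ?thesis using power_add[of d 2 "r - 2"] by (simp only:)
  qed
  ultimately have 1: "d ^ (r - 2) \<le> real r ^ 4 * J ^ (2 * r)" using d1 by simp
  have "real r ^ 4 * J ^ (2 * r) \<le> real r ^ (2 * (r - 2)) * J ^ (4 * (r - 2))"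
    using r5 J1 by (intro mult_mono[where 'a = real] power_increasing) auto
  also have "\<dots> = (J ^ 4 * real r ^ 2) ^ (r - 2)"
      by (simp only: power_mult_distrib power_mult mult.commute)
  also have "\<dots> < d ^ (r - 2)" using big r5 J1 by (intro power_strict_mono) auto
  finally show False using 1 by simp
qed

text \<open>
  The rate at which the bounds for \<open>\<Lambda>\<^sub>n\<close> grow with \<open>n\<close>: the factor \<open>6\<close> bounds the approximants and
  \<open>r\<^sup>3 \<surd>|D|\<close> is the common denominator.
\<close>

definition T :: real where "T = 6 * real r ^ 3 * cmod sqrtD"

lemma T_ge_1: "T \<ge> 1"
proof -
  have "1 \<le> real_of_int \<bar>D\<bar>" using D_nonzero by simp
  hence "1\<^sup>2 \<le> (cmod sqrtD)\<^sup>2" by (simp add: norm_sqrtD)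
  hence 1: "1 \<le> cmod sqrtD" by (rule power2_le_imp_le) simp
  have "1 * 1 * 1 \<le> 6 * real r ^ 3 * cmod sqrtD"
    using r5 1 by (intro mult_mono one_le_power) auto
  thus ?thesis by (simp add: T_def)
qed

text \<open>
  The gap principle gives \<open>|\<xi>(q)| \<ge> (r L/(2h)) |\<xi>(p)|\<^bsup>r-1\<^esup>\<close>, and \<open>|\<xi>(p)|\<close> is about \<open>\<surd>L\<close> or more. So
  \<open>|\<xi>(q)|\<^bsup>2r\<^esup>\<close> is at least \<open>L\<^bsup>r\<^sup>2+r\<^esup> h\<^bsup>-2r\<^esup>\<close>, of which \<open>L\<^sup>8\<close> pays for \<open>T\<^sup>4\<close>.
\<close>

lemma second_solution_large:
  assumes p: "large_solution p" and q: "large_solution q" and "omega p = omega q" "det p q \<noteq> 0"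
    and le: "cmod (xi p) \<le> cmod (xi q)"
  shows "cmod (xi q) ^ r > 1024 * T\<^sup>2 * real h ^ 5"
proof -
  define X W where "X = cmod (xi p)" and "W = cmod (xi q) ^ r"
  have X0: "X > 0" using large_xi(3)[OF p] by (simp add: X_def)
  define G where "G = real r * L / (2 * real h)"
  have G0: "G \<ge> 0" using L_pos by (simp add: G_def)
  have Xr: "X ^ r = X * X ^ (r - 1)" using r5 by (simp add: power_eq_if)
  have "G * X ^ (r - 1) * X \<le> cmod (xi q) * X"
    using gap_principle[OF assms] Xr by (simp add: G_def X_def mult_ac)
  hence "G * X ^ (r - 1) \<le> cmod (xi q)" using X0 by simp
  hence "(G * X ^ (r - 1)) ^ r \<le> W"
    unfolding W_def using G0 X0 by (intro power_mono) auto
  hence "((G * X ^ (r - 1)) ^ r)\<^sup>2 \<le> W\<^sup>2"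
    using G0 X0 by (intro power_mono) auto
  also have "((G * X ^ (r - 1)) ^ r)\<^sup>2 = (G\<^sup>2) ^ r * ((X ^ r)\<^sup>2) ^ (r - 1)"
  proof -
    have e: "((a ^ m) ^ k)\<^sup>2 = ((a ^ k)\<^sup>2) ^ m" for a :: real and m k
      by (metis mult.assoc mult.commute power_mult)
    have "(G ^ r)\<^sup>2 = (G\<^sup>2) ^ r" by (metis mult.commute power_mult)
    thus ?thesis by (simp only: power_mult_distrib e)
  qed
  finally have 1: "(G\<^sup>2) ^ r * ((X ^ r)\<^sup>2) ^ (r - 1) \<le> W\<^sup>2" .
  \<comment> \<open>Passing from the maximum of \<open>|\<xi>|\<close> and \<open>|\<eta>|\<close> to \<open>|\<xi>|\<close> costs the factor \<open>3/4\<close>, squared here;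
    the factor \<open>r\<^sup>2/4 \<ge> 25/4\<close> from the gap principle makes up for it.\<close>
  have X2: "9 / 16 * L ^ r \<le> (X ^ r)\<^sup>2"
  proof -
    have "0 \<le> maxnorm p" by (simp add: maxnorm_def le_max_iff_disj)
    hence "(3 / 4 * maxnorm p ^ r)\<^sup>2 \<le> (X ^ r)\<^sup>2"
      using large_xi(1)[OF p] by (intro power_mono) (auto simp: X_def)
    moreover have "(3 / 4 * maxnorm p ^ r)\<^sup>2 = 9 / 16 * (maxnorm p ^ r)\<^sup>2" by (simp
        add: power2_eq_square)
    moreover have "L ^ r \<le> (maxnorm p ^ r)\<^sup>2" using maxnorm_power_ge(2) p by (simp
        add: large_solution_def)
    ultimately show ?thesis by linarith
  qed
  have "L ^ (r\<^sup>2 + r) = (L\<^sup>2) ^ r * (L ^ r) ^ (r - 1)"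
  proof -
    have "r\<^sup>2 + r = 2 * r + r * (r - 1)" by (simp add: power2_eq_square algebra_simps)
    thus ?thesis by (simp only: power_add power_mult)
  qed
  also have "\<dots> \<le> (25 / 4 * L\<^sup>2) ^ r * (9 / 16 * L ^ r) ^ (r - 1)"
  proof -
    have "(1::real) \<le> (25/4) * (25/4 * (9/16)) ^ (r - 1)"
      using mult_mono[of "1::real" "25/4" 1 "(25/4 * (9/16)) ^ (r - 1)"] by (simp add: one_le_power)
    also have "\<dots> = (25/4) ^ r * (9/16) ^ (r - 1)"
    proof -
      have "((25::real)/4) ^ r = 25/4 * (25/4) ^ (r - 1)" using r5 by (cases r) simp_all
      thus ?thesis by (simp only: power_mult_distrib mult.assoc)
    qed
    finally have "1 * ((L\<^sup>2) ^ r * (L ^ r) ^ (r - 1)) \<le> (25/4) ^ r * (9/16) ^ (r - 1) * ((L\<^sup>2) ^ r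
        * (L ^ r) ^ (r - 1))"
      using L_pos by (intro mult_right_mono) auto
    thus ?thesis by (simp only: power_mult_distrib mult_ac mult_1_left)
  qed
  also have "\<dots> \<le> ((G * real h)\<^sup>2) ^ r * ((X ^ r)\<^sup>2) ^ (r - 1)"
  proof (intro mult_mono power_mono X2)
    have "25 / 4 * L\<^sup>2 \<le> (real r)\<^sup>2 / 4 * L\<^sup>2"
      using power_mono[of 5 "real r" 2] r5 by (intro mult_right_mono) auto
    also have "\<dots> = (G * real h)\<^sup>2" using h_pos by (simp add: G_def power_divide power_mult_distrib)
    finally show "25 / 4 * L\<^sup>2 \<le> (G * real h)\<^sup>2" .
  qed (use L_pos in auto)
  also have "\<dots> = real h ^ (2 * r) * ((G\<^sup>2) ^ r * ((X ^ r)\<^sup>2) ^ (r - 1))"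
    unfolding power_mult power_mult_distrib by (simp only: mult_ac)
  also have "\<dots> \<le> real h ^ (2 * r) * W\<^sup>2" using 1 by (intro mult_left_mono) auto
  finally have 2: "L ^ (r\<^sup>2 + r) \<le> real h ^ (2 * r) * W\<^sup>2" .
  have "real r ^ 40 * real h ^ (2 * r + 10) * L ^ 8 \<le> L ^ (r\<^sup>2 + r - 8) * L ^ 8"
    using L_power_large L_pos by (intro mult_right_mono) auto
  also have "\<dots> = L ^ (r\<^sup>2 + r)"
  proof -
    have "8 \<le> r\<^sup>2 + r" using r5 by (intro trans_le_add1) (use power_mono[of 5 r 2] in auto)
    thus ?thesis by (simp flip: power_add)
  qed
  also note 2
  finally have "real h ^ (2 * r) * (real r ^ 40 * real h ^ 10 * L ^ 8) \<le> real h ^ (2 * r) * W\<^sup>2"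
    by (simp add: power_add mult_ac)
  hence 3: "real r ^ 40 * real h ^ 10 * L ^ 8 \<le> W\<^sup>2" using h_pos by simp
  have "(1024 * T\<^sup>2 * real h ^ 5)\<^sup>2 = 1024\<^sup>2 * 6 ^ 4 * real r ^ 12 * ((cmod sqrtD)\<^sup>2)\<^sup>2 * real h ^ 10"
    by (simp add: T_def power_mult_distrib flip: power_mult)
  also have "\<dots> \<le> 1024\<^sup>2 * 6 ^ 4 * real r ^ 12 * ((2 * L) ^ 4 * real r ^ 2)\<^sup>2 * real h ^ 10"
    unfolding norm_sqrtD using abs_D_le L_pos
    by (intro mult_right_mono mult_left_mono power_mono) auto
  also have "\<dots> = (1024\<^sup>2 * 6 ^ 4 * 2 ^ 8) * (real r ^ 16 * real h ^ 10 * L ^ 8)"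
    by (simp add: power_mult_distrib flip: power_mult power_add)
  also have "\<dots> < real r ^ 24 * (real r ^ 16 * real h ^ 10 * L ^ 8)"
  proof (rule mult_strict_right_mono)
    have "(1024\<^sup>2 * 6 ^ 4 * 2 ^ 8 :: real) < 5 ^ 24" by simp
    also have "\<dots> \<le> real r ^ 24" using r5 by (intro power_mono) auto
    finally show "1024\<^sup>2 * 6 ^ 4 * 2 ^ 8 < real r ^ 24" .
  qed (use r5 h_pos L_pos in auto)
  also have "\<dots> = real r ^ 40 * real h ^ 10 * L ^ 8" by (simp flip: power_add mult.assoc)
  also note 3
  finally show ?thesis unfolding W_def[symmetric] by (rule power2_less_imp_less) (simp add: W_def)
qed

text \<open>
  The linear form is an integral multiple of \<open>j\<close> but smaller than \<open>|j|\<close>. One part of it comes from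
  \<open>\<eta>(q)/\<xi>(q)\<close> not being equal to \<open>\<omega>\<close>, the other one from the remainder of the approximation at \<open>quot p\<close>.
\<close>

lemma pade_form_vanishes:
  fixes n :: nat
  assumes p: "large_solution p" and q: "large_solution q" and \<omega>: "omega p = omega q"
    and I: "2 * real h / real r * (T * cmod (xi p) ^ r) ^ n * cmod (xi p) < L * cmod (xi q) ^ (r - 1)"
    and II: "4 * real h * ((real h)\<^sup>2 * T) ^ n * (cmod (xi q) * cmod (xi p)) < L
        * (cmod (xi p) ^ r) ^ Suc n"
  shows "xi p * eta q * pade n nu (quot p) = xi q * eta p * pade n (- nu) (quot p)"
proof (rule ccontr)
  define \<Lambda> where "\<Lambda> = xi p * eta q * pade n nu (quot p) - xi q * eta p * pade n (- nu) (quot p)"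
  assume "\<not> ?thesis"
  hence \<Lambda>0: "\<Lambda> \<noteq> 0" by (simp add: \<Lambda>_def)
  define X Y W H where "X = cmod (xi p)" and "Y = cmod (xi q)" and "W = X ^ r" and "H = real h"
  have pos: "X > 0" "Y > 0" "W > 0" "H > 0" "T > 0"
    using large_xi(3)[OF p] large_xi(3)[OF q] h_ge_1 T_ge_1 by (simp_all add: X_def Y_def W_def H_def)
  obtain k :: int where k: "(of_nat (r ^ 3) * sqrtD * xi p ^ r) ^ n * \<Lambda> = of_int k * jdet"
    using pade_form_integrality[OF large_xi(3)[OF p], of n q] unfolding \<Lambda>_def nu_def quot_def by blast
  have "(of_nat (r ^ 3) * sqrtD * xi p ^ r) ^ n * \<Lambda> \<noteq> 0"
    using \<Lambda>0 r5 sqrtD_nonzero large_xi(3)[OF p] by simp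
  hence "k \<noteq> 0" using k by auto
  hence "1 * cmod jdet \<le> cmod (of_int k) * cmod jdet"
    by (intro mult_right_mono) auto
  hence "2 * L \<le> cmod ((of_nat (r ^ 3) * sqrtD * xi p ^ r) ^ n * \<Lambda>)"
    unfolding k by (simp add: L_def norm_mult)
  also have "\<dots> = (T / 6 * W) ^ n * cmod \<Lambda>"
    by (simp add: norm_mult norm_power T_def W_def X_def)
  finally have lower: "2 * L \<le> (T / 6 * W) ^ n * cmod \<Lambda>" .
  have nu: "\<bar>nu\<bar> < 1" "nu \<noteq> 0" using r5 by (auto simp: nu_def)
  have "\<Lambda> = omega p * xi p * xi q * ((quot q powr of_real nu - 1) * pade n nu (quot p) +
      (pade n nu (quot p) - quot p powr of_real nu * pade n (- nu) (quot p)))"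
    unfolding \<Lambda>_def eta_eq[OF p] eta_eq[OF q] \<omega> by (simp add: algebra_simps)
  hence "cmod \<Lambda> = X * Y * cmod ((quot q powr of_real nu - 1) * pade n nu (quot p) +
      (pade n nu (quot p) - quot p powr of_real nu * pade n (- nu) (quot p)))"
    by (simp only: norm_mult norm_omega[OF p] X_def Y_def mult_1_left)
  also have "\<dots> \<le> X * Y * (2 / real r * (H / Y ^ r) * 6 ^ n + 4 * 2 ^ n * (H / W) ^ (2 * n + 1))"
  proof (intro mult_left_mono order.trans[OF norm_triangle_ineq] add_mono)
    show "cmod ((quot q powr of_real nu - 1) * pade n nu (quot p)) \<le> 2 / real r * (H / Y ^ r) * 6 ^ n"
      unfolding norm_mult H_def Y_def
      by (intro mult_mono quot_powr_close[OF q] norm_pade_le nu Re_pos_near_1 quot_close[OF p]) auto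
    have "cmod (pade n nu (quot p) - quot p powr of_real nu * pade n (- nu) (quot p))
       \<le> 4 * 2 ^ n * cmod (quot p - 1) ^ (2 * n + 1)"
      by (intro pade_approx nu quot_close[OF p])
    also have "\<dots> \<le> 4 * 2 ^ n * (H / W) ^ (2 * n + 1)"
      using quot_close(1)[OF p] by (intro mult_left_mono power_mono) (auto simp: H_def W_def X_def)
    finally show "cmod (pade n nu (quot p) - quot p powr of_real nu * pade n (- nu) (quot p))
       \<le> 4 * 2 ^ n * (H / W) ^ (2 * n + 1)" .
  qed (use pos in auto)
  finally have "(T / 6 * W) ^ n * cmod \<Lambda> \<le>
     (T / 6 * W) ^ n * (X * Y * (2 / real r * (H / Y ^ r) * 6 ^ n + 4 * 2 ^ n * (H / W) ^ (2 * n + 1)))"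
    using pos by (intro mult_left_mono) auto
  also have "\<dots> = (T / 6 * W) ^ n * X * Y * (2 / real r * (H / Y ^ r) * 6 ^ n) +
      (T / 6 * W) ^ n * X * Y * (4 * 2 ^ n * (H / W) ^ (2 * n + 1))"
    by (simp only: distrib_left mult.assoc)
  also have "(T / 6 * W) ^ n * X * Y * (2 / real r * (H / Y ^ r) * 6 ^ n) < L"
  proof -
    have "(T / 6 * W) ^ n * X * Y * (2 / real r * (H / Y ^ r) * 6 ^ n) =
        2 * H / real r * (T / 6 * W * 6) ^ n * X * (Y / Y ^ r)"
      by (simp only: power_mult_distrib) simp
    also have "T / 6 * W * 6 = T * W" by simp
    also have "Y / Y ^ r = 1 / Y ^ (r - 1)" using pos r5 by (simp add: power_eq_if)
    finally have "(T / 6 * W) ^ n * X * Y * (2 / real r * (H / Y ^ r) * 6 ^ n) = 2 * H / real r * (T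
        * W) ^ n * X / Y ^ (r - 1)"
      by simp
    also have "\<dots> < L" using I pos by (subst pos_divide_less_eq) (auto simp: X_def Y_def W_def H_def)
    finally show ?thesis .
  qed
  also have "(T / 6 * W) ^ n * X * Y * (4 * 2 ^ n * (H / W) ^ (2 * n + 1)) < L"
  proof -
    have "(T / 6 * W) ^ n * X * Y * (4 * 2 ^ n * (H / W) ^ (2 * n + 1)) =
        4 * H * (T / 6 * W * 2 * (H / W)\<^sup>2) ^ n * (Y * X) / W"
      by (simp only: power_mult_distrib power_mult power_add) simp
    also have "T / 6 * W * 2 * (H / W)\<^sup>2 = (H\<^sup>2 * T / W) / 3"
      using pos by (simp add: power2_eq_square field_simps)
    also have "4 * H * ((H\<^sup>2 * T / W) / 3) ^ n * (Y * X) / W \<le> 4 * H * (H\<^sup>2 * T / W) ^ n * (Y * X) / W"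
    proof -
      have "0 \<le> H\<^sup>2 * T / W" using pos by simp
      moreover have "z / 3 \<le> z \<and> 0 \<le> z / 3" if "0 \<le> z" for z :: real using that by simp
      ultimately have "H\<^sup>2 * T / W / 3 \<le> H\<^sup>2 * T / W" "0 \<le> H\<^sup>2 * T / W / 3" by blast+
      thus ?thesis using pos by (intro divide_right_mono mult_right_mono mult_left_mono power_mono)
          simp_all
    qed
    also have "\<dots> = 4 * H * (H\<^sup>2 * T) ^ n * (Y * X) / W ^ Suc n" by (simp add: power_divide)
    also have "\<dots> < L" using II pos by (subst pos_divide_less_eq) (auto simp: X_def Y_def W_def H_def)
    finally show ?thesis .
  qed
  finally show False using lower by simp
qed

text \<open>
  If the linear form vanishes for two consecutive indices, the two approximants agree at \<open>quot q \<noteq> 1\<close>.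
\<close>

lemma no_three_large_solutions:
  assumes sols: "large_solution p" "large_solution q" "large_solution s"
    and \<omega>: "omega p = omega q" "omega q = omega s"
    and dets: "det p q \<noteq> 0" "det q s \<noteq> 0"
    and le: "cmod (xi p) \<le> cmod (xi q)" "cmod (xi q) \<le> cmod (xi s)"
  shows False
proof -
  have "\<exists>N. \<forall>n\<in>{N, Suc N}.
     2 * real h / real r * (T * cmod (xi q) ^ r) ^ n * cmod (xi q) < L * cmod (xi s) ^ (r - 1) \<and>
     4 * real h * ((real h)\<^sup>2 * T) ^ n * (cmod (xi s) * cmod (xi q)) < L * (cmod (xi q) ^ r) ^ Suc n"
    by (intro choose_pade_index r5 T_ge_1 L_ge_1 h_ge_1 gap_principle second_solution_large[OF sols(1)] assms)
       (use large_xi(3)[OF sols(2)] large_xi(3)[OF sols(3)] in auto)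
  then obtain N where N: "\<And>n. n \<in> {N, Suc N} \<Longrightarrow>
     2 * real h / real r * (T * cmod (xi q) ^ r) ^ n * cmod (xi q) < L * cmod (xi s) ^ (r - 1) \<and>
     4 * real h * ((real h)\<^sup>2 * T) ^ n * (cmod (xi s) * cmod (xi q)) < L * (cmod (xi q) ^ r) ^ Suc n"
    by blast
  have van: "xi q * eta s * pade n nu (quot q) = xi s * eta q * pade n (- nu) (quot q)" if "n
      \<in> {N, Suc N}" for n
    using N[OF that] by (intro pade_form_vanishes sols \<omega>) auto
  define a b where "a = xi q * eta s" and "b = xi s * eta q"
  have eta0: "eta p \<noteq> 0" if "large_solution p" for p
    using quot_close(4)[OF that] r5 by (auto simp: quot_def)
  have ab: "a \<noteq> 0" "b \<noteq> 0"
    using large_xi(3)[OF sols(2)] large_xi(3)[OF sols(3)] eta0[OF sols(2)] eta0[OF sols(3)] by (auto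
        simp: a_def b_def)
  have "a * b * (pade N nu (quot q) * pade (Suc N) (- nu) (quot q)) =
     (a * pade N nu (quot q)) * (b * pade (Suc N) (- nu) (quot q))" by (simp add: mult_ac)
  also have "\<dots> = (b * pade N (- nu) (quot q)) * (a * pade (Suc N) nu (quot q))"
    using van[of N] van[of "Suc N"] by (simp add: a_def b_def)
  also have "\<dots> = a * b * (pade (Suc N) nu (quot q) * pade N (- nu) (quot q))" by (simp add: mult_ac)
  finally have "pade N nu (quot q) * pade (Suc N) (- nu) (quot q) = pade (Suc N) nu (quot q)
      * pade N (- nu) (quot q)"
    using ab by simp
  moreover have "\<dots> \<noteq> pade N nu (quot q) * pade (Suc N) (- nu) (quot q)"
    using pade_determinant_nonzero[of nu "quot q" N] quot_close(3)[OF sols(2)] r5 by (auto simp: nu_def)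
  ultimately show False by simp
qed

section \<open>Counting\<close>

lemma small_if_not_large: "solution p \<Longrightarrow> \<not> large_solution p \<Longrightarrow> (maxnorm p)\<^sup>2 < L"
  by (auto simp: large_solution_def)

text \<open>
  Three distinct members of a class, ordered by \<open>|\<xi>|\<close>, would contradict \<open>no_three_large_solutions\<close>.
\<close>

lemma class_at_most_two:
  assumes pairwise: "\<And>p q. p \<in> S \<Longrightarrow> q \<in> S \<Longrightarrow> p \<noteq> q \<Longrightarrow> det p q \<noteq> 0"
    and S: "\<And>p. p \<in> S \<Longrightarrow> large_solution p \<and> omega p = \<omega>"
  shows "finite S \<and> card S \<le> 2"
proof (rule ccontr)
  assume not: "\<not> (finite S \<and> card S \<le> 2)"
  have "\<exists>U. U \<subseteq> S \<and> card U = 3"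
  proof (cases "finite S")
    case True
    with not have "3 \<le> card S" by simp
    thus ?thesis by (meson obtain_subset_with_card_n)
  next
    case False
    thus ?thesis using infinite_arbitrarily_large[of S 3] by blast
  qed
  then obtain U where U: "U \<subseteq> S" "card U = 3" by blast
  then obtain p q s where pqs: "U = {p, q, s}" "p \<noteq> q" "p \<noteq> s" "q \<noteq> s"
    by (auto simp: card_3_iff)
  have *: False if "a \<in> U" "b \<in> U" "d \<in> U" "a \<noteq> b" "b \<noteq> d" "cmod (xi a) \<le> cmod (xi b)" "cmod (xi b)
      \<le> cmod (xi d)" for a b d
  proof -
    have "a \<in> S" "b \<in> S" "d \<in> S" using that U by auto
    thus False using no_three_large_solutions[of a b d] S[of a] S[of b] S[of d] pairwise that by simp
  qed
  have "p \<in> U" "q \<in> U" "s \<in> U" using pqs by auto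
  thus False
    using *[of p q s] *[of p s q] *[of q p s] *[of q s p] *[of s p q] *[of s q p] pqs(2-4)
    by (smt (verit))
qed

lemma primitive_proportional:
  assumes "gcd (fst p) (snd p) = 1" "gcd (fst q) (snd q) = 1" "det p q = 0"
  shows "q = p \<or> q = (- fst p, - snd p)"
proof -
  obtain x y x' y' where pq: "p = (x, y)" "q = (x', y')" by (cases p, cases q)
  have e: "x * y' = y * x'" using assms(3) by (simp add: det_def pq)
  have c: "coprime x y" "coprime x' y'" using assms by (simp_all add: pq coprime_iff_gcd_eq_1)
  have "x dvd y * x'" "x' dvd x * y'" "y dvd x * y'" "y' dvd y * x'"
    using e by (metis dvd_triv_left dvd_triv_right)+
  hence d: "x dvd x'" "x' dvd x" "y dvd y'" "y' dvd y"
    using c by (simp_all add: coprime_dvd_mult_right_iff coprime_dvd_mult_left_iff coprime_commute)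
  have "\<bar>x\<bar> = \<bar>x'\<bar>" "\<bar>y\<bar> = \<bar>y'\<bar>" using d by (auto intro: zdvd_antisym_abs)
  thus ?thesis using e c unfolding pq by (auto simp: abs_eq_iff)
qed

text \<open>
  Representatives of the solutions up to sign are pairwise not proportional. At most one of them is
  small, and each \<open>\<omega> \<in> \<Omega>\<close> accounts for at most two large ones.
\<close>

lemma num_solutions_le:
  assumes fin: "finite \<Omega>" and \<Omega>: "\<And>p. large_solution p \<Longrightarrow> omega p \<in> \<Omega>"
  shows "num_solutions r c h \<le> enat (2 * card \<Omega> + 1)"
proof -
  define P where "P = primitive_solutions r c h"
  define f :: "int \<times> int \<Rightarrow> (int \<times> int) set" where "f = (\<lambda>(x, y). {(x, y), (- x, - y)})"
  obtain R where R: "R \<subseteq> P" "inj_on f R" "f ` P = f ` R"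
    using subset_image_inj[of "f ` P" f P] by auto
  have prim: "gcd (fst p) (snd p) = 1" "solution p" if "p \<in> R" for p
    using that R(1) by (auto simp: P_def primitive_solutions_def solution_def F_def)
  have pairwise: "det p q \<noteq> 0" if "p \<in> R" "q \<in> R" "p \<noteq> q" for p q
  proof
    assume "det p q = 0"
    hence "q = p \<or> q = (- fst p, - snd p)" using prim that by (intro primitive_proportional) auto
    hence "f p = f q" by (auto simp: f_def case_prod_unfold)
    thus False using R(2) that by (auto dest: inj_onD)
  qed
  define Rl where "Rl = {p \<in> R. large_solution p}"
  define Rs where "Rs = {p \<in> R. \<not> large_solution p}"
  have Rs: "finite Rs \<and> card Rs \<le> 1"
  proof -
    have eq: "p = q" if "p \<in> Rs" "q \<in> Rs" for p q
    proof (rule ccontr)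
      assume "p \<noteq> q"
      hence "det p q \<noteq> 0" using pairwise that by (simp add: Rs_def)
      moreover have "det p q = 0"
        using that prim(2) by (intro small_solutions_proportional small_if_not_large) (auto
            simp: Rs_def)
      ultimately show False by simp
    qed
    show ?thesis
    proof (cases "Rs = {}")
      case False
      then obtain p where "p \<in> Rs" by blast
      hence "Rs = {p}" using eq by blast
      thus ?thesis by simp
    qed simp
  qed
  have fibre: "finite {p \<in> Rl. omega p = \<omega>} \<and> card {p \<in> Rl. omega p = \<omega>} \<le> 2" for \<omega>
    by (rule class_at_most_two[where \<omega> = \<omega>]) (auto simp: Rl_def intro: pairwise[THEN notE])
  have Rl_eq: "Rl = (\<Union>\<omega>\<in>\<Omega>. {p \<in> Rl. omega p = \<omega>})" using \<Omega> by (auto simp: Rl_def)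
  have "finite Rl" by (subst Rl_eq) (use fin fibre in auto)
  have "card Rl \<le> (\<Sum>\<omega>\<in>\<Omega>. card {p \<in> Rl. omega p = \<omega>})"
    by (subst Rl_eq) (rule card_UN_le[OF fin])
  also have "\<dots> \<le> (\<Sum>\<omega>\<in>\<Omega>. 2)" using fibre by (intro sum_mono) auto
  finally have "card Rl \<le> 2 * card \<Omega>" by (simp add: mult.commute)
  have RU: "R = Rl \<union> Rs" by (auto simp: Rl_def Rs_def)
  hence "finite R" using \<open>finite Rl\<close> Rs by simp
  have "card R \<le> 2 * card \<Omega> + 1"
    using card_Un_le[of Rl Rs] RU Rs \<open>card Rl \<le> 2 * card \<Omega>\<close> by simp
  moreover have "num_solutions r c h = enat (card R)"
    using R \<open>finite R\<close> by (simp add: num_solutions_def P_def[symmetric] f_def[symmetric] card_image)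
  ultimately show ?thesis by simp
qed

lemma num_solutions_general: "num_solutions r c h \<le> enat (3 * r)"
proof -
  have "finite {z::complex. z ^ r = 1}" "card {z::complex. z ^ r = 1} \<le> r"
    using r5 by (auto intro!: finite_roots_unity card_roots_unity)
  hence "num_solutions r c h \<le> enat (2 * card {z::complex. z ^ r = 1} + 1)"
    by (intro num_solutions_le) (auto simp: omega_power)
  also have "\<dots> \<le> enat (3 * r)"
    using \<open>card {z::complex. z ^ r = 1} \<le> r\<close> r5 by simp
  finally show ?thesis .
qed

context
  assumes D_pos: "D > 0"
begin

lemma real_thetas: "\<theta> \<in> \<real>" "\<theta>' \<in> \<real>"
proof -
  have "Re (sqrtD\<^sup>2) = of_int D" "Im (sqrtD\<^sup>2) = 0" unfolding sqrtD_sq by simp_all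
  hence "Re sqrtD * Re sqrtD - Im sqrtD * Im sqrtD = of_int D" "Re sqrtD * Im sqrtD = 0"
    by (auto simp: power2_eq_square)
  moreover have "real_of_int D > 0" using D_pos by simp
  moreover have "0 \<le> Im sqrtD * Im sqrtD" by simp
  ultimately have "Im sqrtD = 0" by (cases "Re sqrtD = 0") auto
  hence s: "sqrtD \<in> \<real>" by (simp add: complex_is_Real_iff)
  have t: "\<theta> = (of_int B + sqrtD) / 2" "\<theta>' = (of_int B - sqrtD) / 2"
    unfolding sqrtD_def theta(1)[symmetric] by simp_all
  show "\<theta> \<in> \<real>" "\<theta>' \<in> \<real>" unfolding t using s by auto
qed

lemma conj_pair_real: "conj_pair z z' \<Longrightarrow> z \<in> \<real> \<and> z' \<in> \<real>"
  using real_thetas by (auto simp: conj_pair_def)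

lemma quot_powr_real:
  assumes p: "large_solution p"
  shows "quot p powr of_real nu \<in> \<real>"
proof -
  have "quot p = (of_nat r * sqrtD * eta p ^ r) / (of_nat r * sqrtD * xi p ^ r)"
    using r5 sqrtD_nonzero by (simp add: quot_def power_divide)
  also have "\<dots> \<in> \<real>" using conj_pair_real[OF conj_pair_powers[of p]] by (intro Reals_divide) auto
  finally obtain x where x: "quot p = of_real x" by (elim Reals_cases)
  have "x > 0" using Re_pos_near_1(1)[OF quot_close(2)[OF p]] unfolding x by simp
  hence "quot p powr of_real nu = of_real (x powr nu)" unfolding x by (subst powr_of_real) auto
  thus ?thesis by simp
qed

text \<open>
  For \<open>D > 0\<close> conjugate pairs consist of real numbers, and \<open>quot p\<close> is real
      and close to \<open>1\<close>, so the ratio is real.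
  As a quotient of roots of unity it has modulus \<open>1\<close>.
\<close>

lemma omega_real_ratio:
  assumes p: "large_solution p" and q: "large_solution q"
  shows "omega p = omega q \<or> omega p = - omega q"
proof -
  have "omega p / omega q = (xi q * eta p / \<kappa>) / (xi p * eta q / \<kappa>) *
      (quot q powr of_real nu / quot p powr of_real nu)"
    using kappa_nonzero by (simp add: omega_def field_simps)
  also have "\<dots> \<in> \<real>"
  proof -
    note real = conj_pair_real[OF conj_pair_mixed[of p q]]
    show ?thesis
      by (rule Reals_mult[OF Reals_divide[OF conjunct2[OF real] conjunct1[OF real]]
            Reals_divide[OF quot_powr_real[OF q] quot_powr_real[OF p]]])
  qed
  finally obtain x where x: "omega p / omega q = of_real x" by (elim Reals_cases)
  have "cmod (omega p / omega q) = 1" using norm_omega[OF p] norm_omega[OF q] by (simp add: norm_divide)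
  hence "x = 1 \<or> x = -1" unfolding x by auto
  moreover have "omega q \<noteq> 0" using norm_omega[OF q] by auto
  ultimately show ?thesis using x by (auto simp: field_simps)
qed

lemma num_solutions_real: "num_solutions r c h \<le> 6"
proof -
  obtain z where z: "\<And>p. large_solution p \<Longrightarrow> omega p \<in> {z, - z}"
    using omega_real_ratio by blast
  have "num_solutions r c h \<le> enat (2 * card {z, - z} + 1)"
    by (rule num_solutions_le) (use z in auto)
  also have "\<dots> \<le> enat 6" by (simp add: card_insert_if)
  finally show ?thesis by (simp add: numeral_eq_enat)
qed

lemma num_solutions_real_odd: "odd r \<Longrightarrow> num_solutions r c h \<le> 3"
proof -
  assume "odd r"
  have "omega p = omega q" if pq: "large_solution p" "large_solution q" for p q
  proof (rule ccontr)
    assume "omega p \<noteq> omega q"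
    hence "omega p = - omega q" using omega_real_ratio[OF pq] by simp
    hence "omega p ^ r = - (omega q ^ r)" using \<open>odd r\<close> by simp
    thus False by (simp add: omega_power pq)
  qed
  then obtain z where z: "\<And>p. large_solution p \<Longrightarrow> omega p \<in> {z}" by blast
  have "num_solutions r c h \<le> enat (2 * card {z} + 1)"
    by (rule num_solutions_le) (use z in auto)
  thus ?thesis by (simp add: numeral_eq_enat)
qed

lemma real_directions:
  "\<exists>\<tau> a b. \<alpha> = \<tau> * of_real a \<and> \<beta> = \<tau> * of_real b"
  "\<exists>\<tau> a b. \<gamma> = \<tau> * of_real a \<and> \<delta> = \<tau> * of_real b"
proof -
  obtain t t' where t: "\<theta> = of_real t" "\<theta>' = of_real t'" using real_thetas by (auto elim!: Reals_cases)
  have e: "\<alpha> * \<delta> = \<kappa> * \<theta>" "\<beta> * \<gamma> = \<kappa> * \<theta>'" using kappa_nonzero by (simp_all add: \<theta>_def \<theta>'_def)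
  note eqs = e[unfolded t] quad_coeffs(1,3)
  have j: "\<alpha> * \<delta> - \<beta> * \<gamma> \<noteq> 0" using jdet_nonzero by (simp only: jdet_def not_False_eq_True)
  show "\<exists>\<tau> a b. \<alpha> = \<tau> * of_real a \<and> \<beta> = \<tau> * of_real b"
  proof (cases "\<delta> = 0")
    case False
    thus ?thesis using eqs
      by (intro exI[of _ "\<kappa> / \<delta>"] exI[of _ t] exI[of _ "of_int C"]) (auto simp: field_simps)
  next
    case True
    hence "\<gamma> \<noteq> 0" using j by auto
    thus ?thesis using eqs
      by (intro exI[of _ "\<kappa> / \<gamma>"] exI[of _ "of_int A"] exI[of _ t']) (auto simp: field_simps)
  qed
  show "\<exists>\<tau> a b. \<gamma> = \<tau> * of_real a \<and> \<delta> = \<tau> * of_real b"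
  proof (cases "\<alpha> = 0")
    case False
    thus ?thesis using eqs
      by (intro exI[of _ "\<kappa> / \<alpha>"] exI[of _ "of_int A"] exI[of _ t]) (auto simp: field_simps)
  next
    case True
    hence "\<beta> \<noteq> 0" using j by auto
    thus ?thesis using eqs
      by (intro exI[of _ "\<kappa> / \<beta>"] exI[of _ t'] exI[of _ "of_int C"]) (auto simp: field_simps)
  qed
qed

text \<open>
  Write \<open>\<xi> = \<tau> l\<close> and \<open>\<eta> = \<tau>' m\<close> with real linear forms \<open>l\<close> and \<open>m\<close>. Evaluating \<open>F\<close> at the real zeros of
  \<open>m\<close> and of \<open>l\<close> shows that \<open>\<tau>\<^sup>r\<close> and \<open>-\<tau>'\<^sup>r\<close> are real with the sign of \<open>F\<close>. As \<open>r\<close> is even, there is no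
  cancellation in \<open>F = \<xi>\<^sup>r - \<eta>\<^sup>r\<close>, so both powers are bounded by \<open>h\<close>.
\<close>

lemma definite_no_large_solution:
  assumes "definite_form r c"
  shows "\<not> large_solution p"
proof
  assume p: "large_solution p"
  obtain \<tau> a b \<tau>' a' b' where ab: "\<alpha> = \<tau> * of_real a" "\<beta> = \<tau> * of_real b" "\<gamma> = \<tau>' * of_real a'" "\<delta>
      = \<tau>' * of_real b'"
    using real_directions by blast
  define f :: "real \<Rightarrow> real \<Rightarrow> real" where "f = form_eval r c"
  have f: "complex_of_real (f x y) = \<tau> ^ r * of_real ((a * x + b * y) ^ r) - \<tau>' ^ r * of_real ((a'
      * x + b' * y) ^ r)" for x y
  proof -
    have "complex_of_real (f x y) = form_eval r c (of_real x) (of_real y)"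
      by (simp add: f_def form_eval_def)
    also have "\<dots> = (\<alpha> * of_real x + \<beta> * of_real y) ^ r - (\<gamma> * of_real x + \<delta> * of_real y) ^ r"
      using diag unfolding diagonalized_by_def by blast
    also have "\<alpha> * of_real x + \<beta> * of_real y = \<tau> * of_real (a * x + b * y)" by (simp
        add: ab algebra_simps)
    also have "\<gamma> * of_real x + \<delta> * of_real y = \<tau>' * of_real (a' * x + b' * y)" by (simp
        add: ab algebra_simps)
    finally show ?thesis by (simp add: power_mult_distrib)
  qed
  obtain \<sigma> :: real where \<sigma>: "\<sigma> = 1 \<or> \<sigma> = -1" and def: "\<And>x y. (x, y) \<noteq> (0, 0) \<Longrightarrow> \<sigma> * f x y > 0"
  proof -
    from assms consider "\<forall>x y. (x, y) \<noteq> (0, 0) \<longrightarrow> f x y > 0" | "\<forall>x y. (x, y) \<noteq> (0, 0) \<longrightarrow> f x y < 0"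
      unfolding definite_form_def f_def by blast
    thus ?thesis
    proof cases
      case 1 thus ?thesis using that[of 1] by simp
    next
      case 2 thus ?thesis using that[of "-1"] by simp
    qed
  qed
  have "even r"
  proof (rule ccontr)
    assume "odd r"
    hence "f (- 1) (- 0) = - f 1 0" unfolding f_def by (subst form_minus) simp
    thus False using def[of 1 0] def[of "-1" 0] by simp
  qed
  define e where "e = a * b' - b * a'"
  have "\<alpha> * \<delta> - \<beta> * \<gamma> = \<tau> * \<tau>' * of_real e" by (simp add: ab e_def algebra_simps)
  hence e0: "e \<noteq> 0" using diag by (auto simp: diagonalized_by_def)
  have er: "e ^ r > 0" using e0 \<open>even r\<close> by (simp add: zero_less_power_eq)
  define t1 t2 where "t1 = f b' (- a') / e ^ r" and "t2 = f b (- a) / e ^ r"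
  have er0: "e ^ r \<noteq> 0" using e0 by simp
  have quotient: "z = of_real (y / E)" if "complex_of_real y = z * of_real E" "E \<noteq> 0" for z y E
    using that by (simp add: field_simps)
  have T1: "\<tau> ^ r = of_real t1"
  proof -
    have l: "a * b' + b * (- a') = e" "a' * b' + b' * (- a') = 0" by (simp_all add: e_def)
    have "complex_of_real (f b' (- a')) = \<tau> ^ r * of_real (e ^ r)"
      unfolding f l using r5 by (simp add: power_0_left)
    thus ?thesis unfolding t1_def by (rule quotient) fact
  qed
  have T2: "- (\<tau>' ^ r) = of_real t2"
  proof -
    have l: "a * b + b * (- a) = 0" "a' * b + b' * (- a) = - e" by (simp_all add: e_def)
    have "complex_of_real (f b (- a)) = - (\<tau>' ^ r) * of_real (e ^ r)"
      unfolding f l using r5 \<open>even r\<close> by (simp add: power_0_left)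
    thus ?thesis unfolding t2_def by (rule quotient) fact
  qed
  have "(b', - a') \<noteq> (0, 0)" "(b, - a) \<noteq> (0, 0)" using e0 by (auto simp: e_def)
  hence pos: "\<sigma> * t1 > 0" "\<sigma> * t2 > 0"
    using def er by (simp_all add: t1_def t2_def)
  obtain x y where xy: "p = (x, y)" by (cases p)
  define l m where "l = (a * of_int x + b * of_int y) ^ r" and "m = (a' * of_int x + b' * of_int y) ^ r"
  have lm: "l \<ge> 0" "m \<ge> 0" using \<open>even r\<close> by (simp_all add: l_def m_def zero_le_even_power)
  have "xi p = \<tau> * of_real (a * of_int x + b * of_int y)"
    unfolding xi_def xy by (simp add: ab algebra_simps)
  hence X: "xi p ^ r = of_real (t1 * l)"
    by (simp only: power_mult_distrib T1 l_def of_real_mult of_real_power)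
  have T2': "\<tau>' ^ r = - of_real t2" using T2 by (metis minus_minus)
  have "eta p = \<tau>' * of_real (a' * of_int x + b' * of_int y)"
    unfolding eta_def xy by (simp add: ab algebra_simps)
  hence E: "eta p ^ r = - of_real (t2 * m)"
    by (simp only: power_mult_distrib T2' m_def of_real_mult of_real_power mult_minus_left)
  have "complex_of_real (of_int (F p)) = of_real (t1 * l + t2 * m)"
    using F_eq[of p] unfolding X E by simp
  hence Fp: "of_int (F p) = t1 * l + t2 * m" by (simp only: of_real_eq_iff)
  have "cmod (xi p) ^ r = \<sigma> * t1 * l" "cmod (eta p) ^ r = \<sigma> * t2 * m"
    using X E pos lm \<sigma> by (auto simp: norm_power[symmetric] norm_mult)
  moreover have "\<sigma> * of_int (F p) = \<sigma> * t1 * l + \<sigma> * t2 * m" by (simp add: Fp algebra_simps)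
  moreover have "\<sigma> * of_int (F p) \<le> \<bar>of_int (F p)\<bar>" using \<sigma> by auto
  moreover have "0 \<le> \<sigma> * t1 * l" "0 \<le> \<sigma> * t2 * m" using pos lm by simp_all
  moreover have "real_of_int \<bar>F p\<bar> \<le> real h"
    using p unfolding large_solution_def solution_def by linarith
  ultimately have "cmod (xi p) ^ r \<le> real h" "cmod (eta p) ^ r \<le> real h" by auto
  hence "maxnorm p ^ r \<le> real h" by (simp add: maxnorm_def max_def)
  thus False using maxnorm_power_ge(1)[of p] p h_ge_1 by (simp add: large_solution_def)
qed

lemma num_solutions_definite: "definite_form r c \<Longrightarrow> num_solutions r c h \<le> 1"
  using num_solutions_le[of "{}"] definite_no_large_solution by (simp add: one_enat_def)

end

end

theorem corollary1p5:
  fixes r h :: nat and c :: "nat \<Rightarrow> int"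
    and \<alpha> \<beta> \<gamma> \<delta> \<kappa> :: complex and A B C D :: int
  assumes "r \<ge> 5" and "h > 0"
    and "diagonalized_by r c \<alpha> \<beta> \<gamma> \<delta>"
    and "associated_quadratic \<alpha> \<beta> \<gamma> \<delta> \<kappa> A B C"
    and "D = B\<^sup>2 - 4 * A * C"
    and "normalized_disc r c h \<ge>
           real r powr (7 * real r * (real r - 1) / (real r - 4)) *
           real h powr ((real r - 1) * ((real r)\<^sup>2 + real r + 2) / (real r * (real r - 4)))"
  shows "(D < 0 \<longrightarrow> num_solutions r c h \<le> enat (3 * r)) \<and>
         (D > 0 \<and> even r \<and> indefinite_form r c \<longrightarrow> num_solutions r c h \<le> 6) \<and>
         (D > 0 \<and> odd r \<and> indefinite_form r c \<longrightarrow> num_solutions r c h \<le> 3) \<and>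
         (D > 0 \<and> definite_form r c \<longrightarrow> num_solutions r c h \<le> 1)"
proof (cases "D = 0")
  case False
  define g where "g = gcd A (gcd B C)"
  have "g \<noteq> 0" using False assms(5) by (auto simp: g_def)
  hence g: "g > 0" by (simp add: g_def order_less_le)
  have "g dvd A" "g dvd B" "g dvd C" unfolding g_def by (auto intro: dvd_trans)
  then obtain A' B' C' where ABC: "A = g * A'" "B = g * B'" "C = g * C'" by (auto elim!: dvdE)
  have "g = g * gcd A' (gcd B' C')"
    using g by (subst (1) g_def) (simp add: ABC gcd_mult_distrib_int[symmetric])
  hence prim: "gcd A' (gcd B' C') = 1" using \<open>g \<noteq> 0\<close> by simp
  define D' where "D' = B'\<^sup>2 - 4 * A' * C'"
  have D: "D = g\<^sup>2 * D'" unfolding assms(5) ABC D'_def by (simp add: power2_eq_square algebra_simps)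
  have sgn: "D > 0 \<longleftrightarrow> D' > 0" using g by (simp add: D zero_less_mult_iff)
  interpret large_diagonal_form r c \<alpha> \<beta> \<gamma> \<delta> "\<kappa> * of_int g" A' B' C' D' h "cmod (\<alpha> * \<delta> - \<beta> * \<gamma>) / 2"
  proof -
    interpret diagonal_form r c \<alpha> \<beta> \<gamma> \<delta> "\<kappa> * of_int g" A' B' C' D'
    proof
      show "associated_quadratic \<alpha> \<beta> \<gamma> \<delta> (\<kappa> * of_int g) A' B' C'"
        using assms(4) by (simp add: associated_quadratic_def ABC algebra_simps)
    qed (use assms D'_def in auto)
    show "large_diagonal_form r c \<alpha> \<beta> \<gamma> \<delta> (\<kappa> * of_int g) A' B' C' D' h (cmod (\<alpha> * \<delta> - \<beta> * \<gamma>) / 2)"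
      by unfold_locales
         (use assms(1,2) prim half_jdet_lower_bounds[OF assms(1,2,3,6)] in \<open>simp_all add: jdet_def\<close>)
  qed
  show ?thesis
    using num_solutions_general num_solutions_real num_solutions_real_odd num_solutions_definite
    by (auto simp: sgn)
qed simp

end
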